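(* Let $\gamma$ be the Euler constant and, for $z\in\mathbb{C}\setminus(-\infty,0]$ and $\lambda\in S^1$, let $$\phi(z,\lambda)=\begin{pmatrix}\sqrt{-\gamma}&-\lambda/\sqrt{-\gamma}\\0&1/\sqrt{-\gamma}\end{pmatrix}\begin{pmatrix}1&0\\\lambda^{-1}\log\frac z2&1\end{pmatrix}\begin{pmatrix}y_0&\lambda z(y_0)_z\\\frac14y_1&y_0+\lambda z\frac14(y_1)_z\end{pmatrix},$$ where $$y_0(z,\lambda)=\sum_{j\ge0}\frac{\lambda^{-2j}z^{4j}}{16^j(j!)^2},\qquad y_1(z,\lambda)=-2\lambda^{-1}\sum_{j\ge1}\Big(1+\cdots+\frac1j\Big)\frac{\lambda^{-2j}z^{4j}}{16^j(j!)^2}.$$ Then $\phi$ admits an Iwasawa factorization $$\phi=F\begin{pmatrix}0&\lambda\\-\lambda^{-1}&0\end{pmatrix}B$$ on all of $\mathbb{C}\setminus(-\infty,0]$; that is, for every $z\in\mathbb{C}\setminus(-\infty,0]$ there are $F(z,\cdot)\in(\Lambda\mathrm{SU}_{1,1})_\sigma$ and $B(z,\cdot)\in(\Lambda^{+,>0}\mathrm{SL}_2\mathbb{C})_\sigma$ such that this identity holds for all $\lambda\in S^1$.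
   Context: $\log$ is the principal branch on $\mathbb{C}\setminus(-\infty,0]$ and $\sqrt{-\gamma}=i\sqrt\gamma$; the subscript $z$ denotes $\partial/\partial z$. Let $\sigma(X)=\mathrm{diag}(1,-1)\,X\,\mathrm{diag}(1,-1)$ for $2\times2$ complex matrices $X$. $(\Lambda\mathrm{SL}_2\mathbb{C})_\sigma$ is the group of smooth maps $\gamma:S^1\to\mathrm{SL}_2\mathbb{C}$ with $\gamma(-\lambda)=\sigma(\gamma(\lambda))$. $(\Lambda^{+}\mathrm{SL}_2\mathbb{C})_\sigma$ is the subgroup of those loops that extend holomorphically to the disc $\{|\lambda|<1\}$ with values in $\mathrm{SL}_2\mathbb{C}$ (with boundary values the given loop). $(\Lambda^{+,>0}\mathrm{SL}_2\mathbb{C})_\sigma$ is the subgroup of those $\gamma\in(\Lambda^{+}\mathrm{SL}_2\mathbb{C})_\sigma$ with $\gamma(0)=\mathrm{diag}(\rho,\rho^{-1})$ for some $\rho>0$. $(\Lambda\mathrm{SU}_{1,1})_\sigma$ is the subgroup of those $F\in(\Lambda\mathrm{SL}_2\mathbb{C})_\sigma$ with $F(\lambda)\,\mathrm{diag}(1,-1)\,\overline{F(\overline{\lambda^{-1}})}^{\,t}=\mathrm{diag}(1,-1)$ for $\lambda\in S^1$. *)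

theory Defs
  imports "HOL-Analysis.Analysis"
begin

type_synonym cmat2 = "complex^2^2"

definition mat22 :: "complex \<Rightarrow> complex \<Rightarrow> complex \<Rightarrow> complex \<Rightarrow> cmat2" where
  "mat22 a b c d = vector [vector [a, b], vector [c, d]]"

definition sigma3 :: cmat2 where
  "sigma3 = mat22 1 0 0 (-1)"

definition twist :: "cmat2 \<Rightarrow> cmat2" where
  "twist X = sigma3 ** X ** sigma3"

definition SL2C :: "cmat2 set" where
  "SL2C = {X. det X = 1}"

text \<open>
  A map on the unit circle is represented by a function on the whole complex plane; only its
  values on the circle are ever used.  It is smooth iff its composition with the covering
  \<open>t \<mapsto> exp (i t)\<close> has derivatives of all orders, \<open>D n\<close> being the \<open>n\<close>-th one.
\<close>

definition smooth_on_circle :: "(complex \<Rightarrow> 'a::real_normed_vector) \<Rightarrow> bool" where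
  "smooth_on_circle g \<longleftrightarrow>
     (\<exists>D :: nat \<Rightarrow> real \<Rightarrow> 'a. (\<forall>t. D 0 t = g (cis t)) \<and>
        (\<forall>n t. (D n has_vector_derivative D (Suc n) t) (at t)))"

definition Loop_SL2C :: "(complex \<Rightarrow> cmat2) set" where
  "Loop_SL2C = {g. smooth_on_circle g \<and>
     (\<forall>l\<in>sphere 0 1. g l \<in> SL2C \<and> g (- l) = twist (g l))}"

text \<open>
  The holomorphic extension is continuous up to the boundary and agrees with the loop there.
\<close>

definition disc_extension :: "(complex \<Rightarrow> cmat2) \<Rightarrow> (complex \<Rightarrow> cmat2) \<Rightarrow> bool" where
  "disc_extension g G \<longleftrightarrow>
     continuous_on (cball 0 1) G \<and>
     (\<forall>i j. (\<lambda>l. G l $ i $ j) holomorphic_on ball 0 1) \<and>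
     (\<forall>l\<in>ball 0 1. G l \<in> SL2C) \<and>
     (\<forall>l\<in>sphere 0 1. G l = g l)"

definition Loop_plus_SL2C :: "(complex \<Rightarrow> cmat2) set" where
  "Loop_plus_SL2C = {g \<in> Loop_SL2C. \<exists>G. disc_extension g G}"

text \<open>
  The value at \<open>0\<close> is that of the extension, which is unique on the closed disc; the value
  at \<open>0\<close> of the function representing the loop itself carries no information.
\<close>

definition Loop_plus_pos_SL2C :: "(complex \<Rightarrow> cmat2) set" where
  "Loop_plus_pos_SL2C = {g \<in> Loop_plus_SL2C.
     \<exists>G. disc_extension g G \<and>
       (\<exists>\<rho>::real. \<rho> > 0 \<and> G 0 = mat22 (of_real \<rho>) 0 0 (of_real (inverse \<rho>)))}"

definition Loop_SU11 :: "(complex \<Rightarrow> cmat2) set" where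
  "Loop_SU11 = {F \<in> Loop_SL2C. \<forall>l\<in>sphere 0 1.
     F l ** sigma3 ** transpose (map_matrix cnj (F (cnj (inverse l)))) = sigma3}"

definition y0 :: "complex \<Rightarrow> complex \<Rightarrow> complex" where
  "y0 z l = (\<Sum>j. l powi (- 2 * int j) * z ^ (4 * j) / (16 ^ j * (fact j)\<^sup>2))"

text \<open>The series for \<open>y1\<close> starts at \<open>j = 1\<close>, hence the shift by \<open>Suc\<close>.\<close>

definition y1 :: "complex \<Rightarrow> complex \<Rightarrow> complex" where
  "y1 z l = - 2 * inverse l *
     (\<Sum>i. let j = Suc i in
        harm j * (l powi (- 2 * int j) * z ^ (4 * j) / (16 ^ j * (fact j)\<^sup>2)))"

text \<open>The square root of minus the Euler constant, with the branch \<open>sqrt (- x) = i sqrt x\<close>.\<close>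

definition sqrt_neg_euler :: complex where
  "sqrt_neg_euler = \<i> * of_real (sqrt euler_mascheroni)"

definition phi :: "complex \<Rightarrow> complex \<Rightarrow> cmat2" where
  "phi z l =
     mat22 sqrt_neg_euler (- l / sqrt_neg_euler)
           0              (1 / sqrt_neg_euler) **
     mat22 1                       0
           (inverse l * Ln (z / 2)) 1 **
     mat22 (y0 z l)         (l * z * deriv (\<lambda>w. y0 w l) z)
           (1 / 4 * y1 z l) (y0 z l + l * z * (1 / 4) * deriv (\<lambda>w. y1 w l) z)"

definition omega :: "complex \<Rightarrow> cmat2" where
  "omega l = mat22 0 l (- inverse l) 0"

end

theory Submission
  imports Defs "HOL-Complex_Analysis.Complex_Analysis"
begin

text \<open>
  Put \<open>x = z\<^sup>2/(2\<lambda>)\<close>, \<open>t = |z|\<^sup>2/2\<close> and \<open>w = t/x\<close>, so that \<open>|w| = 1\<close>. On the circle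
  \<open>\<phi>\<^sup>* \<sigma>\<^sub>3 \<phi> = - M\<close>, where \<open>M = (r\<^sup>* k + k\<^sup>* r)/2\<close> and the rows \<open>r\<close>, \<open>k\<close> are
  \<open>(f, 2\<lambda> x f')\<close> for the modified Bessel functions \<open>f = I\<^sub>0(x)\<close> and \<open>f = K\<^sub>0(x)\<close>; the Euler constant
  enters exactly so as to produce the decaying solution \<open>K\<^sub>0\<close>. The claim is that
  \<open>M = B\<^sup>* \<sigma>\<^sub>3 B\<close> with \<open>B\<close> holomorphic in the disc.

  If \<open>a\<close> is the first column of \<open>B\<^sup>-\<^sup>1\<close>, then \<open>a\<close> is holomorphic inside and \<open>c = M a\<close> outside the circle, so
  \<open>P = r a\<close> and \<open>Q = k a\<close> continue to \<open>w \<noteq> 0\<close>, \<open>P\<close> single-valued and \<open>Q\<close> with the monodromy of \<open>K\<^sub>0\<close>.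
  With \<open>Q = w\<^sup>1\<^sup>/\<^sup>2 exp (- t (w + 1/w)) g(w)\<close>, monodromy and growth amount to the integral equation
  \<open>g(w) = 1 + (1/\<pi>) \<integral>\<^sub>0\<^sup>\<infinity> exp (- 2t (s + 1/s)) g(s) / (s + w) ds\<close>. This is a contraction for every
  \<open>t > 0\<close>, with a positive solution. Reading the argument backwards from \<open>g\<close> gives \<open>a\<close> and \<open>c\<close>; the second
  column of \<open>B\<^sup>-\<^sup>1\<close> is \<open>(- c\<^sub>2\<^sup>*, c\<^sub>1\<^sup>*)\<close>, and by Liouville's theorem \<open>a\<^sup>* c\<close> is the constant
  \<open>g(0)/\<pi> > 0\<close>, which provides the normalisation of \<open>B\<close> and the sign \<open>\<omega>\<close> accounts for.
\<close>

section \<open>Modified Bessel functions of order zero\<close>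

text \<open>The integral equation is a jump condition. Monodromy expresses \<open>P\<close> by
  \<open>Q (- w) - Q w\<close>, with opposite signs in the two half-planes. The two expressions
  match at \<open>s > 0\<close> iff the boundary values of \<open>Q\<close> at \<open>- s\<close>
  from above and below add up to \<open>2 * Q s\<close>. The prefactor of \<open>g\<close> turns
  this sum into a difference: \<open>g\<close> must jump by
  \<open>- 2 * \<i> * exp (- 2 * t * (s + 1 / s)) * g s\<close> at \<open>- s\<close>, which a
  Cauchy integral tending to 1 at infinity achieves. The exponential in the prefactor cancels the
  growth of the Bessel functions of \<open>t / w\<close> at \<open>w = 0\<close>; the half power
  leaves a singularity of order at most 1/2 there, which is removable. This cancellation shapes the
  analytic work: it needs \<open>K0\<close> of size \<open>exp (- Re x)\<close> and
  \<open>I0\<close> of size \<open>exp (Re x)\<close> in the right half-plane, with constants that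
  do not deteriorate at the imaginary axis. The functions are given by series, and that gamma
  singles out the decaying solution has to be proved; the integrals that yield the bounds are tied
  to the series through the differential equation alone.\<close>

definition bcoeff :: "nat \<Rightarrow> complex" where "bcoeff j = 1 / (fact j)\<^sup>2"
definition hcoeff :: "nat \<Rightarrow> complex" where "hcoeff j = harm j / (fact j)\<^sup>2"
definition pser :: "(nat \<Rightarrow> complex) \<Rightarrow> complex \<Rightarrow> complex" where "pser c q = (\<Sum>j. c j * q ^ j)"

text \<open>The majorant is the exponential series at \<open>2 * norm q\<close>. It is loose enough
  to absorb factors \<open>j\<close> and \<open>harm j\<close> in the coefficients, so all four
  series below are entire for the same reason.\<close>

lemma pser_summable:
  fixes c :: "nat \<Rightarrow> complex"
  assumes "\<And>j. norm (c j) \<le> 2 ^ j / fact j"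
  shows "summable (\<lambda>j. c j * q ^ j)"
proof (rule summable_comparison_test'[where N = 0])
  show "summable (\<lambda>j. (2 * norm q) ^ j /\<^sub>R fact j)"
    by (rule summable_exp_generic)
  fix j :: nat
  have "norm (c j * q ^ j) \<le> 2 ^ j / fact j * norm q ^ j"
    unfolding norm_mult norm_power by (intro mult_right_mono assms) auto
  then show "norm (c j * q ^ j) \<le> (2 * norm q) ^ j /\<^sub>R fact j"
    by (simp add: power_mult_distrib field_simps)
qed

text \<open>Phrased through \<open>q * d\<close>, that is, the Euler operator, which multiplies the
  \<open>j\<close>-th coefficient by \<open>j\<close> without shifting indices. Bessel's equation
  then becomes a recursion for coefficients.\<close>

lemma pser_deriv:
  fixes c :: "nat \<Rightarrow> complex"
  assumes s: "\<And>q. summable (\<lambda>j. c j * q ^ j)"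
  obtains d where "(pser c has_field_derivative d) (at q)" "q * d = pser (\<lambda>j. of_nat j * c j) q"
proof -
  have d: "(pser c has_field_derivative (\<Sum>n. diffs c n * q ^ n)) (at q)"
    unfolding pser_def by (rule termdiffs_strong_converges_everywhere) (rule s)
  have sd: "summable (\<lambda>n. diffs c n * q ^ n)"
    by (rule termdiff_converges_all) (rule s)
  have sm: "(\<lambda>n. q * (diffs c n * q ^ n)) sums (q * (\<Sum>n. diffs c n * q ^ n))"
    by (intro sums_mult summable_sums sd)
  have "(\<lambda>n. of_nat (Suc n) * c (Suc n) * q ^ Suc n) sums (q * (\<Sum>n. diffs c n * q ^ n))"
    using sm by (simp add: diffs_def mult_ac)
  then have "(\<lambda>n. of_nat n * c n * q ^ n) sums (q * (\<Sum>n. diffs c n * q ^ n))"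
    by (subst (asm) sums_Suc_iff) simp
  then show ?thesis using that d by (simp add: pser_def sums_iff)
qed

lemma of_nat_le_fact: "real j \<le> fact j"
  by (metis fact_ge_self of_nat_fact of_nat_le_iff)

lemma harm_le: "(harm j :: real) \<le> real j"
proof -
  have "(harm j :: real) \<le> (\<Sum>k=1..j. 1)"
    unfolding harm_def by (intro sum_mono) (auto simp: inverse_le_1_iff)
  then show ?thesis by simp
qed

lemma bcoeff_bound: "norm (bcoeff j) \<le> 2 ^ j / fact j"
proof -
  have "(1::real) / (fact j)\<^sup>2 \<le> 1 / fact j"
    by (intro divide_left_mono) (auto simp: power2_eq_square fact_ge_1)
  also have "\<dots> \<le> 2 ^ j / fact j" by (intro divide_right_mono) auto
  finally show ?thesis by (simp add: bcoeff_def norm_divide norm_power)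
qed

lemma square_div_fact_bound: "real j * real j / (fact j)\<^sup>2 \<le> 2 ^ j / fact j"
proof -
  have "real j * real j / (fact j)\<^sup>2 = (real j / fact j) * (real j / fact j)"
    by (simp add: power2_eq_square)
  also have "\<dots> \<le> 1 * (2 ^ j / fact j)"
    using of_nat_le_fact[of j] of_nat_less_two_power[of j, where 'a=real]
    by (intro mult_mono divide_right_mono) (auto simp: less_imp_le)
  finally show ?thesis by simp
qed

lemma jbcoeff_bound: "norm (of_nat j * bcoeff j) \<le> 2 ^ j / fact j"
proof -
  have "real j / (fact j)\<^sup>2 \<le> real j * real j / (fact j)\<^sup>2"
    by (intro divide_right_mono) (cases j, auto)
  with square_div_fact_bound[of j] show ?thesis by (simp add: bcoeff_def norm_divide norm_mult norm_power)
qed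

lemma norm_harm': "norm (harm j :: complex) = harm j"
  by (simp add: norm_harm)

lemma jhcoeff_bound: "norm (of_nat j * hcoeff j) \<le> 2 ^ j / fact j"
proof -
  have "real j * harm j / (fact j)\<^sup>2 \<le> real j * real j / (fact j)\<^sup>2"
    by (intro divide_right_mono mult_left_mono harm_le) auto
  with square_div_fact_bound[of j] show ?thesis 
    by (simp add: hcoeff_def norm_divide norm_mult norm_power norm_harm')
qed

lemma hcoeff_bound: "norm (hcoeff j) \<le> 2 ^ j / fact j"
proof (cases "j = 0")
  case False
  have "harm j / (fact j)\<^sup>2 \<le> real j * harm j / (fact j)\<^sup>2"
    using False by (intro divide_right_mono mult_right_mono[of 1 _ "harm j", simplified] harm_nonneg) auto
  with jhcoeff_bound[of j] show ?thesis 
    by (simp add: hcoeff_def norm_divide norm_mult norm_power norm_harm')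
qed (auto simp: hcoeff_def harm_def)

lemmas bcoeff_summable = pser_summable[of bcoeff, OF bcoeff_bound]
lemmas jbcoeff_summable = pser_summable[of "\<lambda>j. of_nat j * bcoeff j", OF jbcoeff_bound]
lemmas hcoeff_summable = pser_summable[of hcoeff, OF hcoeff_bound]
lemmas jhcoeff_summable = pser_summable[of "\<lambda>j. of_nat j * hcoeff j", OF jhcoeff_bound]

text \<open>Bessel's equation read off the coefficients: \<open>j * j * bcoeff j\<close> equals
  \<open>bcoeff (j - 1)\<close> for positive \<open>j\<close>.\<close>

lemma pser_jjbcoeff: "pser (\<lambda>j. of_nat j * (of_nat j * bcoeff j)) q = q * pser bcoeff q"
proof -
  have "(\<lambda>n. q * (bcoeff n * q ^ n)) sums (q * pser bcoeff q)"
    unfolding pser_def by (intro sums_mult summable_sums bcoeff_summable)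
  moreover have "q * (bcoeff n * q ^ n) = of_nat (Suc n) * (of_nat (Suc n) * bcoeff (Suc n)) * q ^ Suc n" for n
    by (simp add: bcoeff_def power2_eq_square field_simps del: of_nat_Suc)
  ultimately have "(\<lambda>n. of_nat (Suc n) * (of_nat (Suc n) * bcoeff (Suc n)) * q ^ Suc n) sums (q * pser bcoeff q)"
    by simp
  then have "(\<lambda>n. of_nat n * (of_nat n * bcoeff n) * q ^ n) sums (q * pser bcoeff q)"
    by (subst (asm) sums_Suc_iff) simp
  then show ?thesis by (simp add: pser_def sums_iff)
qed

text \<open>The extra series comes from \<open>harm j = harm (j - 1) + 1 / j\<close>. It is what the
  derivative of the logarithm in \<open>K0\<close> will cancel.\<close>

lemma pser_jjhcoeff: "pser (\<lambda>j. of_nat j * (of_nat j * hcoeff j)) q = q * pser hcoeff q + pser (\<lambda>j. of_nat j * bcoeff j) q"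
proof -
  have s1: "(\<lambda>n. q * (hcoeff n * q ^ n)) sums (q * pser hcoeff q)"
    unfolding pser_def by (intro sums_mult summable_sums hcoeff_summable)
  have "(\<lambda>n. of_nat n * bcoeff n * q ^ n) sums (pser (\<lambda>j. of_nat j * bcoeff j) q)"
    unfolding pser_def by (intro summable_sums jbcoeff_summable)
  then have s2: "(\<lambda>n. of_nat (Suc n) * bcoeff (Suc n) * q ^ Suc n) sums (pser (\<lambda>j. of_nat j * bcoeff j) q)"
    by (subst sums_Suc_iff) simp
  have e: "q * (hcoeff n * q ^ n) + of_nat (Suc n) * bcoeff (Suc n) * q ^ Suc n
      = of_nat (Suc n) * (of_nat (Suc n) * hcoeff (Suc n)) * q ^ Suc n" for n
  proof -
    have h: "(harm (Suc n) :: complex) = harm n + 1 / of_nat (Suc n)"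
      by (simp add: harm_Suc inverse_eq_divide)
    show ?thesis unfolding hcoeff_def bcoeff_def h
      by (simp add: power2_eq_square divide_simps del: of_nat_Suc) (simp add: algebra_simps)
  qed
  have "(\<lambda>n. of_nat (Suc n) * (of_nat (Suc n) * hcoeff (Suc n)) * q ^ Suc n) sums 
      (q * pser hcoeff q + pser (\<lambda>j. of_nat j * bcoeff j) q)"
    using sums_add[OF s1 s2] unfolding e .
  then have "(\<lambda>n. of_nat n * (of_nat n * hcoeff n) * q ^ n) sums (q * pser hcoeff q + pser (\<lambda>j. of_nat j * bcoeff j) q)"
    by (subst (asm) sums_Suc_iff) simp
  then show ?thesis by (simp add: pser_def sums_iff)
qed

text \<open>
  Index \<open>1\<close> stands for \<open>x d/dx\<close>: in the usual notation \<open>I1 x\<close> is \<open>x I\<^sub>1(x)\<close> and, below, \<open>K1 x\<close> is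
  \<open>- x K\<^sub>1(x)\<close>.
\<close>

definition I0 :: "complex \<Rightarrow> complex" where "I0 x = pser bcoeff ((x/2)\<^sup>2)"
definition I1 :: "complex \<Rightarrow> complex" where "I1 x = 2 * pser (\<lambda>j. of_nat j * bcoeff j) ((x/2)\<^sup>2)"
definition H0 :: "complex \<Rightarrow> complex" where "H0 x = pser hcoeff ((x/2)\<^sup>2)"
definition H1 :: "complex \<Rightarrow> complex" where "H1 x = 2 * pser (\<lambda>j. of_nat j * hcoeff j) ((x/2)\<^sup>2)"

lemma pser_sq_deriv:
  assumes "\<And>q. summable (\<lambda>j. c j * q ^ j)" "x \<noteq> 0"
  shows "((\<lambda>x. pser c ((x/2)\<^sup>2)) has_field_derivative 2 * pser (\<lambda>j. of_nat j * c j) ((x/2)\<^sup>2) / x) (at x)"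
proof -
  obtain d where d: "(pser c has_field_derivative d) (at ((x/2)\<^sup>2))" 
    "(x/2)\<^sup>2 * d = pser (\<lambda>j. of_nat j * c j) ((x/2)\<^sup>2)" using pser_deriv[OF assms(1)] .
  have "((\<lambda>x. pser c ((x/2)\<^sup>2)) has_field_derivative d * (2 * (x / 2) * (1/2))) (at x)"
    by (rule DERIV_chain2[where f = "pser c" and g = "\<lambda>x. (x/2)\<^sup>2", OF d(1)]) (auto intro!: derivative_eq_intros)
  also have "d * (2 * (x / 2) * (1/2)) = 2 * ((x/2)\<^sup>2 * d) / x"
    using assms(2) by (simp add: power2_eq_square field_simps)
  finally show ?thesis unfolding d(2) .
qed

lemma pser_sq_holo:
  assumes "\<And>q. summable (\<lambda>j. c j * q ^ j)"
  shows "(\<lambda>x. pser c ((x/2)\<^sup>2)) holomorphic_on A"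
proof -
  have "(pser c) holomorphic_on UNIV"
    unfolding holomorphic_on_def field_differentiable_def using pser_deriv[OF assms]
    by (metis iso_tuple_UNIV_I has_field_derivative_at_within)
  then have "(pser c \<circ> (\<lambda>x. (x/2)\<^sup>2)) holomorphic_on A"
    by (intro holomorphic_on_compose_gen[where t = UNIV] holomorphic_intros) auto
  then show ?thesis by (simp add: o_def)
qed

lemma I0_holo: "I0 holomorphic_on A" and I1_holo: "I1 holomorphic_on A"
  and H0_holo: "H0 holomorphic_on A" and H1_holo: "H1 holomorphic_on A"
  unfolding I0_def[abs_def] I1_def[abs_def] H0_def[abs_def] H1_def[abs_def]
  by (intro holomorphic_intros pser_sq_holo bcoeff_summable jbcoeff_summable hcoeff_summable jhcoeff_summable)+

lemma I0_deriv: "x \<noteq> 0 \<Longrightarrow> (I0 has_field_derivative I1 x / x) (at x)"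
  using pser_sq_deriv[OF bcoeff_summable, of x] unfolding I0_def[abs_def] I1_def[abs_def] by simp
lemma H0_deriv: "x \<noteq> 0 \<Longrightarrow> (H0 has_field_derivative H1 x / x) (at x)"
  using pser_sq_deriv[OF hcoeff_summable, of x] unfolding H0_def[abs_def] H1_def[abs_def] by simp
lemma I1_deriv: "x \<noteq> 0 \<Longrightarrow> (I1 has_field_derivative x * I0 x) (at x)"
  using DERIV_cmult[OF pser_sq_deriv[OF jbcoeff_summable, of x], of 2] unfolding pser_jjbcoeff I0_def[abs_def] I1_def[abs_def] 
  by (simp add: power2_eq_square field_simps)
lemma H1_deriv: "x \<noteq> 0 \<Longrightarrow> (H1 has_field_derivative x * H0 x + 2 * I1 x / x) (at x)"
  using DERIV_cmult[OF pser_sq_deriv[OF jhcoeff_summable, of x], of 2] unfolding pser_jjhcoeff H0_def[abs_def] H1_def[abs_def] I1_def[abs_def]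
  by (rule DERIV_cong) (simp_all add: power2_eq_square field_simps)

lemma pser_0: "pser c 0 = c 0"
  unfolding pser_def by (subst powser_zero) simp

lemma I0_0: "I0 0 = 1" and I1_0: "I1 0 = 0" and H0_0: "H0 0 = 0" and H1_0: "H1 0 = 0"
  by (simp_all add: I0_def I1_def H0_def H1_def pser_0 bcoeff_def hcoeff_def harm_def)

lemma I0_minus: "I0 (-x) = I0 x" and I1_minus: "I1 (-x) = I1 x"
  and H0_minus: "H0 (-x) = H0 x" and H1_minus: "H1 (-x) = H1 x"
  by (simp_all add: I0_def I1_def H0_def H1_def)

lemma pser_cnj:
  assumes "\<And>q. summable (\<lambda>j. c j * q ^ j)" "\<And>j. cnj (c j) = c j"
  shows "cnj (pser c q) = pser c (cnj q)"
proof -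
  have "(\<lambda>j. c j * q ^ j) sums pser c q" unfolding pser_def by (intro summable_sums assms)
  then have "(\<lambda>j. cnj (c j * q ^ j)) sums cnj (pser c q)" by (simp only: sums_cnj)
  then show ?thesis by (simp add: pser_def sums_iff assms(2))
qed

lemma cnj_bcoeff: "cnj (bcoeff j) = bcoeff j" and cnj_hcoeff: "cnj (hcoeff j) = hcoeff j"
  by (auto simp: bcoeff_def hcoeff_def harm_def)

lemma I0_cnj: "cnj (I0 x) = I0 (cnj x)" and I1_cnj: "cnj (I1 x) = I1 (cnj x)"
  and H0_cnj: "cnj (H0 x) = H0 (cnj x)" and H1_cnj: "cnj (H1 x) = H1 (cnj x)"
  by (simp_all add: I0_def I1_def H0_def H1_def pser_cnj bcoeff_summable jbcoeff_summable hcoeff_summable jhcoeff_summable cnj_bcoeff cnj_hcoeff)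

text \<open>A Wronskian: its derivative vanishes off \<open>0\<close>, where the derivative formulas
  are available, and continuity carries the constant to \<open>0\<close>, where the series give its
  value. The same expression is the determinant of \<open>phi\<close>.\<close>

lemma bessel_det: "(I0 x)\<^sup>2 + I1 x * H0 x - H1 x * I0 x = 1"
proof -
  let ?W = "\<lambda>x. (I0 x)\<^sup>2 + I1 x * H0 x - H1 x * I0 x"
  have "?W x = ?W 0"
  proof (rule DERIV_zero_connected_constant[where S = UNIV and K = "{0}"])
    show "continuous_on UNIV ?W"
      by (intro holomorphic_on_imp_continuous_on holomorphic_intros I0_holo I1_holo H0_holo H1_holo)
    show "\<forall>x\<in>UNIV - {0}. (?W has_field_derivative 0) (at x)"
    proof
      fix x :: complex assume "x \<in> UNIV - {0}"
      then have x: "x \<noteq> 0" by auto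
      show "(?W has_field_derivative 0) (at x)"
        by (rule derivative_eq_intros I0_deriv[OF x] I1_deriv[OF x] H0_deriv[OF x] H1_deriv[OF x] refl)+
           (use x in \<open>simp add: field_simps power2_eq_square\<close>)
    qed
  qed auto
  then show ?thesis by (simp add: I0_0 I1_0 H0_0 H1_0)
qed

section \<open>The logarithmic solution and its connection formula\<close>

definition K0 :: "complex \<Rightarrow> complex" where "K0 x = H0 x - (Ln (x/2) + euler_mascheroni) * I0 x"
definition K1 :: "complex \<Rightarrow> complex" where "K1 x = H1 x - I0 x - (Ln (x/2) + euler_mascheroni) * I1 x"

lemma bessel_wronskian: "I1 x * K0 x - K1 x * I0 x = 1"
  using bessel_det[of x] unfolding K0_def K1_def by algebra

lemma half_slit: "x \<notin> \<real>\<^sub>\<le>\<^sub>0 \<Longrightarrow> x/2 \<notin> (\<real>\<^sub>\<le>\<^sub>0 :: complex set)"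
  by (auto simp: complex_nonpos_Reals_iff)

lemma K0_deriv: "x \<notin> \<real>\<^sub>\<le>\<^sub>0 \<Longrightarrow> (K0 has_field_derivative K1 x / x) (at x)"
  unfolding K0_def[abs_def] K1_def[abs_def]
  by (cases "x = 0", simp)
     (rule derivative_eq_intros I0_deriv I1_deriv H0_deriv H1_deriv refl half_slit | assumption
       | (simp add: field_simps power2_eq_square; fail))+
lemma K1_deriv: "x \<notin> \<real>\<^sub>\<le>\<^sub>0 \<Longrightarrow> (K1 has_field_derivative x * K0 x) (at x)"
  unfolding K0_def[abs_def] K1_def[abs_def]
  by (cases "x = 0", simp)
     (rule derivative_eq_intros I0_deriv I1_deriv H0_deriv H1_deriv refl half_slit | assumption
       | (simp add: field_simps power2_eq_square; fail))+

lemma K0_holo: "A \<subseteq> - \<real>\<^sub>\<le>\<^sub>0 \<Longrightarrow> K0 holomorphic_on A" 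
  unfolding holomorphic_on_def field_differentiable_def using K0_deriv has_field_derivative_at_within by blast
lemma K1_holo: "A \<subseteq> - \<real>\<^sub>\<le>\<^sub>0 \<Longrightarrow> K1 holomorphic_on A" 
  unfolding holomorphic_on_def field_differentiable_def using K1_deriv has_field_derivative_at_within by blast

lemma K0_cnj: "x \<notin> \<real>\<^sub>\<le>\<^sub>0 \<Longrightarrow> cnj (K0 x) = K0 (cnj x)"
  using cnj_Ln[of "x/2"] half_slit[of x]
  by (simp add: K0_def I0_cnj H0_cnj euler_mascheroni_def)
lemma K1_cnj: "x \<notin> \<real>\<^sub>\<le>\<^sub>0 \<Longrightarrow> cnj (K1 x) = K1 (cnj x)"
  using cnj_Ln[of "x/2"] half_slit[of x]
  by (simp add: K1_def I0_cnj I1_cnj H1_cnj euler_mascheroni_def)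

lemma Ln_minus_upper: "Im x > 0 \<Longrightarrow> Ln (- x) = Ln x - \<i> * pi"
  by (subst Ln_minus) auto

lemma Ln_minus_half: "Im x > 0 \<Longrightarrow> Ln (- x / 2) = Ln (x/2) - \<i> * pi"
  using Ln_minus_upper[of "x/2"] by simp

lemma K0_minus: "Im x > 0 \<Longrightarrow> K0 (- x) = K0 x + \<i> * pi * I0 x"
  unfolding K0_def I0_minus H0_minus by (simp only: Ln_minus_half) (simp add: algebra_simps)
lemma K1_minus: "Im x > 0 \<Longrightarrow> K1 (- x) = K1 x + \<i> * pi * I1 x"
  unfolding K1_def I0_minus I1_minus H1_minus by (simp only: Ln_minus_half) (simp add: algebra_simps)

text \<open>\<open>a\<close> and \<open>b\<close> are Wronskians of \<open>Y\<close> with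
  \<open>K0\<close> and with \<open>I0\<close>, constant because all three solve the same equation;
  as \<open>I0\<close> and \<open>K0\<close> have Wronskian 1, Cramer's rule involves no division.
  Integrals are identified below, up to constants, by their differential equation alone.\<close>

lemma bessel_span:
  assumes Y: "\<And>x. Re x > 0 \<Longrightarrow> (Y has_field_derivative Y1 x / x) (at x)"
    and Y1: "\<And>x. Re x > 0 \<Longrightarrow> (Y1 has_field_derivative x * Y x) (at x)"
  obtains a b where "\<And>x. Re x > 0 \<Longrightarrow> Y x = a * I0 x + b * K0 x"
    "\<And>x. Re x > 0 \<Longrightarrow> Y1 x = a * I1 x + b * K1 x"
proof -
  let ?H = "{x. Re x > 0}"
  have conv: "convex ?H" by (rule convex_halfspace_Re_gt)
  have nz: "x \<noteq> 0" "x \<notin> \<real>\<^sub>\<le>\<^sub>0" if "Re x > 0" for x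
    using that by (auto simp: complex_nonpos_Reals_iff)
  have "\<exists>c. \<forall>x\<in>?H. Y1 x * K0 x - Y x * K1 x = c"
  proof (rule has_field_derivative_zero_constant[OF conv])
    fix x assume x: "x \<in> ?H"
    show "((\<lambda>x. Y1 x * K0 x - Y x * K1 x) has_field_derivative 0) (at x within ?H)"
      by (rule has_field_derivative_at_within)
        (use x nz in \<open>auto intro!: derivative_eq_intros Y Y1 K0_deriv K1_deriv simp: field_simps\<close>)
  qed
  then obtain a where a: "\<And>x. Re x > 0 \<Longrightarrow> Y1 x * K0 x - Y x * K1 x = a" by auto
  have "\<exists>c. \<forall>x\<in>?H. Y x * I1 x - Y1 x * I0 x = c"
  proof (rule has_field_derivative_zero_constant[OF conv])
    fix x assume x: "x \<in> ?H"
    show "((\<lambda>x. Y x * I1 x - Y1 x * I0 x) has_field_derivative 0) (at x within ?H)"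
      by (rule has_field_derivative_at_within)
        (use x nz in \<open>auto intro!: derivative_eq_intros Y Y1 I0_deriv I1_deriv simp: field_simps\<close>)
  qed
  then obtain b where b: "\<And>x. Re x > 0 \<Longrightarrow> Y x * I1 x - Y1 x * I0 x = b" by auto
  show ?thesis
  proof (rule that)
    fix x assume x: "Re x > 0"
    have "a * I0 x + b * K0 x = Y x * (I1 x * K0 x - K1 x * I0 x)"
      unfolding a[OF x, symmetric] b[OF x, symmetric] by (simp add: algebra_simps)
    then show "Y x = a * I0 x + b * K0 x" by (simp add: bessel_wronskian)
    have "a * I1 x + b * K1 x = Y1 x * (I1 x * K0 x - K1 x * I0 x)"
      unfolding a[OF x, symmetric] b[OF x, symmetric] by (simp add: algebra_simps)
    then show "Y1 x = a * I1 x + b * K1 x" by (simp add: bessel_wronskian)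
  qed
qed

section \<open>Comparison of K0 with I0 on the positive axis\<close>

lemma harm_upper: "harm j \<le> euler_mascheroni + ln (real j + 1)"
proof (cases j)
  case 0
  then show ?thesis using euler_mascheroni_pos by (simp add: harm_def)
next
  case (Suc n)
  have "0 \<le> 1 / (4 + 2 * real n)" by simp
  moreover have "harm (Suc n) - ln (real n + 2) + 1 / (4 + 2 * real n) \<le> euler_mascheroni"
    using euler_mascheroni_lower[of n] by (simp add: add.commute)
  ultimately have "harm (Suc n) \<le> euler_mascheroni + ln (real n + 2)" by linarith
  then show ?thesis by (simp add: Suc add.commute)
qed

lemma harm_lower: "harm j \<ge> euler_mascheroni + ln (real j + 1) - 1 / (real j + 1)"
proof (cases j)
  case 0
  then show ?thesis using euler_mascheroni_less_13_over_22 by (simp add: harm_def)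
next
  case (Suc n)
  have "1 / real_of_nat (2 * (n + 1)) \<le> 1 / (real j + 1)" 
    using Suc by (intro divide_left_mono) auto
  with euler_mascheroni_upper[of n] Suc show ?thesis by (simp add: add.commute)
qed

text \<open>
  With weights \<open>p\<^sub>j = (x/2)\<^sup>2\<^sup>j / j!\<^sup>2\<close>, the means of \<open>j\<^sup>2\<close> and \<open>(j + 1)\<^sup>-\<^sup>2\<close> are essentially
  \<open>(x/2)\<^sup>2\<close> and \<open>(x/2)\<^sup>-\<^sup>2\<close>, so Jensen's inequality for \<open>ln\<close> (in tangent line form) shows that the mean of the harmonic
  numbers is \<open>ln (x/2) + \<gamma>\<close> up to \<open>2/x\<close>.
\<close>

lemma K0_le_I0:
  fixes x :: real assumes x: "x > 0"
  shows "norm (K0 (of_real x)) \<le> 2 / x * norm (I0 (of_real x))" "norm (I0 (of_real x)) \<ge> 1"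
proof -
  define y where "y = x / 2"
  have y: "y > 0" using x by (simp add: y_def)
  define p where "p = (\<lambda>j::nat. y ^ (2 * j) / (fact j)\<^sup>2)"
  have pc: "bcoeff j * ((of_real x / 2)\<^sup>2) ^ j = of_real (p j)" for j
    by (simp add: bcoeff_def p_def y_def power_mult)
  have pp: "p j \<ge> 0" for j using y by (simp add: p_def)
  define S where "S = suminf p"
  have sp: "summable p" using bcoeff_summable[of "(of_real x/2)\<^sup>2"] unfolding pc by (simp add: summable_of_real_iff)
  then have pS: "p sums S" by (simp add: S_def summable_sums)
  have IS: "I0 (of_real x) = of_real S"
    unfolding I0_def pser_def pc S_def using sp by (simp add: suminf_of_real)
  have p0: "p 0 = 1" by (simp add: p_def)
  have S1: "S \<ge> 1" using sum_le_suminf[OF sp, of "{0}"] pp by (auto simp: p0 S_def)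
  then show "norm (I0 (of_real x)) \<ge> 1" unfolding IS by simp
  have hc: "hcoeff j * ((of_real x / 2)\<^sup>2) ^ j = of_real (harm j * p j)" for j
    by (simp add: hcoeff_def p_def y_def power_mult of_real_harm)
  have sh: "summable (\<lambda>j. harm j * p j)"
    using hcoeff_summable[of "(of_real x/2)\<^sup>2"] unfolding hc by (simp only: summable_of_real_iff)
  define h where "h = (\<Sum>j. harm j * p j)"
  have hS: "(\<lambda>j. harm j * p j) sums h" using sh by (simp add: h_def summable_sums)
  have HS: "H0 (of_real x) = of_real h"
    unfolding H0_def pser_def hc h_def using sh by (simp only: suminf_of_real)
  define L where "L = ln y + euler_mascheroni"
  have Lnx: "Ln (of_real x / 2) = of_real (ln y)"
    using Ln_of_real[OF y] by (simp add: y_def)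
  have KS: "K0 (of_real x) = of_real (h - L * S)"
    unfolding K0_def HS IS Lnx L_def by simp
  have s2: "(\<lambda>j. real j ^ 2 * p j) sums (y\<^sup>2 * S)"
  proof -
    have "real (Suc n) ^ 2 * p (Suc n) = y\<^sup>2 * p n" for n
      using y by (simp add: p_def power2_eq_square power_mult field_simps del: of_nat_Suc)
    then have "(\<lambda>n. real (Suc n) ^ 2 * p (Suc n)) sums (y\<^sup>2 * S)"
      using sums_mult[OF pS, of "y\<^sup>2"] by simp
    then show ?thesis by (subst (asm) sums_Suc_iff) simp
  qed
  have s3: "(\<lambda>j. y\<^sup>2 * (p j / (real j + 1)\<^sup>2)) sums (S - 1)"
  proof -
    have "y\<^sup>2 * (p j / (real j + 1)\<^sup>2) = p (Suc j)" for j
      by (simp add: p_def power2_eq_square power_mult field_simps)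
    moreover have "(\<lambda>j. p (Suc j)) sums (S - 1)"
      by (subst sums_Suc_iff) (simp add: p0 pS)
    ultimately show ?thesis by simp
  qed
  have s3': "(\<lambda>j. p j / (real j + 1)\<^sup>2) sums ((S - 1) / y\<^sup>2)"
    using sums_divide[OF s3, of "y\<^sup>2"] y by simp
  have up: "h - L * S \<le> S / y"
  proof -
    \<comment> \<open>The tangent to \<open>ln\<close> is taken at \<open>a\<^sup>2\<close>, a bound
      for the mean of \<open>(j + 1)\<^sup>2\<close>: the mean of \<open>j\<^sup>2\<close> is
      \<open>y\<^sup>2\<close>, AM-GM replaces \<open>2 * j\<close> by
      \<open>j\<^sup>2 / y + y\<close>, and \<open>(1 + 1 / y) * y\<^sup>2 + a = a\<^sup>2\<close>.
      In the mean the linear terms cancel and \<open>ln (a / y) \<le> 1 / y\<close> remains.\<close>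
    define a where "a = y + 1"
    have a: "a > 0" using y by (simp add: a_def)
    have tm: "harm j * p j - L * p j \<le> (ln a - ln y - 1/2 + a / (2 * a\<^sup>2)) * p j + (1 + 1 / y) / (2 * a\<^sup>2) * (real j ^ 2 * p j)" for j
    proof -
      have "harm j - L \<le> ln (real j + 1) - ln y" using harm_upper[of j] by (simp add: L_def)
      also have "ln (real j + 1) = ln a + ln ((real j + 1) / a)" using a by (simp add: ln_div)
      also have "ln ((real j + 1) / a) = ln (((real j + 1) / a)\<^sup>2) / 2" using a by (simp add: ln_realpow)
      also have "\<dots> \<le> (((real j + 1) / a)\<^sup>2 - 1) / 2" using a by (intro divide_right_mono ln_le_minus_one) auto
      also have "((real j + 1) / a)\<^sup>2 = (real j + 1)\<^sup>2 / a\<^sup>2" by (simp add: power_divide)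
      also have "(real j + 1)\<^sup>2 \<le> (1 + 1 / y) * real j ^ 2 + a"
      proof -
        have "0 \<le> (real j - y)\<^sup>2 / y" using y by simp
        also have "\<dots> = real j ^ 2 / y - 2 * real j + y" using y by (simp add: power2_eq_square field_simps)
        finally have "2 * real j \<le> real j ^ 2 / y + y" by simp
        then show ?thesis by (simp add: a_def power2_eq_square algebra_simps)
      qed
      finally have "harm j - L \<le> ln a + (((1 + 1 / y) * real j ^ 2 + a) / a\<^sup>2 - 1) / 2 - ln y"
        using a by (simp add: divide_right_mono)
      then have "(harm j - L) * p j \<le> (ln a + (((1 + 1 / y) * real j ^ 2 + a) / a\<^sup>2 - 1) / 2 - ln y) * p j"
        by (intro mult_right_mono pp)
      then show ?thesis by (simp add: algebra_simps add_divide_distrib diff_divide_distrib)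
    qed
    have "h - L * S \<le> (ln a - ln y - 1/2 + a / (2 * a\<^sup>2)) * S + (1 + 1 / y) / (2 * a\<^sup>2) * (y\<^sup>2 * S)"
      by (rule sums_le[OF _ sums_diff[OF hS sums_mult[OF pS]] sums_add[OF sums_mult[OF pS] sums_mult[OF s2]]]) (rule tm)
    also have "\<dots> = (ln a - ln y) * S + S * ((a + y\<^sup>2 + y) / a\<^sup>2 - 1) / 2"
      using y a by (simp add: field_simps power2_eq_square)
    also have "a + y\<^sup>2 + y = a\<^sup>2" by (simp add: a_def power2_eq_square algebra_simps)
    also have "ln a - ln y = ln (a / y)" using a y by (simp add: ln_div)
    also have "ln (a / y) \<le> 1 / y" 
    proof -
      have "a / y = 1 + 1 / y" using y by (simp add: a_def field_simps)
      then show ?thesis using ln_add_one_self_le_self[of "1/y"] y by simp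
    qed
    finally show ?thesis using a S1 by (simp add: mult_right_mono)
  qed
  have lo: "- (S / y) \<le> h - L * S"
  proof -
    \<comment> \<open>For the lower bound the tangent is taken at 1 in the variable
      \<open>(y / k)\<^sup>2\<close>, whose mean \<open>(S - 1) / S\<close> is below 1; the error
      \<open>1 / k\<close> of \<open>harm_lower\<close> is turned by AM-GM into terms with known
      means.\<close>
    have tm: "(1/2 - 1 / (2 * y)) * p j - (y\<^sup>2 / 2 + y / 2) * (p j / (real j + 1)\<^sup>2) \<le> harm j * p j - L * p j" for j
    proof -
      define k where "k = real j + 1"
      have k: "k > 0" by (simp add: k_def)
      have "ln y - ln k = ln (y / k)" using y k by (simp add: ln_div)
      also have "\<dots> = ln ((y / k)\<^sup>2) / 2" using y k by (simp add: ln_realpow)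
      also have "\<dots> \<le> ((y / k)\<^sup>2 - 1) / 2" using y k by (intro divide_right_mono ln_le_minus_one) auto
      finally have 1: "ln k - ln y \<ge> (1 - y\<^sup>2 / k\<^sup>2) / 2" by (simp add: power_divide)
      have "0 \<le> (y / k - 1)\<^sup>2 / y" using y by simp
      also have "\<dots> = y / k\<^sup>2 - 2 / k + 1 / y" using y k by (simp add: power2_eq_square field_simps)
      finally have 2: "1 / k \<le> (y / k\<^sup>2 + 1 / y) / 2" by simp
      have "harm j - L \<ge> ln k - ln y - 1 / k" using harm_lower[of j] by (simp add: L_def k_def)
      with 1 2 have "harm j - L \<ge> (1 - y\<^sup>2 / k\<^sup>2) / 2 - (y / k\<^sup>2 + 1 / y) / 2" by linarith
      then have "(harm j - L) * p j \<ge> ((1 - y\<^sup>2 / k\<^sup>2) / 2 - (y / k\<^sup>2 + 1 / y) / 2) * p j"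
        by (intro mult_right_mono pp)
      then show ?thesis unfolding k_def[symmetric] by (simp add: algebra_simps add_divide_distrib diff_divide_distrib)
    qed
    have "(1/2 - 1 / (2 * y)) * S - (y\<^sup>2 / 2 + y / 2) * ((S - 1) / y\<^sup>2) \<le> h - L * S"
      by (rule sums_le[OF _ sums_diff[OF sums_mult[OF pS] sums_mult[OF s3']] sums_diff[OF hS sums_mult[OF pS]]]) (rule tm)
    moreover have "(1/2 - 1 / (2 * y)) * S - (y\<^sup>2 / 2 + y / 2) * ((S - 1) / y\<^sup>2) = - (S / y) + (1/2 + 1 / (2 * y))"
      using y by (simp add: field_simps power2_eq_square)
    moreover have "1/2 + 1 / (2 * y) \<ge> 0" using y by simp
    ultimately show ?thesis by linarith
  qed
  have "\<bar>h - L * S\<bar> \<le> S / y" using up lo by linarith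
  then show "norm (K0 (of_real x)) \<le> 2 / x * norm (I0 (of_real x))"
    unfolding KS IS norm_of_real using S1 by (simp add: y_def mult.commute)
qed

section \<open>Exponential bounds in the right half-plane\<close>

text \<open>A Laplace-type integral with phase \<open>p\<close> and amplitude \<open>m\<close>;
  differentiation in \<open>x\<close> changes only \<open>m\<close>. Classically the phase
  \<open>cosh\<close> on the half-line gives \<open>K0\<close> and the phase \<open>- cos\<close> on
  \<open>{0..pi}\<close> gives \<open>pi * I0\<close>. What is proved below is
  proportionality.\<close>

definition lap :: "(real \<Rightarrow> real) \<Rightarrow> (real \<Rightarrow> real) \<Rightarrow> real \<Rightarrow> real \<Rightarrow> complex \<Rightarrow> complex" where
  "lap m p a b x = integral {a..b} (\<lambda>u. of_real (m u) * exp (- x * of_real (p u)))"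

lemma lap_integrable:
  fixes m p :: "real \<Rightarrow> real"
  assumes "continuous_on {a..b} m" "continuous_on {a..b} p"
  shows "(\<lambda>u. of_real (m u) * exp (- x * of_real (p u) :: complex)) integrable_on {a..b}"
  by (rule integrable_continuous_real) (intro continuous_intros assms)

lemma lap_deriv:
  assumes m: "continuous_on {a..b} m" and p: "continuous_on {a..b} p"
  shows "(lap m p a b has_field_derivative lap (\<lambda>u. - m u * p u) p a b x) (at x)"
proof -
  have "((\<lambda>x. integral (cbox a b) (\<lambda>u. of_real (m u) * exp (- x * of_real (p u)))) has_field_derivative
      integral (cbox a b) (\<lambda>u. of_real (- m u * p u) * exp (- x * of_real (p u)))) (at x within UNIV)"
  proof (rule leibniz_rule_field_derivative)
    show "continuous_on (UNIV \<times> cbox a b) (\<lambda>(x, u). complex_of_real (- m u * p u) * exp (- x * of_real (p u)))"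
      unfolding split_beta
      by (intro continuous_intros continuous_on_compose2[OF m continuous_on_snd] continuous_on_compose2[OF p continuous_on_snd]) auto
  qed (auto intro!: derivative_eq_intros lap_integrable[simplified] m p)
  then show ?thesis by (simp add: lap_def[abs_def])
qed

lemma lap_norm_le:
  assumes ab: "a \<le> b" and m: "continuous_on {a..b} m" and p: "continuous_on {a..b} p"
    and B: "\<And>u. u \<in> {a..b} \<Longrightarrow> \<bar>m u\<bar> \<le> B" and q: "\<And>u. u \<in> {a..b} \<Longrightarrow> p u \<ge> q" and x: "Re x \<ge> 0"
  shows "norm (lap m p a b x) \<le> B * (b - a) * exp (- q * Re x)"
proof -
  have "norm (lap m p a b x) \<le> (B * exp (- q * Re x)) * (b - a)"
    unfolding lap_def
  proof (rule integral_bound[OF ab])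
    show "continuous_on {a..b} (\<lambda>u. complex_of_real (m u) * exp (- x * of_real (p u)))"
      by (intro continuous_intros m p)
    fix u assume u: "u \<in> {a..b}"
    have "Re x * q \<le> Re x * p u" using q[OF u] x by (intro mult_left_mono) auto
    then show "norm (complex_of_real (m u) * exp (- x * of_real (p u))) \<le> B * exp (- q * Re x)"
      unfolding norm_mult using B[OF u] by (intro mult_mono) (auto simp: norm_exp_eq_Re mult.commute)
  qed
  then show ?thesis by (simp add: mult_ac)
qed

text \<open>Integration by parts, with \<open>p\<close> antitone and \<open>sinh u exp (- x cosh u)\<close> the derivative of
  \<open>- exp (- x cosh u) / x\<close>; the estimate is uniform up to the imaginary axis.\<close>

lemma lap_cosh_tail:
  assumes n: "1 \<le> n" and p: "\<And>u. u \<in> {1..n} \<Longrightarrow> (p has_real_derivative p' u) (at u)"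
    and p': "continuous_on {1..n} p'" "\<And>u. u \<in> {1..n} \<Longrightarrow> p' u \<le> 0" and pn: "p n \<ge> 0"
    and x: "Re x \<ge> 0" "x \<noteq> 0"
  shows "norm (lap (\<lambda>u. p u * sinh u) cosh 1 n x) \<le> 2 * p 1 * exp (- Re x) / norm x"
proof -
  let ?e = "\<lambda>u::real. exp (- x * of_real (cosh u))"
  have cp: "continuous_on {1..n} p"
    using p by (meson DERIV_isCont continuous_at_imp_continuous_on)
  have ne: "norm (?e u) \<le> exp (- Re x)" for u
  proof -
    have "Re x * 1 \<le> Re x * cosh u" by (intro mult_left_mono cosh_real_ge_1 x)
    then show ?thesis by (simp add: norm_exp_eq_Re)
  qed
  have d: "((\<lambda>u. of_real (p u) * ?e u) has_vector_derivative 
      (of_real (p' u) * ?e u - x * (of_real (p u * sinh u) * ?e u))) (at u within {1..n})" if u: "u \<in> {1..n}" for u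
  proof -
    note dp = has_vector_derivative_of_real[OF has_field_derivative_at_within[OF p[OF u]]]
    have "((\<lambda>z. exp (- x * cosh z)) has_field_derivative (- x * sinh (of_real u)) * exp (- x * cosh (of_real u))) (at (of_real u))"
      by (auto intro!: derivative_eq_intros)
    from has_vector_derivative_real_field[OF this, of "{1..n}"]
    have de: "(?e has_vector_derivative (- x * of_real (sinh u)) * ?e u) (at u within {1..n})"
      by (simp add: cosh_field_def sinh_field_def flip: exp_of_real)
    show ?thesis using has_vector_derivative_mult[OF dp de] by (simp add: algebra_simps)
  qed
  from fundamental_theorem_of_calculus[OF n d]
  have ftc: "((\<lambda>u. of_real (p' u) * ?e u - x * (of_real (p u * sinh u) * ?e u)) has_integral
      (of_real (p n) * ?e n - of_real (p 1) * ?e 1)) {1..n}" by simp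
  have csh: "continuous_on {1..n} sinh" "continuous_on {1..n} (cosh :: real \<Rightarrow> real)"
    by (intro continuous_intros)+
  have i1: "((\<lambda>u. of_real (p' u) * ?e u) has_integral lap p' cosh 1 n x) {1..n}"
    unfolding lap_def by (intro integrable_integral lap_integrable p' csh)
  have i2: "((\<lambda>u. of_real (p u * sinh u) * ?e u) has_integral lap (\<lambda>u. p u * sinh u) cosh 1 n x) {1..n}"
    unfolding lap_def by (intro integrable_integral lap_integrable cp continuous_intros csh)
  have "of_real (p n) * ?e n - of_real (p 1) * ?e 1 = lap p' cosh 1 n x - x * lap (\<lambda>u. p u * sinh u) cosh 1 n x"
    by (rule has_integral_unique[OF ftc]) (intro has_integral_diff i1 has_integral_mult_right i2)
  then have eq: "x * lap (\<lambda>u. p u * sinh u) cosh 1 n x = lap p' cosh 1 n x + of_real (p 1) * ?e 1 - of_real (p n) * ?e n"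
    by (simp add: algebra_simps)
  have b1: "norm (lap p' cosh 1 n x) \<le> (p 1 - p n) * exp (- Re x)"
  proof -
    have "((\<lambda>u. - p' u * exp (- Re x)) has_integral (- p n * exp (- Re x) - - p 1 * exp (- Re x))) {1..n}"
      by (rule fundamental_theorem_of_calculus[OF n])
         (auto simp flip: has_real_derivative_iff_has_vector_derivative 
           intro!: derivative_eq_intros has_field_derivative_at_within[OF p])
    moreover have "norm (of_real (p' u) * ?e u) \<le> - p' u * exp (- Re x)" if "u \<in> {1..n}" for u
      unfolding norm_mult using p'(2)[OF that] by (intro mult_mono ne) auto
    ultimately have "norm (lap p' cosh 1 n x) \<le> - p n * exp (- Re x) - - p 1 * exp (- Re x)"
      unfolding lap_def by (metis (no_types, lifting) i1 has_integral_integrable integral_norm_bound_integral integral_unique)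
    then show ?thesis by (simp add: algebra_simps)
  qed
  have p1: "p 1 \<ge> p n" by (rule DERIV_nonpos_imp_nonincreasing[OF n]) (use p p' in force)
  have "norm x * norm (lap (\<lambda>u. p u * sinh u) cosh 1 n x) = norm (lap p' cosh 1 n x + of_real (p 1) * ?e 1 - of_real (p n) * ?e n)"
    unfolding norm_mult[symmetric] eq ..
  also have "\<dots> \<le> norm (lap p' cosh 1 n x) + norm (of_real (p 1) * ?e 1) + norm (of_real (p n) * ?e n)"
    by (meson norm_triangle_ineq norm_triangle_ineq4 order_trans add_right_mono)
  also have "\<dots> \<le> (p 1 - p n) * exp (- Re x) + p 1 * exp (- Re x) + p n * exp (- Re x)"
    unfolding norm_mult using p1 pn by (intro add_mono b1 mult_mono ne) auto
  finally show ?thesis using x by (simp add: field_simps)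
qed

lemma lap_split:
  assumes "a \<le> c" "c \<le> b" "continuous_on {a..b} m" "continuous_on {a..b} p"
  shows "lap m p a b x = lap m p a c x + lap m p c b x"
  unfolding lap_def using assms
  by (intro Henstock_Kurzweil_Integration.integral_combine[symmetric] lap_integrable) auto

lemma cosh_cont: "continuous_on A (cosh :: real \<Rightarrow> real)" "continuous_on A (sinh :: real \<Rightarrow> real)"
  by (intro continuous_intros)+

text \<open>On \<open>{1..n}\<close> the amplitude is a sign times \<open>p u * sinh u\<close> with
  \<open>p\<close> equal to \<open>1 / sinh\<close> or \<open>cosh / sinh\<close>, both decreasing,
  so integration by parts applies. Both are singular at \<open>0\<close>, hence the cut at
  \<open>1\<close> and the crude bound on \<open>{0..1}\<close>. The constants depend neither on
  \<open>n\<close> nor on the distance of \<open>x\<close> from the imaginary axis.\<close>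

lemma lap_cosh_bound:
  assumes n: "1 \<le> n" and x: "Re x \<ge> 0" "norm x \<ge> 1"
  shows "norm (lap (\<lambda>_. 1) cosh 0 n x) \<le> (1 + 2 / sinh 1) * exp (- Re x)"
    and "norm (lap (\<lambda>u. - cosh u) cosh 0 n x) \<le> (cosh 1 + 2 * cosh 1 / sinh 1) * exp (- Re x)"
proof -
  have x0: "x \<noteq> 0" using x by auto
  have sp: "sinh u > (0::real)" if "u \<in> {1..n}" for u using that by auto
  have tail: "norm (lap m cosh 1 n x) \<le> 2 * c / sinh 1 * exp (- Re x)"
    if p: "\<And>u. u \<in> {1..n} \<Longrightarrow> (p has_real_derivative p' u) (at u)"
    and p': "continuous_on {1..n} p'" "\<And>u. u \<in> {1..n} \<Longrightarrow> p' u \<le> 0" and pn: "p n \<ge> 0"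
    and m: "\<And>u. u \<in> {1..n} \<Longrightarrow> m u = s * (p u * sinh u)" and s: "\<bar>s\<bar> = 1" and p1: "p 1 = c / sinh 1" and c: "c \<ge> 0" for p p' m c s
  proof -
    have "lap m cosh 1 n x = integral {1..n} (\<lambda>u. of_real s * (of_real (p u * sinh u) * exp (- x * of_real (cosh u))))"
      unfolding lap_def by (rule integral_cong) (simp add: m mult_ac)
    also have "\<dots> = of_real s * lap (\<lambda>u. p u * sinh u) cosh 1 n x" unfolding lap_def by simp
    also have "norm \<dots> = norm (lap (\<lambda>u. p u * sinh u) cosh 1 n x)" using s by (simp add: norm_mult)
    also have "\<dots> \<le> 2 * p 1 * exp (- Re x) / norm x"
      by (rule lap_cosh_tail[OF n p p' pn x(1) x0])
    also have "\<dots> \<le> 2 * p 1 * exp (- Re x) / 1" 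
      using x c by (intro divide_left_mono) (auto simp: p1)
    finally show ?thesis by (simp add: p1)
  qed
  have 1: "norm (lap (\<lambda>_. 1) cosh 1 n x) \<le> 2 * 1 / sinh 1 * exp (- Re x)"
    by (rule tail[where p = "\<lambda>u. 1 / sinh u" and p' = "\<lambda>u. - cosh u / (sinh u)\<^sup>2" and s = 1])
       (use sp n in \<open>auto intro!: derivative_eq_intros continuous_intros simp: power2_eq_square cosh_real_nonneg less_imp_neq[symmetric]\<close>)
  have sc: "sinh u * sinh u - cosh u * cosh u = (-1::real)" for u
    using cosh_square_eq[of u] by (simp add: power2_eq_square)
  have 2: "norm (lap (\<lambda>u. - cosh u) cosh 1 n x) \<le> 2 * cosh 1 / sinh 1 * exp (- Re x)"
    by (rule tail[where p = "\<lambda>u. cosh u / sinh u" and p' = "\<lambda>u. - 1 / (sinh u)\<^sup>2" and s = "-1"])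
       (use sp n in \<open>auto intro!: derivative_eq_intros continuous_intros simp: power2_eq_square cosh_real_nonneg less_imp_neq[symmetric] sc\<close>)
  have 3: "norm (lap (\<lambda>_. 1) cosh 0 1 x) \<le> 1 * (1 - 0) * exp (- 1 * Re x)"
    by (rule lap_norm_le) (auto intro: x cosh_cont cosh_real_ge_1)
  have 4: "norm (lap (\<lambda>u. - cosh u) cosh 0 1 x) \<le> cosh 1 * (1 - 0) * exp (- 1 * Re x)"
    by (rule lap_norm_le) (auto intro: x cosh_cont cosh_real_ge_1 continuous_intros simp: cosh_real_nonneg_le_iff)
  have "lap (\<lambda>_. 1) cosh 0 n x = lap (\<lambda>_. 1) cosh 0 1 x + lap (\<lambda>_. 1) cosh 1 n x"
    using n by (intro lap_split cosh_cont continuous_intros) auto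
  then show "norm (lap (\<lambda>_. 1) cosh 0 n x) \<le> (1 + 2 / sinh 1) * exp (- Re x)"
    using norm_triangle_ineq[of "lap (\<lambda>_. 1) cosh 0 1 x" "lap (\<lambda>_. 1) cosh 1 n x"] 1 3 by (simp add: algebra_simps)
  have "lap (\<lambda>u. - cosh u) cosh 0 n x = lap (\<lambda>u. - cosh u) cosh 0 1 x + lap (\<lambda>u. - cosh u) cosh 1 n x"
    using n by (intro lap_split cosh_cont continuous_intros) auto
  then show "norm (lap (\<lambda>u. - cosh u) cosh 0 n x) \<le> (cosh 1 + 2 * cosh 1 / sinh 1) * exp (- Re x)"
    using norm_triangle_ineq[of "lap (\<lambda>u. - cosh u) cosh 0 1 x" "lap (\<lambda>u. - cosh u) cosh 1 n x"] 2 4 by (simp add: algebra_simps)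
qed

text \<open>Used with \<open>p = cosh\<close>, \<open>s = 1\<close> and with \<open>p = - cos\<close>, \<open>s = - 1\<close>: Bessel's equation up to boundary terms.\<close>

lemma lap_ode:
  fixes p p' p'' :: "real \<Rightarrow> real"
  assumes ab: "a \<le> b" and p: "\<And>u. (p has_real_derivative p' u) (at u)" and p': "\<And>u. (p' has_real_derivative p'' u) (at u)"
    and c: "continuous_on {a..b} p" "continuous_on {a..b} p''" and id: "\<And>u. (p u)\<^sup>2 - s * (p' u)\<^sup>2 = 1" "\<And>u. p'' u = s * p u"
    and s: "s\<^sup>2 = 1"
  fixes x :: complex
  defines "E \<equiv> \<lambda>u. exp (- x * of_real (p u))"
  shows "lap (\<lambda>u. - p u) p a b x + x * lap (\<lambda>u. p u * p u) p a b x
     = x * lap (\<lambda>_. 1) p a b x - of_real s * (of_real (p' b) * E b - of_real (p' a) * E a)"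
proof -
  have dE: "(E has_vector_derivative (- x * of_real (p' u)) * E u) (at u within {a..b})" for u
  proof -
    have "((\<lambda>u. - x * of_real (p u)) has_vector_derivative - x * of_real (p' u)) (at u within {a..b})"
      by (intro has_vector_derivative_mult_right has_vector_derivative_of_real has_field_derivative_at_within[OF p])
    from field_vector_diff_chain_within[OF this has_field_derivative_at_within[OF DERIV_exp]]
    show ?thesis by (simp add: E_def o_def)
  qed
  have "((\<lambda>u. of_real s * (of_real (p' u) * E u)) has_vector_derivative
     of_real s * (of_real (p' u) * ((- x * of_real (p' u)) * E u) + of_real (p'' u) * E u)) (at u within {a..b})" for u
    by (intro has_vector_derivative_mult_right has_vector_derivative_mult dE has_vector_derivative_of_real has_field_derivative_at_within[OF p'])
  from fundamental_theorem_of_calculus[OF ab this]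
  have ftc: "((\<lambda>u. of_real s * (of_real (p' u) * ((- x * of_real (p' u)) * E u) + of_real (p'' u) * E u)) has_integral
     of_real s * (of_real (p' b) * E b) - of_real s * (of_real (p' a) * E a)) {a..b}" .
  have e: "of_real s * (of_real (p' u) * ((- x * of_real (p' u)) * E u) + of_real (p'' u) * E u) =
    x * (of_real 1 * E u) + of_real (p u) * E u - x * (of_real (p u * p u) * E u)" for u
  proof -
    have "p'' u * s = p u" using id(2)[of u] s by (simp add: power2_eq_square)
    then have 1: "of_real s * of_real (p'' u) = (of_real (p u) :: complex)" by (metis mult.commute of_real_mult)
    have "s * (p' u * p' u) = p u * p u - 1" using id(1)[of u] by (simp add: power2_eq_square)
    then have 2: "of_real s * (of_real (p' u) * of_real (p' u)) = (of_real (p u) * of_real (p u) - 1 :: complex)" 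
      by (metis of_real_1 of_real_diff of_real_mult)
    have "of_real s * (of_real (p' u) * ((- x * of_real (p' u)) * E u) + of_real (p'' u) * E u)
       = - x * E u * (of_real s * (of_real (p' u) * of_real (p' u))) + E u * (of_real s * of_real (p'' u))"
      by (simp add: algebra_simps)
    then show ?thesis unfolding 1 2 by (simp add: algebra_simps)
  qed
  have i1: "((\<lambda>u. of_real (m u) * E u) has_integral lap m p a b x) {a..b}" if "continuous_on {a..b} m" for m
    unfolding lap_def E_def by (intro integrable_integral lap_integrable that c)
  have "((\<lambda>u. x * (of_real 1 * E u) + of_real (p u) * E u - x * (of_real (p u * p u) * E u)) has_integral
     (x * lap (\<lambda>_. 1) p a b x + lap p p a b x - x * lap (\<lambda>u. p u * p u) p a b x)) {a..b}"
    by (intro has_integral_diff has_integral_add has_integral_mult_right i1 continuous_intros c)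
  from has_integral_unique[OF this ftc[unfolded e]] show ?thesis
    unfolding lap_def by (simp add: algebra_simps)
qed

lemma lap_bessel:
  fixes p p' p'' :: "real \<Rightarrow> real"
  assumes ab: "a \<le> b" and p: "\<And>u. (p has_real_derivative p' u) (at u)" and p': "\<And>u. (p' has_real_derivative p'' u) (at u)"
    and c: "continuous_on {a..b} p" "continuous_on {a..b} p''" and id: "\<And>u. (p u)\<^sup>2 - s * (p' u)\<^sup>2 = 1" "\<And>u. p'' u = s * p u"
    and s: "s\<^sup>2 = 1"
  shows "(lap (\<lambda>_. 1) p a b has_field_derivative lap (\<lambda>u. - p u) p a b x) (at x)"
    "((\<lambda>x. x * lap (\<lambda>u. - p u) p a b x) has_field_derivative x * lap (\<lambda>_. 1) p a b x - 
       of_real s * (of_real (p' b) * exp (- x * of_real (p b)) - of_real (p' a) * exp (- x * of_real (p a)))) (at x)"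
proof -
  show "(lap (\<lambda>_. 1) p a b has_field_derivative lap (\<lambda>u. - p u) p a b x) (at x)"
    using lap_deriv[of a b "\<lambda>_. 1" p x] c by (simp add: continuous_intros)
  have "(lap (\<lambda>u. - p u) p a b has_field_derivative lap (\<lambda>u. p u * p u) p a b x) (at x)"
    using lap_deriv[of a b "\<lambda>u. - p u" p x] c by (simp add: continuous_intros)
  then show "((\<lambda>x. x * lap (\<lambda>u. - p u) p a b x) has_field_derivative x * lap (\<lambda>_. 1) p a b x - 
       of_real s * (of_real (p' b) * exp (- x * of_real (p b)) - of_real (p' a) * exp (- x * of_real (p a)))) (at x)"
    unfolding lap_ode[OF ab p p' c id s, symmetric]
    by (auto intro!: derivative_eq_intros)
qed

section \<open>The integral of exp (- x cosh u) over the half-line\<close>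

definition Kint_upto :: "nat \<Rightarrow> complex \<Rightarrow> complex" where "Kint_upto n = lap (\<lambda>_. 1) cosh 0 (real n)"
definition Kint_upto_deriv :: "nat \<Rightarrow> complex \<Rightarrow> complex" where "Kint_upto_deriv n = lap (\<lambda>u. - cosh u) cosh 0 (real n)"

lemma Kint_upto_bessel:
  "(Kint_upto n has_field_derivative Kint_upto_deriv n x) (at x)"
  "((\<lambda>x. x * Kint_upto_deriv n x) has_field_derivative x * Kint_upto n x - of_real (sinh n) * exp (- x * of_real (cosh n))) (at x)"
proof -
  have c1: "(cosh has_real_derivative sinh u) (at u)" "(sinh has_real_derivative cosh u) (at u)" for u :: real
    by (auto intro!: derivative_eq_intros)
  have id: "(cosh u)\<^sup>2 - 1 * (sinh u)\<^sup>2 = 1" "cosh u = 1 * cosh u" for u :: real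
    by (simp_all add: cosh_square_eq)
  have n: "0 \<le> real n" by simp
  note * = lap_bessel[OF n c1 cosh_cont(1) cosh_cont(1) id, of x]
  show "(Kint_upto n has_field_derivative Kint_upto_deriv n x) (at x)" 
    using *(1) unfolding Kint_upto_def Kint_upto_deriv_def by simp
  show "((\<lambda>x. x * Kint_upto_deriv n x) has_field_derivative x * Kint_upto n x - of_real (sinh n) * exp (- x * of_real (cosh n))) (at x)"
    using *(2) unfolding Kint_upto_def Kint_upto_deriv_def by simp
qed

text \<open>From \<open>cosh n \<ge> exp n / 2\<close> and \<open>exp r \<ge> r\<close>: convergence
  is geometric, uniformly on \<open>Re x \<ge> d\<close>.\<close>

lemma Kint_upto_step: 
  assumes "Re x \<ge> d" "d > 0"
  shows "norm (Kint_upto (Suc n) x - Kint_upto n x) \<le> (2 / d) * exp (-1) ^ n"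
proof -
  have x: "Re x \<ge> 0" using assms by simp
  have "Kint_upto (Suc n) x = Kint_upto n x + lap (\<lambda>_. 1) cosh (real n) (real (Suc n)) x"
    unfolding Kint_upto_def by (rule lap_split) (auto intro: cosh_cont)
  moreover have "norm (lap (\<lambda>_. 1) cosh (real n) (real (Suc n)) x) \<le> 1 * (real (Suc n) - real n) * exp (- cosh (real n) * Re x)"
    by (rule lap_norm_le) (auto intro: cosh_cont x simp: cosh_real_nonneg_le_iff)
  moreover have "exp (- cosh (real n) * Re x) \<le> (2 / d) * exp (-1) ^ n"
  proof -
    have "exp (real n) / 2 \<le> cosh (real n)" by (simp add: cosh_def)
    then have "exp (real n) / 2 * d \<le> cosh (real n) * Re x" using assms by (intro mult_mono) auto
    also have "\<dots> \<le> exp (cosh (real n) * Re x)" 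
      using exp_ge_add_one_self[of "cosh (real n) * Re x"] by linarith
    finally have "exp (real n) / 2 * d \<le> exp (cosh (real n) * Re x)" .
    then show ?thesis using assms by (simp add: exp_minus field_simps flip: exp_of_nat_mult)
  qed
  ultimately show ?thesis by simp
qed

text \<open>The limit of the truncations, written as a telescoping series so that the M-test yields
  uniform convergence.\<close>

definition Kint :: "complex \<Rightarrow> complex" where "Kint x = (\<Sum>n. Kint_upto (Suc n) x - Kint_upto n x)"

lemma Kint_upto_0: "Kint_upto 0 x = 0"
  by (simp add: Kint_upto_def lap_def)

lemma Kint_upto_uniform_limit:
  assumes "d > 0" shows "uniform_limit {x. Re x > d} Kint_upto Kint sequentially"
proof -
  have "uniform_limit {x. Re x > d} (\<lambda>n x. \<Sum>i<n. Kint_upto (Suc i) x - Kint_upto i x) (\<lambda>x. \<Sum>i. Kint_upto (Suc i) x - Kint_upto i x) sequentially"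
  proof (rule Weierstrass_m_test)
    show "summable (\<lambda>n. (2 / d) * exp (-1) ^ n)" by (intro summable_mult summable_geometric) simp
    show "norm (Kint_upto (Suc n) x - Kint_upto n x) \<le> (2 / d) * exp (-1) ^ n" if "x \<in> {x. Re x > d}" for n x
      using that assms by (intro Kint_upto_step) auto
  qed
  moreover have "(\<Sum>i<n. Kint_upto (Suc i) x - Kint_upto i x) = Kint_upto n x" for n x
    using sum_lessThan_telescope[of "\<lambda>n. Kint_upto n x" n] by (simp add: Kint_upto_0)
  ultimately show ?thesis unfolding Kint_def[abs_def] by simp
qed

lemma Kint_upto_holo: "Kint_upto n holomorphic_on A"
  using Kint_upto_bessel(1) by (meson DERIV_subset field_differentiable_def holomorphic_on_def subset_UNIV)

lemma deriv_Kint_upto: "deriv (Kint_upto n) = Kint_upto_deriv n" by (rule ext) (rule DERIV_imp_deriv[OF Kint_upto_bessel(1)])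

text \<open>Locally uniform limits of holomorphic functions may be differentiated under the limit,
  so the equation of the truncations passes on to \<open>Kint\<close>; the boundary term with
  \<open>sinh n\<close> tends to \<open>0\<close> because
  \<open>exp (- r) \<le> 2 / r\<^sup>2\<close>. The last two claims have the form that
  \<open>bessel_span\<close> expects.\<close>

lemma Kint_facts:
  assumes x: "Re x > 0"
  shows "(\<lambda>n. Kint_upto n x) \<longlonglongrightarrow> Kint x" "(\<lambda>n. Kint_upto_deriv n x) \<longlonglongrightarrow> deriv Kint x"
    "(Kint has_field_derivative (x * deriv Kint x) / x) (at x)"
    "((\<lambda>x. x * deriv Kint x) has_field_derivative x * Kint x) (at x)"
proof -
  define A where "A = {y. Re y > Re x / 2}"
  have A: "open A" "x \<in> A" using x open_halfspace_Re_gt[of "Re x / 2"] by (auto simp: A_def)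
  have u: "uniform_limit A Kint_upto Kint sequentially" unfolding A_def using x by (intro Kint_upto_uniform_limit) auto
  have lim: "(\<lambda>n. (deriv ^^ m) (Kint_upto n) x) \<longlonglongrightarrow> (deriv ^^ m) Kint x" for m
    by (rule higher_deriv_complex_uniform_limit[OF u]) (use A in \<open>simp_all add: Kint_upto_holo\<close>)
  show l0: "(\<lambda>n. Kint_upto n x) \<longlonglongrightarrow> Kint x" using lim[of 0] by simp
  show l1: "(\<lambda>n. Kint_upto_deriv n x) \<longlonglongrightarrow> deriv Kint x" using lim[of 1] by (simp add: deriv_Kint_upto)
  have holo: "Kint holomorphic_on A"
  proof (rule holomorphic_uniform_sequence[OF A(1), of Kint_upto])
    fix y assume "y \<in> A"
    then obtain r where r: "r > 0" "cball y r \<subseteq> A" using A(1) open_contains_cball by blast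
    then show "\<exists>d>0. cball y d \<subseteq> A \<and> uniform_limit (cball y d) Kint_upto Kint sequentially"
      using uniform_limit_on_subset[OF u r(2)] by blast
  qed (rule Kint_upto_holo)
  have holo1: "deriv Kint holomorphic_on A" using holo A(1) by (rule holomorphic_deriv)
  show d0: "(Kint has_field_derivative (x * deriv Kint x) / x) (at x)"
    using holomorphic_derivI[OF holo A] x by auto
  have "(deriv Kint has_field_derivative deriv (deriv Kint) x) (at x)"
    by (rule holomorphic_derivI[OF holo1 A])
  then have d1: "((\<lambda>x. x * deriv Kint x) has_field_derivative deriv Kint x + x * deriv (deriv Kint) x) (at x)"
    by (auto intro!: derivative_eq_intros)
  have "(\<lambda>n. Kint_upto_deriv n x + x * deriv (Kint_upto_deriv n) x) \<longlonglongrightarrow> deriv Kint x + x * deriv (deriv Kint) x"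
    using lim[of 2] by (intro tendsto_intros l1) (simp add: numeral_2_eq_2 deriv_Kint_upto)
  moreover have "Kint_upto_deriv n x + x * deriv (Kint_upto_deriv n) x = x * Kint_upto n x - of_real (sinh n) * exp (- x * of_real (cosh n))" for n
  proof -
    have "Kint_upto_deriv n holomorphic_on UNIV" unfolding deriv_Kint_upto[symmetric] by (intro holomorphic_deriv Kint_upto_holo) auto
    then have "(Kint_upto_deriv n has_field_derivative deriv (Kint_upto_deriv n) x) (at x)" by (rule holomorphic_derivI) auto
    then have "((\<lambda>x. x * Kint_upto_deriv n x) has_field_derivative Kint_upto_deriv n x + x * deriv (Kint_upto_deriv n) x) (at x)"
      by (auto intro!: derivative_eq_intros)
    from DERIV_unique[OF this Kint_upto_bessel(2)] show ?thesis .
  qed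
  ultimately have l2: "(\<lambda>n. x * Kint_upto n x - of_real (sinh n) * exp (- x * of_real (cosh n))) \<longlonglongrightarrow> deriv Kint x + x * deriv (deriv Kint) x"
    by simp
  have "(\<lambda>n. of_real (sinh (real n)) * exp (- x * of_real (cosh (real n)))) \<longlonglongrightarrow> 0"
  proof (rule Lim_null_comparison)
    show "\<forall>\<^sub>F n in sequentially. norm (of_real (sinh (real n)) * exp (- x * of_real (cosh (real n)))) \<le> (2 / (Re x)\<^sup>2) * inverse (cosh (real n))"
    proof (intro always_eventually allI)
      fix n
      let ?c = "cosh (real n)"
      have c: "?c > 0" by (rule cosh_real_pos)
      define r where "r = Re x * ?c"
      have r: "r > 0" using x c by (simp add: r_def)
      have "r\<^sup>2 / 2 \<le> exp r" using exp_lower_Taylor_quadratic[of r] r by linarith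
      then have "exp (- r) \<le> 2 / r\<^sup>2" using r by (simp add: exp_minus divide_simps mult.commute)
      moreover have "\<bar>sinh (real n)\<bar> \<le> ?c" by (simp add: sinh_le_cosh_real)
      ultimately have "\<bar>sinh (real n)\<bar> * exp (- r) \<le> ?c * (2 / r\<^sup>2)"
        using c by (intro mult_mono) auto
      also have "\<dots> = (2 / (Re x)\<^sup>2) * inverse ?c" 
        using c x by (simp add: r_def power2_eq_square divide_simps)
      finally show "norm (of_real (sinh (real n)) * exp (- x * of_real ?c)) \<le> (2 / (Re x)\<^sup>2) * inverse ?c"
        by (simp add: norm_mult norm_exp_eq_Re r_def)
    qed
    have "filterlim (\<lambda>n. cosh (real n)) at_top sequentially"
      by (rule filterlim_compose[OF cosh_real_at_top filterlim_real_sequentially])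
    then show "(\<lambda>n. (2 / (Re x)\<^sup>2) * inverse (cosh (real n))) \<longlonglongrightarrow> 0"
      by (intro tendsto_mult_right_zero tendsto_inverse_0_at_top)
  qed
  from LIMSEQ_unique[OF l2 tendsto_diff[OF tendsto_mult_left[OF l0, of x] this]]
  have "deriv Kint x + x * deriv (deriv Kint) x = x * Kint x" by (simp only: diff_zero)
  with d1 show "((\<lambda>x. x * deriv Kint x) has_field_derivative x * Kint x) (at x)"
    by (simp only:)
qed

lemma Kint_bound:
  assumes x: "Re x > 0" "norm x \<ge> 1"
  shows "norm (Kint x) \<le> (1 + 2 / sinh 1) * exp (- Re x)"
    "norm (deriv Kint x) \<le> (cosh 1 + 2 * cosh 1 / sinh 1) * exp (- Re x)"
proof -
  have n: "1 \<le> real n" if "1 \<le> n" for n using that by simp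
  note b = lap_cosh_bound[OF n less_imp_le[OF x(1)] x(2), folded Kint_upto_def Kint_upto_deriv_def]
  show "norm (Kint x) \<le> (1 + 2 / sinh 1) * exp (- Re x)"
    by (rule LIMSEQ_le_const2[OF tendsto_norm[OF Kint_facts(1)[OF x(1)]]]) (intro exI[of _ 1] allI impI b(1))
  show "norm (deriv Kint x) \<le> (cosh 1 + 2 * cosh 1 / sinh 1) * exp (- Re x)"
    by (rule LIMSEQ_le_const2[OF tendsto_norm[OF Kint_facts(2)[OF x(1)]]]) (intro exI[of _ 1] allI impI b(2))
qed

lemma Re_lap_ge:
  assumes "a \<le> b" "continuous_on {a..b} p" "\<And>u. u \<in> {a..b} \<Longrightarrow> p u \<le> q"
  shows "Re (lap (\<lambda>_. 1) p a b 1) \<ge> (b - a) * exp (- q)"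
proof -
  have "((\<lambda>u. of_real 1 * exp (- 1 * of_real (p u)) :: complex) has_integral lap (\<lambda>_. 1) p a b 1) {a..b}"
    unfolding lap_def by (intro integrable_integral lap_integrable assms(2) continuous_on_const)
  from has_integral_Re[OF this] have f1: "((\<lambda>u. exp (- p u)) has_integral Re (lap (\<lambda>_. 1) p a b 1)) {a..b}"
    by (simp add: Re_exp)
  have f2: "((\<lambda>u. exp (- q)) has_integral (b - a) * exp (- q)) {a..b}"
    using has_integral_const_real[of "exp (- q)" a b] assms(1) by simp
  show ?thesis by (rule has_integral_le[OF f2 f1]) (use assms(3) in auto)
qed

text \<open>Write \<open>Kint\<close> as \<open>a * I0 + b * K0\<close>. Along the integers
  \<open>Kint\<close> tends to \<open>0\<close>, \<open>K0\<close> is small relative to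
  \<open>I0\<close>, and \<open>norm (I0 x) \<ge> 1\<close>; hence \<open>a = 0\<close>. Positivity
  of the integrand at \<open>x = 1\<close> gives \<open>b \<noteq> 0\<close>, so the bounds of
  \<open>Kint\<close> pass to \<open>K0\<close>.\<close>

lemma K_bound:
  obtains C where "C > 0" 
    "\<And>x. Re x > 0 \<Longrightarrow> norm x \<ge> 1 \<Longrightarrow> norm (K0 x) \<le> C * exp (- Re x)"
    "\<And>x. Re x > 0 \<Longrightarrow> norm x \<ge> 1 \<Longrightarrow> norm (K1 x) \<le> C * norm x * exp (- Re x)"
proof -
  obtain a b where ab: "\<And>x. Re x > 0 \<Longrightarrow> Kint x = a * I0 x + b * K0 x"
    "\<And>x. Re x > 0 \<Longrightarrow> x * deriv Kint x = a * I1 x + b * K1 x"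
    by (rule bessel_span[of Kint "\<lambda>x. x * deriv Kint x"]) (rule that Kint_facts(3,4) | assumption)+
  define c where "c = 1 + 2 / sinh (1::real)"
  define c1 where "c1 = cosh 1 + 2 * cosh 1 / sinh (1::real)"
  have c: "c > 0" "c1 > 0" by (auto simp: c_def c1_def intro!: add_pos_pos divide_pos_pos mult_pos_pos cosh_real_pos)
  have "norm a \<le> c * inverse (real n) + 2 * norm b * inverse (real n)" if n: "n \<ge> 1" for n
  proof -
    let ?x = "of_real (real n) :: complex"
    have nn: "real n \<ge> 1" "real n > 0" using n by auto
    have "norm (Kint ?x) \<le> c * exp (- real n)"
      using Kint_bound(1)[of ?x] n by (simp add: c_def)
    also have "exp (- real n) \<le> inverse (real n)"
    proof -
      have "real n \<le> exp (real n)" using exp_ge_add_one_self[of "real n"] by linarith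
      then show ?thesis using nn unfolding exp_minus by (intro le_imp_inverse_le)
    qed
    finally have 1: "norm (Kint ?x) \<le> c * inverse (real n)" using c by simp
    have i: "norm (I0 ?x) \<ge> 1" by (rule K0_le_I0(2)[OF nn(2)])
    have "norm a * norm (I0 ?x) = norm (Kint ?x - b * K0 ?x)" using ab(1)[of ?x] nn by (simp flip: norm_mult)
    also have "\<dots> \<le> norm (Kint ?x) + norm (b * K0 ?x)" by (rule norm_triangle_ineq4)
    also have "\<dots> \<le> c * inverse (real n) + norm b * (2 / real n * norm (I0 ?x))"
      unfolding norm_mult by (intro add_mono 1 mult_left_mono K0_le_I0(1)[OF nn(2)]) auto
    also have "\<dots> \<le> c * inverse (real n) * norm (I0 ?x) + norm b * (2 / real n * norm (I0 ?x))"
      using mult_left_mono[OF i, of "c * inverse (real n)"] c nn by (intro add_right_mono) simp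
    finally have "norm a * norm (I0 ?x) \<le> (c * inverse (real n) + 2 * norm b * inverse (real n)) * norm (I0 ?x)"
      by (simp add: algebra_simps divide_inverse)
    then show ?thesis using i by (subst (asm) mult_le_cancel_right) auto
  qed
  then have ev: "\<forall>\<^sub>F n in sequentially. norm a \<le> c * inverse (real n) + 2 * norm b * inverse (real n)"
    by (intro eventually_sequentiallyI[of 1])
  have "(\<lambda>n. c * inverse (real n) + 2 * norm b * inverse (real n)) \<longlonglongrightarrow> c * 0 + 2 * norm b * 0"
    by (intro tendsto_intros lim_inverse_n)
  from tendsto_lowerbound[OF this ev] have a0: "a = 0" by simp
  have b0: "b \<noteq> 0"
  proof
    assume "b = 0"
    then have z: "Kint 1 = 0" using ab(1)[of 1] a0 by simp
    have "exp (- cosh 1) \<le> Re (Kint_upto n 1)" if n: "1 \<le> n" for n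
    proof -
      have n': "1 \<le> real n" using n by simp
      have "Kint_upto n 1 = lap (\<lambda>_. 1) cosh 0 1 1 + lap (\<lambda>_. 1) cosh 1 (real n) 1"
        unfolding Kint_upto_def using n' by (intro lap_split cosh_cont continuous_intros) auto
      moreover have "Re (lap (\<lambda>_. 1) cosh 0 1 1) \<ge> (1 - 0) * exp (- cosh 1)"
        by (rule Re_lap_ge) (auto intro: cosh_cont simp: cosh_real_nonneg_le_iff)
      moreover have "Re (lap (\<lambda>_. 1) cosh 1 (real n) 1) \<ge> (real n - 1) * exp (- cosh (real n))"
        by (rule Re_lap_ge) (use n' in \<open>auto intro: cosh_cont simp: cosh_real_nonneg_le_iff\<close>)
      moreover have "(real n - 1) * exp (- cosh (real n)) \<ge> 0" using n' by simp
      ultimately show ?thesis unfolding plus_complex.sel by simp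
    qed
    then have "\<exists>N. \<forall>n\<ge>N. exp (- cosh 1) \<le> Re (Kint_upto n 1)" by blast
    moreover have "(\<lambda>n. Re (Kint_upto n 1)) \<longlonglongrightarrow> Re (Kint 1)" by (rule tendsto_Re[OF Kint_facts(1)]) simp
    ultimately have "exp (- cosh 1) \<le> Re (Kint 1)"
      by (rule LIMSEQ_le_const[rotated])
    then show False using z by simp
  qed
  define C where "C = max c c1 / norm b"
  have Cb: "C * norm b = max c c1" using b0 by (simp add: C_def)
  show ?thesis
  proof (rule that)
    show "C > 0" using c b0 by (simp add: C_def less_max_iff_disj)
    fix x assume x: "Re x > 0" "norm x \<ge> 1"
    have "norm b * norm (K0 x) = norm (Kint x)" using ab(1)[OF x(1)] a0 by (simp add: norm_mult)
    also have "\<dots> \<le> c * exp (- Re x)" using Kint_bound(1)[OF x] by (simp add: c_def)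
    also have "\<dots> \<le> (C * norm b) * exp (- Re x)" unfolding Cb by (intro mult_right_mono) auto
    finally have "norm b * norm (K0 x) \<le> norm b * (C * exp (- Re x))" by (simp add: mult_ac)
    then show "norm (K0 x) \<le> C * exp (- Re x)" using b0 by (subst (asm) mult_le_cancel_left) auto
    have "norm b * norm (K1 x) = norm x * norm (deriv Kint x)" using ab(2)[OF x(1)] a0 by (simp flip: norm_mult)
    also have "\<dots> \<le> norm x * (c1 * exp (- Re x))" using Kint_bound(2)[OF x] by (simp add: c1_def mult_left_mono)
    also have "\<dots> \<le> norm x * ((C * norm b) * exp (- Re x))" unfolding Cb by (intro mult_left_mono mult_right_mono) auto
    finally have "norm b * norm (K1 x) \<le> norm b * (C * norm x * exp (- Re x))" by (simp add: mult_ac)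
    then show "norm (K1 x) \<le> C * norm x * exp (- Re x)" using b0 by (subst (asm) mult_le_cancel_left) auto
  qed
qed

text \<open>\<open>\<integral>\<^sub>0\<^sup>\<pi> exp (x cos u) du\<close> is a multiple of \<open>I0\<close>, being bounded near \<open>0\<close>.\<close>

lemma I_bound:
  obtains C where "C > 0" 
    "\<And>x. Re x > 0 \<Longrightarrow> norm (I0 x) \<le> C * exp (Re x)"
    "\<And>x. Re x > 0 \<Longrightarrow> norm (I1 x) \<le> C * norm x * exp (Re x)"
proof -
  define J where "J = lap (\<lambda>_. 1) (\<lambda>u. - cos u) 0 pi"
  define J1 where "J1 = lap (\<lambda>u. - (- cos u)) (\<lambda>u. - cos u) 0 pi"
  have pc: "continuous_on A (\<lambda>u::real. - cos u)" for A by (intro continuous_intros)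
  have "((\<lambda>u. - cos u) has_real_derivative sin u) (at u)" "(sin has_real_derivative cos u) (at u)" for u :: real
    by (auto intro!: derivative_eq_intros)
  moreover have "continuous_on {0..pi} (\<lambda>u::real. cos u)" by (intro continuous_intros)
  moreover have "(- cos u)\<^sup>2 - (-1) * (sin u)\<^sup>2 = 1" "cos u = (-1) * (- cos u)" "(-1)\<^sup>2 = (1::real)" for u :: real
    by (simp_all add: add.commute)
  ultimately have d: "(J has_field_derivative J1 x) (at x)" 
    "((\<lambda>x. x * J1 x) has_field_derivative x * J x) (at x)" for x
    using lap_bessel[of 0 pi "\<lambda>u. - cos u" sin cos "-1" x] pc unfolding J_def J1_def by simp_all
  obtain a b where ab: "\<And>x. Re x > 0 \<Longrightarrow> J x = a * I0 x + b * K0 x"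
    "\<And>x. Re x > 0 \<Longrightarrow> x * J1 x = a * I1 x + b * K1 x"
  proof (rule bessel_span[of J "\<lambda>x. x * J1 x"])
    fix x :: complex assume "Re x > 0"
    then show "(J has_field_derivative x * J1 x / x) (at x)" using d(1)[of x] by auto
  qed (rule that d(2) | assumption)+
  have b0: "b = 0"
  proof -
    \<comment> \<open>Along this sequence \<open>Ln (x n / 2) = - n\<close>. Dividing
      \<open>J - a * I0 = b * K0\<close> by \<open>n\<close> makes every term vanish in the limit
      except the logarithmic one, which tends to \<open>b * I0 0\<close>.\<close>
    define x where "x = (\<lambda>n. of_real (2 * exp (- real n)) :: complex)"
    have "(\<lambda>n. 2 * exp (- real n)) \<longlonglongrightarrow> 2 * 0"
      by (intro tendsto_mult tendsto_const filterlim_compose[OF exp_at_bot] filterlim_compose[OF filterlim_uminus_at_bot_at_top filterlim_real_sequentially])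
    from tendsto_of_real[OF this] have x0: "x \<longlonglongrightarrow> 0" unfolding x_def by (simp only: mult_zero_right of_real_0)
    have cont: "(\<lambda>n. f (x n)) \<longlonglongrightarrow> f 0" if "f holomorphic_on UNIV" for f
    proof -
      have "continuous_on UNIV f" using that by (rule holomorphic_on_imp_continuous_on)
      then have "isCont f 0" by (simp add: continuous_on_eq_continuous_at)
      then show ?thesis using x0 by (rule isCont_tendsto_compose)
    qed
    have Jh: "J holomorphic_on UNIV" unfolding holomorphic_on_def field_differentiable_def using d(1) by auto
    have inv: "(\<lambda>n. inverse (of_nat n :: complex)) \<longlonglongrightarrow> 0" by (rule lim_inverse_n)
    have L: "Ln (x n / 2) = - of_nat n" for n
      using Ln_of_real[of "exp (- real n)"] by (simp add: x_def)
    have "(\<lambda>n. (J (x n) - a * I0 (x n) - b * (H0 (x n) - euler_mascheroni * I0 (x n))) * inverse (of_nat n)) \<longlonglongrightarrow> 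
       (J 0 - a * I0 0 - b * (H0 0 - euler_mascheroni * I0 0)) * 0"
      by (intro tendsto_intros cont Jh I0_holo H0_holo inv)
    moreover have "\<forall>\<^sub>F n in sequentially. (J (x n) - a * I0 (x n) - b * (H0 (x n) - euler_mascheroni * I0 (x n))) * inverse (of_nat n) = b * I0 (x n)"
    proof (rule eventually_sequentiallyI[of 1])
      fix n :: nat assume n: "1 \<le> n"
      have "Re (x n) > 0" by (simp add: x_def)
      from ab(1)[OF this] have "J (x n) - a * I0 (x n) - b * (H0 (x n) - euler_mascheroni * I0 (x n)) = b * I0 (x n) * of_nat n"
        unfolding K0_def L by (simp add: algebra_simps)
      then show "(J (x n) - a * I0 (x n) - b * (H0 (x n) - euler_mascheroni * I0 (x n))) * inverse (of_nat n) = b * I0 (x n)"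
        using n by simp
    qed
    ultimately have "(\<lambda>n. b * I0 (x n)) \<longlonglongrightarrow> 0" by (simp add: tendsto_cong)
    moreover have "(\<lambda>n. b * I0 (x n)) \<longlonglongrightarrow> b * I0 0" by (intro tendsto_intros cont I0_holo)
    ultimately have "b * I0 0 = 0" by (rule LIMSEQ_unique[symmetric])
    then show ?thesis by (simp add: I0_0)
  qed
  have a0: "a \<noteq> 0"
  proof
    assume "a = 0"
    then have "J 1 = 0" using ab(1)[of 1] b0 by simp
    moreover have "Re (J 1) \<ge> (pi - 0) * exp (- 1)" unfolding J_def by (rule Re_lap_ge) (auto intro: pc)
    moreover have "(pi - 0) * exp (- 1) > 0" by simp
    ultimately show False by (simp only: zero_complex.sel)
  qed
  define C where "C = pi / norm a"
  show ?thesis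
  proof (rule that)
    show "C > 0" using a0 by (simp add: C_def)
    fix x assume x: "Re x > 0"
    have "norm (J x) \<le> 1 * (pi - 0) * exp (- (-1) * Re x)" 
      unfolding J_def by (rule lap_norm_le) (use x in \<open>auto intro: pc\<close>)
    moreover have "norm (J x) = norm a * norm (I0 x)" using ab(1)[OF x] b0 by (simp add: norm_mult)
    ultimately show "norm (I0 x) \<le> C * exp (Re x)" using a0 by (simp add: C_def field_simps)
    have "norm (J1 x) \<le> 1 * (pi - 0) * exp (- (-1) * Re x)" 
      unfolding J1_def by (rule lap_norm_le) (use x in \<open>auto simp: pc intro: continuous_on_cos\<close>)
    then have "norm x * norm (J1 x) \<le> norm x * (pi * exp (Re x))" by (intro mult_left_mono) auto
    moreover have "norm x * norm (J1 x) = norm a * norm (I1 x)" using ab(2)[OF x] b0 by (simp flip: norm_mult)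
    ultimately show "norm (I1 x) \<le> C * norm x * exp (Re x)" using a0 by (simp add: C_def field_simps)
  qed
qed

section \<open>The integral equation\<close>

text \<open>The substitution of \<open>w\<close> times a squared tangent for \<open>s\<close>
  explains the primitive. It is used on \<open>{a..}\<close> with \<open>a > 0\<close>, since
  \<open>sqrt\<close> has no derivative at \<open>0\<close>; monotone convergence then reaches
  \<open>0\<close>. The kernel thus reproduces the weight \<open>1 / sqrt s\<close> up to a factor
  \<open>pi\<close>.\<close>

lemma nn_integral_sqrt_kernel:
  fixes w :: real assumes w: "w > 0"
  shows "(\<integral>\<^sup>+s. ennreal (1 / (sqrt s * (s + w))) * indicator {0<..} s \<partial>lborel) \<le> ennreal (pi / sqrt w)"
proof -
  let ?f = "\<lambda>s. 1 / (sqrt s * (s + w))" and ?F = "\<lambda>s. 2 / sqrt w * arctan (sqrt s / sqrt w)"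
  let ?A = "\<lambda>n::nat. {1 / real (Suc n)..}"
  have b: "(\<integral>\<^sup>+s. ennreal (?f s) * indicator {a..} s \<partial>lborel) \<le> ennreal (pi / sqrt w)" if a: "a > 0" for a
  proof -
    have "(\<integral>\<^sup>+s. ennreal (?f s) * indicator {a..} s \<partial>lborel) = 2 / sqrt w * (pi / 2) - ?F a"
    proof (rule nn_integral_FTC_atLeast)
      fix x assume "a \<le> x"
      then have x: "x > 0" using a by simp
      have e: "2 / sqrt w * (1 / (1 + (sqrt x / sqrt w)\<^sup>2) * (inverse (sqrt x) / 2 / sqrt w)) = ?f x"
      proof -
        define a b where "a = sqrt x" and "b = sqrt w"
        have ab: "a > 0" "b > 0" "x = a * a" "w = b * b" using x w by (auto simp: a_def b_def)
        have p: "a * a + b * b > 0" using ab by (intro add_pos_pos mult_pos_pos)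
        have "1 + (a / b)\<^sup>2 = (a * a + b * b) / (b * b)" using ab(1,2) by (simp add: power2_eq_square field_simps)
        then have "2 / b * (1 / (1 + (a / b)\<^sup>2) * (inverse a / 2 / b)) = 2 / b * ((b * b) / (a * a + b * b) * (inverse a / 2 / b))"
          by simp
        also have "2 / b * ((b * b) / P * (inverse a / 2 / b)) = 1 / (a * P)" if "P > 0" for P
          using ab(1,2) that by (simp add: field_simps)
        note this[OF p]
        finally show ?thesis unfolding a_def[symmetric] b_def[symmetric] unfolding ab(3,4) .
      qed
      have ds: "(sqrt has_real_derivative inverse (sqrt x) / 2) (at x)" by (rule DERIV_real_sqrt[OF x])
      have "(?F has_real_derivative 2 / sqrt w * (1 / (1 + (sqrt x / sqrt w)\<^sup>2) * (inverse (sqrt x) / 2 / sqrt w))) (at x)"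
        using DERIV_cmult[OF DERIV_chain2[OF DERIV_arctan DERIV_cdivide[OF ds, of "sqrt w"]], of "2 / sqrt w"]
        unfolding inverse_eq_divide[of "1 + _"] .
      then show "(?F has_real_derivative ?f x) (at x)" unfolding e .
      show "0 \<le> ?f x" using x w by simp
    next
      have "filterlim (\<lambda>x. sqrt x / sqrt w) at_top at_top"
        using filterlim_tendsto_pos_mult_at_top[OF tendsto_const[of "inverse (sqrt w)"] _ sqrt_at_top] w
        by (simp add: divide_inverse mult.commute)
      then show "(?F \<longlongrightarrow> 2 / sqrt w * (pi / 2)) at_top"
        by (intro tendsto_intros filterlim_compose[OF tendsto_arctan_at_top])
    qed measurable
    also have "\<dots> \<le> ennreal (pi / sqrt w)" using w a
      by (intro ennreal_leI) simp
    finally show ?thesis .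
  qed
  have "(\<integral>\<^sup>+s. ennreal (?f s) * indicator {0<..} s \<partial>lborel) = (\<integral>\<^sup>+s. (SUP n. ennreal (?f s) * indicator (?A n) s) \<partial>lborel)"
  proof (rule nn_integral_cong)
    fix s :: real
    have "(\<Union>n. ?A n) = {0<..}"
    proof (intro set_eqI iffI)
      fix x :: real assume "x \<in> {0<..}"
      then obtain n where "inverse (real (Suc n)) < x" using reals_Archimedean by auto
      then show "x \<in> (\<Union>n. ?A n)" by (auto simp: inverse_eq_divide intro!: exI[of _ n])
    next
      fix x :: real assume "x \<in> (\<Union>n. ?A n)"
      then obtain n where "1 / real (Suc n) \<le> x" by auto
      moreover have "1 / real (Suc n) > 0" by simp
      ultimately have "0 < x" by linarith
      then show "x \<in> {0<..}" by simp
    qed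
    then have "(indicator {0<..} s :: ennreal) = (SUP n. indicator (?A n) s)"
    proof (cases "s \<in> {0<..}")
      case True
      then obtain n where n: "s \<in> ?A n" using \<open>(\<Union>n. ?A n) = {0<..}\<close> by blast
      have "(SUP n. indicator (?A n) s) = (1::ennreal)"
      proof (rule antisym)
        show "(SUP n. indicator (?A n) s) \<le> (1::ennreal)" by (intro SUP_least) (simp add: indicator_def)
        show "(1::ennreal) \<le> (SUP n. indicator (?A n) s)" using n by (intro SUP_upper2[of n]) (simp_all only: UNIV_I indicator_simps order_refl)
      qed
      then show ?thesis using True by simp
    next
      case False
      then have "s \<notin> ?A n" for n using \<open>(\<Union>n. ?A n) = {0<..}\<close> by blast
      then have "indicator (?A n) s = (0::ennreal)" for n by (rule indicator_simps(2))
      moreover have "indicator {0<..} s = (0::ennreal)" using False by (rule indicator_simps(2))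
      ultimately show ?thesis by (simp only: SUP_constant UNIV_not_empty if_False)
    qed
    then show "ennreal (?f s) * indicator {0<..} s = (SUP n. ennreal (?f s) * indicator (?A n) s)"
      by (simp only: SUP_mult_left_ennreal)
  qed
  also have "\<dots> = (SUP n. \<integral>\<^sup>+s. ennreal (?f s) * indicator (?A n) s \<partial>lborel)"
  proof (rule nn_integral_monotone_convergence_SUP)
    have "1 / real (Suc (Suc n)) \<le> 1 / real (Suc n)" for n
      by (intro divide_left_mono) auto
    then have "s \<in> ?A (Suc n)" if "s \<in> ?A n" for n s
      using that order_trans unfolding atLeast_iff by blast
    then show "incseq (\<lambda>n s. ennreal (?f s) * indicator (?A n) s)"
      by (intro incseq_SucI le_funI mult_left_mono indicator_leI) auto
  qed measurable
  also have "\<dots> \<le> ennreal (pi / sqrt w)"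
    by (intro SUP_least b) simp
  finally show ?thesis .
qed

text \<open>The first bound is \<open>s + 1 / s \<ge> 2\<close> and supplies the contraction factor.
  In the second, \<open>exp (2 * t / s)\<close> absorbs \<open>1 + 1 / s\<close> and
  \<open>exp (2 * t * s)\<close> absorbs the square, which controls the density at both ends of the
  half-line.\<close>

lemma neumann_weight:
  fixes t s :: real assumes t: "t > 0" and s: "s > 0"
  shows "exp (- 2 * t * (s + 1 / s)) \<le> exp (- 4 * t)"
    "exp (- 2 * t * (s + 1 / s)) * (1 + 1 / s) * (s + 2)\<^sup>2 \<le> (1 + 1 / (2 * t)) * (2 + 1 / t)\<^sup>2"
proof -
  have "0 \<le> (s - 1)\<^sup>2 / s" using s by simp
  also have "\<dots> = (s + 1 / s) - 2" using s by (simp add: power2_eq_square field_simps)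
  finally have "2 * t * 2 \<le> 2 * t * (s + 1 / s)" using t by (intro mult_left_mono) auto
  then show "exp (- 2 * t * (s + 1 / s)) \<le> exp (- 4 * t)" by simp
  have "1 + 1 / s \<le> (1 + 1 / (2 * t)) * exp (2 * t / s)"
  proof -
    have "1 + 1 / s \<le> (1 + 1 / (2 * t)) * (1 + 2 * t / s)" using t s by (simp add: field_simps)
    also have "\<dots> \<le> (1 + 1 / (2 * t)) * exp (2 * t / s)"
      using exp_ge_add_one_self[of "2 * t / s"] t by (intro mult_left_mono) auto
    finally show ?thesis .
  qed
  moreover have "(s + 2)\<^sup>2 \<le> (2 + 1 / t)\<^sup>2 * exp (2 * t * s)"
  proof -
    have "s + 2 \<le> (2 + 1 / t) * (1 + t * s)" using t s by (simp add: field_simps)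
    also have "\<dots> \<le> (2 + 1 / t) * exp (t * s)"
      using exp_ge_add_one_self[of "t * s"] t by (intro mult_left_mono) auto
    finally have "(s + 2)\<^sup>2 \<le> ((2 + 1 / t) * exp (t * s))\<^sup>2" using s by (intro power_mono) auto
    then show ?thesis by (simp add: power_mult_distrib mult_ac flip: exp_of_nat_mult)
  qed
  ultimately have "(1 + 1 / s) * (s + 2)\<^sup>2 \<le> ((1 + 1 / (2 * t)) * exp (2 * t / s)) * ((2 + 1 / t)\<^sup>2 * exp (2 * t * s))"
    using s t by (intro mult_mono) auto
  also have "\<dots> = (1 + 1 / (2 * t)) * (2 + 1 / t)\<^sup>2 * exp (2 * t * (s + 1 / s))"
  proof -
    have "exp (2 * t * (s + 1 / s)) = exp (2 * t / s) * exp (2 * t * s)"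
      by (simp add: algebra_simps flip: exp_add)
    then show ?thesis by (simp only: mult_ac)
  qed
  finally have "(1 + 1 / s) * (s + 2)\<^sup>2 * exp (- 2 * t * (s + 1 / s)) \<le> 
      (1 + 1 / (2 * t)) * (2 + 1 / t)\<^sup>2 * exp (2 * t * (s + 1 / s)) * exp (- 2 * t * (s + 1 / s))"
    by (intro mult_right_mono) auto
  also have "\<dots> = (1 + 1 / (2 * t)) * (2 + 1 / t)\<^sup>2"
    by (simp add: mult.assoc flip: exp_add)
  finally show "exp (- 2 * t * (s + 1 / s)) * (1 + 1 / s) * (s + 2)\<^sup>2 \<le> (1 + 1 / (2 * t)) * (2 + 1 / t)\<^sup>2"
    by (simp add: mult_ac)
qed

text \<open>The integral equation is solved by its Neumann series, which converges because the kernel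
  \<open>1 / (s + w)\<close> on \<open>(0, \<infinity>)\<close> has norm \<open>\<pi>\<close> with respect to the weight \<open>s\<^sup>-\<^sup>1\<^sup>/\<^sup>2\<close> and the exponential
  factor is at most \<open>exp (- 4 t) < 1\<close>.\<close>

lemma neumann_solution:
  fixes t :: real assumes t: "t > 0"
  obtains \<rho> :: "real \<Rightarrow> real" where "\<rho> \<in> borel_measurable borel" "\<And>s. \<rho> s \<ge> 0" "\<And>s. s \<le> 0 \<Longrightarrow> \<rho> s = 0"
    "integrable lborel \<rho>" "integrable lborel (\<lambda>s. \<rho> s / s)"
    "\<And>s. s > 0 \<Longrightarrow> \<rho> s = exp (- 2 * t * (s + 1 / s)) / pi * (1 + (LINT v|lborel. \<rho> v / (v + s)))"
proof -
  define E where "E = (\<lambda>s. exp (- 2 * t * (s + 1 / s)))"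
  define q where "q = exp (- 4 * t)"
  define M where "M = (1 + 1 / (2 * t)) * (2 + 1 / t)\<^sup>2"
  have q: "0 \<le> q" "q < 1" using t by (auto simp: q_def)
  have M: "M \<ge> 0" using t by (simp add: M_def)
  have Eq: "E s \<le> q" if "s > 0" for s using neumann_weight(1)[OF t that] by (simp add: E_def q_def)
  have EM: "E s * (1 + 1 / s) * (s + 2)\<^sup>2 \<le> M" if "s > 0" for s using neumann_weight(2)[OF t that] by (simp add: E_def M_def)
  have E0: "E s > 0" for s by (simp add: E_def)
  have EM': "E s \<le> M / sqrt s" if s: "s > 0" for s
  proof -
    have "sqrt s \<le> s + 2"
      by (rule real_le_lsqrt) (use s in \<open>auto simp: power2_eq_square algebra_simps\<close>)
    also have "\<dots> \<le> (1 + 1 / s) * (s + 2)\<^sup>2" 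
    proof -
      have "1 * ((s + 2) * 1) \<le> (1 + 1 / s) * ((s + 2) * (s + 2))" using s by (intro mult_mono) auto
      then show ?thesis by (simp add: power2_eq_square)
    qed
    finally have "E s * sqrt s \<le> E s * ((1 + 1 / s) * (s + 2)\<^sup>2)" using E0[of s] by (intro mult_left_mono) auto
    also have "\<dots> \<le> M" using EM[OF s] by (simp add: mult_ac)
    finally show ?thesis using s by (simp add: field_simps)
  qed
  \<comment> \<open>With values in \<open>ennreal\<close> the Neumann series converges and commutes
    with the integral unconditionally; finiteness is read off later from the geometric
    bound.\<close>
  define T where "T = (\<lambda>(f::real \<Rightarrow> ennreal) w. \<integral>\<^sup>+s. ennreal (E s / (pi * (s + w))) * indicator {0<..} s * f s \<partial>lborel)"
  have T_meas: "T f \<in> borel_measurable borel" if [measurable]: "f \<in> borel_measurable borel" for f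
    unfolding T_def E_def by measurable
  have T_bound: "T f w \<le> ennreal (c * k / sqrt w)" 
    if w: "w > 0" and c: "c \<ge> 0" "k \<ge> 0" and f: "\<And>s. s > 0 \<Longrightarrow> ennreal (E s) * f s \<le> ennreal (c * k / sqrt s)" for f w c k
  proof -
    have "T f w \<le> (\<integral>\<^sup>+s. ennreal (c * k / pi) * (ennreal (1 / (sqrt s * (s + w))) * indicator {0<..} s) \<partial>lborel)"
      unfolding T_def
    proof (rule nn_integral_mono)
      fix s :: real
      show "ennreal (E s / (pi * (s + w))) * indicator {0<..} s * f s \<le> ennreal (c * k / pi) * (ennreal (1 / (sqrt s * (s + w))) * indicator {0<..} s)"
      proof (cases "s > 0")
        case True
        have "ennreal (E s / (pi * (s + w))) * f s = ennreal (1 / (pi * (s + w))) * (ennreal (E s) * f s)"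
          using True w E0[of s] by (simp add: mult.assoc[symmetric] flip: ennreal_mult)
        also have "\<dots> \<le> ennreal (1 / (pi * (s + w))) * ennreal (c * k / sqrt s)"
          by (intro mult_left_mono f True) auto
        also have "\<dots> = ennreal (c * k / pi) * ennreal (1 / (sqrt s * (s + w)))"
          using True w c by (simp add: mult_ac flip: ennreal_mult)
        finally show ?thesis using True by simp
      qed auto
    qed
    also have "\<dots> = ennreal (c * k / pi) * (\<integral>\<^sup>+s. (ennreal (1 / (sqrt s * (s + w))) * indicator {0<..} s) \<partial>lborel)"
      by (rule nn_integral_cmult) measurable
    also have "\<dots> \<le> ennreal (c * k / pi) * ennreal (pi / sqrt w)"
      by (intro mult_left_mono nn_integral_sqrt_kernel w) auto
    also have "\<dots> = ennreal (c * k / sqrt w)" using c w by (simp flip: ennreal_mult)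
    finally show ?thesis .
  qed
  define G where "G = (\<lambda>n. (T ^^ n) (\<lambda>_. 1))"
  have G0: "G 0 = (\<lambda>_. 1)" and GS: "G (Suc n) = T (G n)" for n by (auto simp: G_def)
  have G_meas[measurable]: "G n \<in> borel_measurable borel" for n
    by (induction n) (auto simp: G0 GS T_meas)
  \<comment> \<open>The constant \<open>1\<close> is not bounded by a multiple of
    \<open>1 / sqrt w\<close>. The first application of \<open>T\<close> therefore uses
    \<open>E s \<le> M / sqrt s\<close>, and only the later ones gain a factor \<open>q\<close>;
    hence the offset.\<close>
  have G_bound: "G (Suc n) w \<le> ennreal (q ^ n * M / sqrt w)" if "w > 0" for n w
    using that
  proof (induction n arbitrary: w)
    case 0
    have "T (\<lambda>_. 1) w \<le> ennreal (1 * M / sqrt w)"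
      by (rule T_bound) (use 0 M EM' in \<open>auto intro: ennreal_leI\<close>)
    then show ?case by (simp add: GS G0)
  next
    case (Suc n)
    have "T (G (Suc n)) w \<le> ennreal (q ^ Suc n * M / sqrt w)"
    proof (rule T_bound)
      fix s :: real assume s: "s > 0"
      have "ennreal (E s) * G (Suc n) s \<le> ennreal q * ennreal (q ^ n * M / sqrt s)"
        using Suc.IH[OF s] Eq[OF s] by (intro mult_mono ennreal_leI) auto
      also have "\<dots> = ennreal (q ^ Suc n * M / sqrt s)"
        using q M s by (simp add: mult_ac flip: ennreal_mult)
      finally show "ennreal (E s) * G (Suc n) s \<le> ennreal (q ^ Suc n * M / sqrt s)" .
    qed (use Suc.prems q M in auto)
    then show ?case by (simp add: GS[of "Suc n"])
  qed
  define g where "g = (\<lambda>w. \<Sum>n. G n w)"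
  have g_meas[measurable]: "g \<in> borel_measurable borel" unfolding g_def by measurable
  have g_head: "g w = G 0 w + (\<Sum>n. G (Suc n) w)" for w
  proof -
    have "(\<lambda>n. G (Suc n) w) sums (\<Sum>n. G (Suc n) w)" by (rule summable_sums) simp
    from sums_unique[OF sums_Suc[OF this]] show ?thesis by (simp add: g_def add.commute)
  qed
  have g_eq: "g w = 1 + T g w" for w
  proof -
    have "g w = G 0 w + (\<Sum>n. G (Suc n) w)" by (rule g_head)
    also have "(\<Sum>n. G (Suc n) w) = T g w"
      unfolding GS T_def g_def
      by (subst nn_integral_suminf[symmetric]) (auto simp: E_def intro!: nn_integral_cong)
    finally show ?thesis by (simp add: G0)
  qed
  define N where "N = M / (1 - q)"
  have N: "N \<ge> 0" using M q by (simp add: N_def)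
  have g_bound: "g w \<le> ennreal (1 + N / sqrt w)" if w: "w > 0" for w
  proof -
    have "(\<Sum>n. G (Suc n) w) \<le> (\<Sum>n. ennreal (q ^ n * M / sqrt w))"
      by (intro suminf_le G_bound w) auto
    also have "\<dots> = ennreal (\<Sum>n. q ^ n * (M / sqrt w))"
      using q M w by (subst suminf_ennreal2) (auto intro!: summable_mult2 summable_geometric)
    also have "(\<Sum>n. q ^ n * (M / sqrt w)) = N / sqrt w"
      using q by (subst suminf_mult2[symmetric]) (auto simp: suminf_geometric N_def intro!: summable_geometric)
    finally have "(\<Sum>n. G (Suc n) w) \<le> ennreal (N / sqrt w)" .
    moreover have "g w = G 0 w + (\<Sum>n. G (Suc n) w)" by (rule g_head)
    ultimately have "g w \<le> 1 + ennreal (N / sqrt w)" by (simp add: G0 add_left_mono)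
    then show ?thesis using N w by (simp flip: ennreal_1 ennreal_plus)
  qed
  have g_fin: "g w = ennreal (enn2real (g w))" if "w > 0" for w
    using g_bound[OF that] by (metis ennreal_enn2real ennreal_less_top le_less_trans)
  have gr_bound: "enn2real (g w) \<le> 1 + N / sqrt w" if "w > 0" for w
    using g_bound[OF that] N that by (intro enn2real_leI) auto
  define \<rho> where "\<rho> = (\<lambda>s. indicator {0<..} s * (E s / pi * enn2real (g s)))"
  have \<rho>_meas[measurable]: "\<rho> \<in> borel_measurable borel" unfolding \<rho>_def E_def by measurable
  have \<rho>0: "\<rho> s \<ge> 0" for s using E0[of s] by (simp add: \<rho>_def indicator_def)
  have \<rho>n: "\<rho> s = 0" if "s \<le> 0" for s using that by (simp add: \<rho>_def)
  define B where "B = (1 + N) * M / pi"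
  \<comment> \<open>\<open>1 + 1 / s\<close> dominates both \<open>1\<close> and
    \<open>1 / s\<close>, so one comparison with the kernel at \<open>w = 1\<close> gives both
    integrability claims.\<close>
  have dom: "\<rho> s * (1 + 1 / s) \<le> B / (sqrt s * (s + 1))" if s: "s > 0" for s
  proof -
    have ss: "sqrt s > 0" "sqrt s * sqrt s = s" using s by auto
    have sq: "sqrt s \<le> s + 1" 
      by (rule real_le_lsqrt) (use s in \<open>auto simp: power2_eq_square algebra_simps\<close>)
    have "enn2real (g s) \<le> 1 + N / sqrt s" by (rule gr_bound[OF s])
    also have "\<dots> \<le> (1 + N) * (1 + 1 / sqrt s)" using N ss by (simp add: field_simps)
    also have "1 + 1 / sqrt s = (sqrt s + 1) / sqrt s" using ss by (simp add: field_simps)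
    also have "(1 + N) * ((sqrt s + 1) / sqrt s) \<le> (1 + N) * ((s + 2) / sqrt s)" 
      using N ss sq by (intro mult_left_mono divide_right_mono) auto
    finally have "E s / pi * enn2real (g s) * (1 + 1 / s) * (sqrt s * (s + 1)) \<le> 
        E s / pi * ((1 + N) * ((s + 2) / sqrt s)) * (1 + 1 / s) * (sqrt s * (s + 1))"
      using s E0[of s] by (intro mult_right_mono mult_left_mono) auto
    also have "\<dots> = (1 + N) / pi * (E s * (1 + 1 / s) * ((s + 2) * (s + 1)))" using ss by simp
    also have "\<dots> \<le> (1 + N) / pi * (E s * (1 + 1 / s) * (s + 2)\<^sup>2)"
      unfolding power2_eq_square using s N E0[of s] by (intro mult_left_mono) auto
    also have "\<dots> \<le> (1 + N) / pi * M" using N by (intro mult_left_mono EM s) auto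
    also have "\<dots> = B" by (simp add: B_def)
    finally show ?thesis using s ss by (simp add: \<rho>_def pos_le_divide_eq)
  qed
  have B: "B \<ge> 0" using M N by (simp add: B_def)
  have int: "integrable lborel (\<lambda>s. \<rho> s * (1 + 1 / s))"
  proof (rule integrableI_bounded)
    have "(\<integral>\<^sup>+s. ennreal (norm (\<rho> s * (1 + 1 / s))) \<partial>lborel) \<le> 
       (\<integral>\<^sup>+s. ennreal B * (ennreal (1 / (sqrt s * (s + 1))) * indicator {0<..} s) \<partial>lborel)"
    proof (rule nn_integral_mono)
      fix s :: real
      show "ennreal (norm (\<rho> s * (1 + 1 / s))) \<le> ennreal B * (ennreal (1 / (sqrt s * (s + 1))) * indicator {0<..} s)"
      proof (cases "s > 0")
        case True
        have "norm (\<rho> s * (1 + 1 / s)) = \<rho> s * (1 + 1 / s)" using True \<rho>0[of s] by simp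
        also have "\<dots> \<le> B * (1 / (sqrt s * (s + 1)))" using dom[OF True] by simp
        finally have "ennreal (norm (\<rho> s * (1 + 1 / s))) \<le> ennreal (B * (1 / (sqrt s * (s + 1))))" by (rule ennreal_leI)
        then show ?thesis using True B by (simp add: ennreal_mult[symmetric])
      qed (simp add: \<rho>n)
    qed
    also have "\<dots> = ennreal B * (\<integral>\<^sup>+s. (ennreal (1 / (sqrt s * (s + 1))) * indicator {0<..} s) \<partial>lborel)"
      by (rule nn_integral_cmult) measurable
    also have "\<dots> \<le> ennreal B * ennreal (pi / sqrt 1)"
      by (intro mult_left_mono nn_integral_sqrt_kernel) auto
    also have "\<dots> < \<infinity>" using B by (simp flip: ennreal_mult)
    finally show "(\<integral>\<^sup>+s. ennreal (norm (\<rho> s * (1 + 1 / s))) \<partial>lborel) < \<infinity>" .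
  qed measurable
  have ge: "norm (\<rho> s) \<le> norm (\<rho> s * (1 + 1 / s))" "norm (\<rho> s / s) \<le> norm (\<rho> s * (1 + 1 / s))" for s
    using \<rho>0[of s] \<rho>n[of s] by (cases "s > 0"; simp add: field_simps)+
  show ?thesis
  proof (rule that)
    show "\<rho> \<in> borel_measurable borel" by fact
    show "\<rho> s \<ge> 0" for s by (rule \<rho>0)
    show "\<rho> s = 0" if "s \<le> 0" for s using that by (rule \<rho>n)
    show "integrable lborel \<rho>" by (rule Bochner_Integration.integrable_bound[OF int]) (measurable, intro AE_I2 ge)
    show "integrable lborel (\<lambda>s. \<rho> s / s)" by (rule Bochner_Integration.integrable_bound[OF int]) (measurable, intro AE_I2 ge)
    fix s :: real assume s: "s > 0"
    have "T g s = (\<integral>\<^sup>+v. ennreal (\<rho> v / (v + s)) \<partial>lborel)"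
      unfolding T_def
    proof (rule nn_integral_cong)
      fix v :: real
      show "ennreal (E v / (pi * (v + s))) * indicator {0<..} v * g v = ennreal (\<rho> v / (v + s))"
      proof (cases "v > 0")
        case True
        show ?thesis using True s E0[of v] by (subst g_fin[OF True]) (simp add: \<rho>_def flip: ennreal_mult)
      qed (simp add: \<rho>n)
    qed
    moreover have "(LINT v|lborel. \<rho> v / (v + s)) = enn2real (\<integral>\<^sup>+v. ennreal (\<rho> v / (v + s)) \<partial>lborel)"
    proof (rule integral_eq_nn_integral)
      show "AE v in lborel. 0 \<le> \<rho> v / (v + s)"
        using \<rho>0 \<rho>n s by (intro AE_I2) (metis add_nonneg_nonneg divide_nonneg_nonneg div_0 le_cases less_imp_le order_refl)
    qed measurable
    ultimately have e: "(LINT v|lborel. \<rho> v / (v + s)) = enn2real (T g s)" by simp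
    have "T g s < top" using g_eq[of s] g_fin[OF s] by (metis ennreal_add_eq_top ennreal_less_top less_top)
    then have "enn2real (g s) = 1 + enn2real (T g s)" using g_eq[of s] by (simp add: enn2real_plus)
    then show "\<rho> s = exp (- 2 * t * (s + 1 / s)) / pi * (1 + (LINT v|lborel. \<rho> v / (v + s)))"
      using s unfolding e by (simp add: \<rho>_def E_def)
  qed
qed

section \<open>Analytic continuation of the solution\<close>

text \<open>Density of the non-real points: a real \<open>w\<close> is approached along
  \<open>w + \<i> / (n + 1)\<close>.\<close>

lemma off_real_le:
  fixes f :: "complex \<Rightarrow> real"
  assumes S: "open S" "w \<in> S" and f: "continuous_on S f" and le: "\<And>w. w \<in> S \<Longrightarrow> Im w \<noteq> 0 \<Longrightarrow> f w \<le> 0"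
  shows "f w \<le> 0"
proof (cases "Im w = 0")
  case True
  define u where "u = (\<lambda>n. w + \<i> * of_real (inverse (real (Suc n))))"
  have "u \<longlonglongrightarrow> w + \<i> * of_real 0"
    unfolding u_def by (intro tendsto_intros LIMSEQ_inverse_real_of_nat)
  then have u: "u \<longlonglongrightarrow> w" by simp
  have ev: "\<forall>\<^sub>F n in sequentially. u n \<in> S" using topological_tendstoD[OF u S] .
  have "(\<lambda>n. f (u n)) \<longlonglongrightarrow> f w"
    using f S by (intro isCont_tendsto_compose[OF _ u]) (simp add: continuous_on_eq_continuous_at)
  moreover have "\<forall>\<^sub>F n in sequentially. f (u n) \<le> 0"
    using ev by eventually_elim (rule le, simp_all add: u_def True)
  ultimately show ?thesis by (rule tendsto_upperbound) simp
qed (rule le[OF S(2)])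

lemma off_real_eq:
  fixes f h :: "complex \<Rightarrow> complex"
  assumes S: "open S" "w \<in> S" and "continuous_on S f" "continuous_on S h" "\<And>w. w \<in> S \<Longrightarrow> Im w \<noteq> 0 \<Longrightarrow> f w = h w"
  shows "f w = h w"
proof -
  have "norm (f w - h w) \<le> 0"
    using assms by (intro off_real_le[OF S, of "\<lambda>w. norm (f w - h w)"]) (auto intro!: continuous_intros)
  then show ?thesis by simp
qed

text \<open>Two local extensions agree off the axis, hence by density on the whole overlap of their
  discs, so the choices are compatible. At a real point the value is taken from the extension
  centred there.\<close>

lemma extend_across_real:
  fixes f :: "complex \<Rightarrow> complex"
  assumes S: "open S" and f: "f holomorphic_on {w\<in>S. Im w \<noteq> 0}"
    and loc: "\<And>c. of_real c \<in> S \<Longrightarrow> \<exists>r>0. \<exists>h. h holomorphic_on ball (of_real c) r \<and> (\<forall>w\<in>ball (of_real c) r. Im w \<noteq> 0 \<longrightarrow> h w = f w)"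
  obtains F where "F holomorphic_on S" "\<And>w. w \<in> S \<Longrightarrow> Im w \<noteq> 0 \<Longrightarrow> F w = f w"
proof -
  define ok where "ok = (\<lambda>c r h. r > 0 \<and> h holomorphic_on ball (complex_of_real c) r \<and> (\<forall>w\<in>ball (of_real c) r. Im w \<noteq> 0 \<longrightarrow> h w = f w))"
  have "\<forall>c. \<exists>r h. of_real c \<in> S \<longrightarrow> ok c r h" using loc unfolding ok_def by blast
  then obtain r h where ok: "\<And>c. of_real c \<in> S \<Longrightarrow> ok c (r c) (h c)" by metis
  define F where "F = (\<lambda>w. if Im w \<noteq> 0 then f w else h (Re w) w)"
  have "F field_differentiable (at w)" if w: "w \<in> S" for w
  proof (cases "Im w = 0")
    case False
    have o: "open {w\<in>S. Im w \<noteq> 0}" 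
    proof -
      have "open (S - \<real>)" using S closed_complex_Reals by (rule open_Diff)
      moreover have "S - \<real> = {w\<in>S. Im w \<noteq> 0}" by (auto simp: complex_is_Real_iff)
      ultimately show ?thesis by simp
    qed
    have "F holomorphic_on {w\<in>S. Im w \<noteq> 0}" using f by (rule holomorphic_transform) (simp add: F_def)
    then show ?thesis using w False o by (auto simp: holomorphic_on_open field_differentiable_def)
  next
    case True
    define c where "c = Re w"
    have wc: "w = of_real c" using True by (simp add: c_def complex_eq_iff)
    have okc: "ok c (r c) (h c)" using ok w wc by simp
    obtain e where e: "e > 0" "ball w e \<subseteq> S" using S w open_contains_ball by blast
    define d where "d = min e (r c)"
    have d: "d > 0" "ball w d \<subseteq> S" "ball w d \<subseteq> ball (of_real c) (r c)" using e okc by (auto simp: d_def ok_def wc)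
    have eq: "F u = h c u" if u: "u \<in> ball w d" for u
    proof (cases "Im u = 0")
      case False
      then show ?thesis using okc d u by (auto simp: F_def ok_def)
    next
      case True
      define c' where "c' = Re u"
      have uc: "u = of_real c'" using True by (simp add: c'_def complex_eq_iff)
      have okc': "ok c' (r c') (h c')" using ok d u uc by blast
      have "h c' u = h c u"
      proof (rule off_real_eq[of "ball w d \<inter> ball (of_real c') (r c')" u "h c'" "h c"])
        show "open (ball w d \<inter> ball (of_real c') (r c'))" by auto
        show "u \<in> ball w d \<inter> ball (of_real c') (r c')" using u okc' by (auto simp: uc ok_def)
        show "continuous_on (ball w d \<inter> ball (of_real c') (r c')) (h c')"
          using okc' by (auto simp: ok_def intro: holomorphic_on_imp_continuous_on holomorphic_on_subset)
        show "continuous_on (ball w d \<inter> ball (of_real c') (r c')) (h c)"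
          using okc d by (auto simp: ok_def intro: holomorphic_on_imp_continuous_on holomorphic_on_subset)
        fix v assume "v \<in> ball w d \<inter> ball (of_real c') (r c')" "Im v \<noteq> 0"
        then show "h c' v = h c v" using okc okc' d by (auto simp: ok_def)
      qed
      then show ?thesis using True by (simp add: F_def c'_def)
    qed
    have "h c holomorphic_on ball w d" using okc d by (auto simp: ok_def intro: holomorphic_on_subset)
    then have "F holomorphic_on ball w d" by (rule holomorphic_transform) (simp add: eq)
    then show ?thesis using d(1) by (auto simp: holomorphic_on_open field_differentiable_def)
  qed
  then have "F holomorphic_on S" by (auto simp: holomorphic_on_def field_differentiable_at_within)
  then show ?thesis by (rule that) (simp add: F_def)
qed

section \<open>Stieltjes transforms\<close>

definition stieltjes :: "(real \<Rightarrow> real) \<Rightarrow> complex \<Rightarrow> complex" where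
  "stieltjes \<rho> w = (LINT s|lborel. of_real (\<rho> s) / (of_real s + w))"

lemma stieltjes_integrable:
  assumes \<rho>: "integrable lborel \<rho>" and r: "r > 0" "\<And>s. \<rho> s \<noteq> 0 \<Longrightarrow> norm (of_real s + w) \<ge> r"
  shows "integrable lborel (\<lambda>s. of_real (\<rho> s) / (of_real s + w) :: complex)"
proof (rule Bochner_Integration.integrable_bound)
  show "integrable lborel (\<lambda>s. \<rho> s / r)" using \<rho> by simp
  have [measurable]: "\<rho> \<in> borel_measurable borel" using \<rho> by (simp add: borel_measurable_integrable flip: measurable_lborel1)
  show "(\<lambda>s. of_real (\<rho> s) / (of_real s + w) :: complex) \<in> borel_measurable lborel" by measurable
  show "AE s in lborel. norm (of_real (\<rho> s) / (of_real s + w) :: complex) \<le> norm (\<rho> s / r)"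
  proof (intro AE_I2)
    fix s
    show "norm (of_real (\<rho> s) / (of_real s + w) :: complex) \<le> norm (\<rho> s / r)"
      using r(1) r(2)[of s] by (cases "\<rho> s = 0") (auto simp: norm_divide intro!: divide_left_mono mult_pos_pos)
  qed
qed

text \<open>Measuring against \<open>\<rho> s / s\<close> makes the estimate invariant under a
  common scaling of \<open>s\<close> and \<open>w\<close>. It therefore stays uniform as
  \<open>w\<close> tends to \<open>0\<close> or to infinity within a sector.\<close>

lemma stieltjes_bound:
  assumes \<rho>: "integrable lborel (\<lambda>s. \<rho> s / s)" and r: "r > 0" "\<And>s. \<rho> s \<noteq> 0 \<Longrightarrow> s > 0 \<and> norm (of_real s + w) \<ge> s / r"
    and \<rho>0: "\<And>s. \<rho> s \<ge> 0"
  shows "norm (stieltjes \<rho> w) \<le> r * (LINT s|lborel. \<rho> s / s)"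
proof -
  have "norm (stieltjes \<rho> w) \<le> (LINT s|lborel. r * (\<rho> s / s))"
    unfolding stieltjes_def
  proof (rule Bochner_Integration.integral_norm_bound_integral)
    have b: "norm (of_real (\<rho> s) / (of_real s + w) :: complex) \<le> r * (\<rho> s / s)" for s
    proof (cases "\<rho> s = 0")
      case False
      with r(2)[of s] have s: "s > 0" "norm (of_real s + w) \<ge> s / r" by auto
      have "\<rho> s / norm (of_real s + w) \<le> \<rho> s / (s / r)"
        using s \<rho>0[of s] divide_pos_pos[OF s(1) r(1)] by (intro divide_left_mono mult_pos_pos less_le_trans[OF _ s(2)]) auto
      then show ?thesis using \<rho>0[of s] by (simp add: norm_divide mult.commute)
    qed simp
    have "(\<lambda>s. \<rho> s / s * s) \<in> borel_measurable lborel" using \<rho> by (intro borel_measurable_times) (auto intro: borel_measurable_integrable)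
    moreover have "(\<lambda>s. \<rho> s / s * s) = \<rho>" using r(2) by (intro ext) force
    ultimately have [measurable]: "\<rho> \<in> borel_measurable borel" by simp
    show "integrable lborel (\<lambda>s. r * (\<rho> s / s))" using \<rho> by (rule integrable_mult_right)
    then show "integrable lborel (\<lambda>s. of_real (\<rho> s) / (of_real s + w) :: complex)"
      by (rule Bochner_Integration.integrable_bound) (measurable, intro AE_I2 order_trans[OF b], unfold real_norm_def, rule abs_ge_self)
    show "norm (of_real (\<rho> s) / (of_real s + w) :: complex) \<le> r * (\<rho> s / s)" for s by (rule b)
  qed
  then show ?thesis by (simp only: integral_mult_right_zero)
qed

text \<open>The error of the difference quotient has the exact integrand
  \<open>h * \<rho> s / (u\<^sup>2 * (u + h))\<close> with \<open>u = s + w\<close>, and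
  \<open>4 * r ^ 3\<close> is \<open>(2 * r)\<^sup>2 * r\<close>. The distance is measured to points
  where \<open>\<rho>\<close> is nonzero, so a gap in the density yields analyticity across the
  reflected gap.\<close>

lemma stieltjes_differentiable:
  assumes \<rho>: "integrable lborel \<rho>" and r: "r > 0" "\<And>s. \<rho> s \<noteq> 0 \<Longrightarrow> norm (of_real s + w) \<ge> 2 * r"
  shows "stieltjes \<rho> field_differentiable (at w)"
proof -
  have [measurable]: "\<rho> \<in> borel_measurable borel" using \<rho> by (simp add: borel_measurable_integrable flip: measurable_lborel1)
  define D where "D = (LINT s|lborel. - (of_real (\<rho> s) / (of_real s + w)\<^sup>2))"
  have iD: "integrable lborel (\<lambda>s. - (of_real (\<rho> s) / (of_real s + w)\<^sup>2) :: complex)"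
  proof (rule Bochner_Integration.integrable_bound)
    show "integrable lborel (\<lambda>s. \<rho> s / (2 * r)\<^sup>2)" using \<rho> by simp
    show "AE s in lborel. norm (- (of_real (\<rho> s) / (of_real s + w)\<^sup>2) :: complex) \<le> norm (\<rho> s / (2 * r)\<^sup>2)"
    proof (intro AE_I2)
      fix s
      show "norm (- (of_real (\<rho> s) / (of_real s + w)\<^sup>2) :: complex) \<le> norm (\<rho> s / (2 * r)\<^sup>2)"
      proof (cases "\<rho> s = 0")
        case False
        have "(2 * r)\<^sup>2 \<le> (norm (of_real s + w))\<^sup>2" using r(1) r(2)[OF False] by (intro power_mono) auto
        then show ?thesis using r(1) r(2)[OF False]
          by (auto simp: norm_divide norm_power intro!: divide_left_mono mult_pos_pos)
      qed simp
    qed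
  qed measurable
  have q: "norm ((stieltjes \<rho> (w + h) - stieltjes \<rho> w) / h - D) \<le> norm h * (LINT s|lborel. \<bar>\<rho> s\<bar> / (4 * r ^ 3))" 
    if h: "h \<noteq> 0" "norm h < r" for h
  proof -
    let ?q = "\<lambda>s. (of_real (\<rho> s) / (of_real s + (w + h)) - of_real (\<rho> s) / (of_real s + w)) / h - - (of_real (\<rho> s) / (of_real s + w)\<^sup>2)"
    have far: "norm (of_real s + (w + h)) \<ge> r" if "\<rho> s \<noteq> 0" for s
      using norm_diff_ineq[of "of_real s + w" h] r(2)[OF that] h(2) by (simp add: add.assoc)
    have i1: "integrable lborel (\<lambda>s. of_real (\<rho> s) / (of_real s + (w + h)) :: complex)"
      by (rule stieltjes_integrable[OF \<rho> r(1) far])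
    have i2: "integrable lborel (\<lambda>s. of_real (\<rho> s) / (of_real s + w) :: complex)"
      using r by (intro stieltjes_integrable[OF \<rho>, of "2 * r"]) auto
    have "(stieltjes \<rho> (w + h) - stieltjes \<rho> w) / h - D = 
      (LINT s|lborel. ?q s)"
      unfolding stieltjes_def D_def using i1 i2 iD by simp
    also have "norm \<dots> \<le> (LINT s|lborel. norm h * (\<bar>\<rho> s\<bar> / (4 * r ^ 3)))"
    proof (rule Bochner_Integration.integral_norm_bound_integral)
      show "integrable lborel ?q"
        using i1 i2 iD by simp
      show "integrable lborel (\<lambda>s. norm h * (\<bar>\<rho> s\<bar> / (4 * r ^ 3)))" using \<rho> by simp
      fix s
      show "norm (?q s)
         \<le> norm h * (\<bar>\<rho> s\<bar> / (4 * r ^ 3))"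
      proof (cases "\<rho> s = 0")
        case False
        define u where "u = of_real s + w"
        have u: "norm u \<ge> 2 * r" "norm (u + h) \<ge> r" using r(2)[OF False] far[OF False] by (auto simp: u_def add.assoc)
        have u0: "u \<noteq> 0" "u + h \<noteq> 0" using u r(1) by auto
        have "?q s
          = (of_real (\<rho> s) / (u + h) - of_real (\<rho> s) / u) / h + of_real (\<rho> s) / u\<^sup>2"
          by (simp add: u_def add.assoc)
        also have "\<dots> = h * of_real (\<rho> s) / (u\<^sup>2 * (u + h))"
          using u0 h(1) by (simp add: divide_simps power2_eq_square) (simp add: algebra_simps)
        finally have "norm (?q s)
          = norm h * \<bar>\<rho> s\<bar> / ((norm u)\<^sup>2 * norm (u + h))" by (simp add: norm_mult norm_divide norm_power)
        also have "\<dots> \<le> norm h * \<bar>\<rho> s\<bar> / ((2 * r)\<^sup>2 * r)"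
          using u r(1) by (intro divide_left_mono mult_mono power_mono mult_pos_pos) auto
        also have "\<dots> = norm h * (\<bar>\<rho> s\<bar> / (4 * r ^ 3))" by (simp add: power2_eq_square power3_eq_cube)
        finally show ?thesis .
      qed simp
    qed
    finally show ?thesis by simp
  qed
  have "((\<lambda>h. (stieltjes \<rho> (w + h) - stieltjes \<rho> w) / h - D) \<longlongrightarrow> 0) (at 0)"
  proof (rule Lim_null_comparison)
    have "\<forall>\<^sub>F h in at 0. norm h < r \<and> h \<noteq> (0::complex)"
      using r(1) by (auto simp: eventually_at intro!: exI[of _ r])
    then show "\<forall>\<^sub>F h in at 0. norm ((stieltjes \<rho> (w + h) - stieltjes \<rho> w) / h - D) \<le> norm h * (LINT s|lborel. \<bar>\<rho> s\<bar> / (4 * r ^ 3))"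
      by eventually_elim (use q in auto)
    show "((\<lambda>h. norm (h::complex) * (LINT s|lborel. \<bar>\<rho> s\<bar> / (4 * r ^ 3))) \<longlongrightarrow> 0) (at 0)"
      by (intro tendsto_mult_left_zero tendsto_norm_zero tendsto_ident_at)
  qed
  then have "(stieltjes \<rho> has_field_derivative D) (at w)" unfolding DERIV_def by (rule LIM_zero_cancel)
  then show ?thesis by (auto simp: field_differentiable_def)
qed

abbreviation slit :: "complex set" where "slit \<equiv> - \<real>\<^sub>\<le>\<^sub>0"

lemma slit_Re: "Re w > 0 \<Longrightarrow> w \<in> slit" and slit_Im: "Im w \<noteq> 0 \<Longrightarrow> w \<in> slit"
  and slit_nz: "w \<in> slit \<Longrightarrow> w \<noteq> 0" and slit_cnj: "w \<in> slit \<Longrightarrow> cnj w \<in> slit"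
  by (auto simp: complex_nonpos_Reals_iff)

lemma Re_add_inverse_nonneg: "Re w \<ge> 0 \<Longrightarrow> Re (w + 1 / w) \<ge> 0"
  by (simp add: Re_divide)

lemma dist_slit_right: "Re w \<ge> 0 \<Longrightarrow> s > 0 \<Longrightarrow> norm (of_real s + w) \<ge> s"
  using complex_Re_le_cmod[of "of_real s + w"] by simp

text \<open>Outside a sector of slope 1/4 around the positive axis: for \<open>s\<close> up to
  \<open>2 * Re w\<close> the imaginary part keeps \<open>w\<close> away from \<open>s\<close>, for
  larger \<open>s\<close> the real part does.\<close>

lemma dist_slit_left:
  assumes "Re w > 0" "\<bar>Im w\<bar> \<ge> Re w / 4" "s > 0"
  shows "norm (of_real s - w) \<ge> s / 8"
proof (cases "s \<le> 2 * Re w")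
  case True
  then have "s / 8 \<le> \<bar>Im (of_real s - w)\<bar>" using assms by simp
  then show ?thesis using abs_Im_le_cmod order_trans by blast
next
  case False
  then have "s / 8 \<le> \<bar>Re (of_real s - w)\<bar>" using assms by simp
  then show ?thesis using abs_Re_le_cmod order_trans by blast
qed

section \<open>The solution g, its bounds, and its jump across the cut\<close>

locale neumann =
  fixes t :: real and \<rho> :: "real \<Rightarrow> real"
  assumes t: "t > 0" and \<rho>_meas: "\<rho> \<in> borel_measurable borel" and \<rho>_ge: "\<And>s. \<rho> s \<ge> 0" and \<rho>_neg: "\<And>s. s \<le> 0 \<Longrightarrow> \<rho> s = 0"
    and \<rho>_int: "integrable lborel \<rho>" and \<rho>_int': "integrable lborel (\<lambda>s. \<rho> s / s)"
    and \<rho>_eq: "\<And>s. s > 0 \<Longrightarrow> \<rho> s = exp (- 2 * t * (s + 1 / s)) / pi * (1 + (LINT v|lborel. \<rho> v / (v + s)))"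
begin

lemma \<rho>_pos: "\<rho> s \<noteq> 0 \<Longrightarrow> s > 0" using \<rho>_neg[of s] by linarith

definition g where "g w = 1 + stieltjes \<rho> w"
text \<open>The limit of \<open>g\<close> at \<open>0\<close> along the imaginary axis and, as
  \<open>\<rho>\<close> is nonnegative, a bound for \<open>g\<close> on the closed right half-plane.
  It determines the constant \<open>d\<close> of the factorization.\<close>

definition g0 where "g0 = 1 + (LINT s|lborel. \<rho> s / s)"
text \<open>The continuation of \<open>\<rho>\<close> from the positive axis to \<open>slit\<close>;
  the integral equation says exactly that the two agree there.\<close>

definition R where "R w = exp (- of_real (2 * t) * (w + 1 / w)) / of_real pi * g w"

lemma g0_ge: "g0 \<ge> 1"
  unfolding g0_def using \<rho>_ge \<rho>_pos by (auto intro!: Bochner_Integration.integral_nonneg) (metis \<rho>_ge \<rho>_pos div_0 divide_nonneg_pos order_refl)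

lemma g_holo: "g holomorphic_on slit"
proof -
  have "stieltjes \<rho> field_differentiable (at w)" if w: "w \<in> slit" for w
  proof -
    have "open slit" by (simp add: open_Compl)
    then obtain e where e: "e > 0" "ball w e \<subseteq> slit" using w open_contains_ball by blast
    show ?thesis
    proof (rule stieltjes_differentiable[OF \<rho>_int, of "e / 2"])
      fix s assume "\<rho> s \<noteq> 0"
      then have "- complex_of_real s \<in> \<real>\<^sub>\<le>\<^sub>0" using \<rho>_pos[of s] by (simp add: complex_nonpos_Reals_iff)
      then have "- complex_of_real s \<notin> ball w e" using e by auto
      then show "2 * (e / 2) \<le> norm (of_real s + w)" by (simp add: dist_norm add.commute)
    qed (use e in simp)
  qed
  then have "stieltjes \<rho> holomorphic_on slit" by (simp add: holomorphic_on_def field_differentiable_at_within)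
  then show ?thesis unfolding g_def[abs_def] by (intro holomorphic_intros)
qed

lemma g_cnj: "cnj (g w) = g (cnj w)"
proof -
  have "cnj (stieltjes \<rho> w) = stieltjes \<rho> (cnj w)" unfolding stieltjes_def Bochner_Integration.integral_cnj[symmetric] by simp
  then show ?thesis by (simp add: g_def)
qed

lemma R_holo: "R holomorphic_on slit"
  unfolding R_def[abs_def] by (intro holomorphic_intros g_holo) auto

lemma R_real: "s > 0 \<Longrightarrow> R (of_real s) = of_real (\<rho> s)"
proof -
  assume s: "s > 0"
  have "stieltjes \<rho> (of_real s) = of_real (LINT v|lborel. \<rho> v / (v + s))"
    unfolding stieltjes_def integral_complex_of_real[symmetric] by simp
  then show ?thesis unfolding R_def g_def by (subst \<rho>_eq[OF s]) (simp flip: exp_of_real)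
qed

lemma g_bound: "Re w \<ge> 0 \<Longrightarrow> norm (g w) \<le> g0"
proof -
  assume w: "Re w \<ge> 0"
  have "norm (stieltjes \<rho> w) \<le> 1 * (LINT s|lborel. \<rho> s / s)"
    by (rule stieltjes_bound[OF \<rho>_int']) (use w \<rho>_pos \<rho>_ge dist_slit_right in auto)
  then show ?thesis using norm_triangle_ineq[of 1 "stieltjes \<rho> w"] by (simp add: g_def g0_def)
qed

lemma g_bound': "Re w > 0 \<Longrightarrow> \<bar>Im w\<bar> \<ge> Re w / 4 \<Longrightarrow> norm (g (- w)) \<le> 8 * g0"
proof -
  assume w: "Re w > 0" "\<bar>Im w\<bar> \<ge> Re w / 4"
  have "norm (stieltjes \<rho> (- w)) \<le> 8 * (LINT s|lborel. \<rho> s / s)"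
    by (rule stieltjes_bound[OF \<rho>_int']) (use w \<rho>_pos \<rho>_ge dist_slit_left[OF w] in auto)
  then show ?thesis using norm_triangle_ineq[of 1 "stieltjes \<rho> (- w)"] by (simp add: g_def g0_def)
qed

lemma R_bound: "Re w \<ge> 0 \<Longrightarrow> norm (R w) \<le> g0 / pi"
proof -
  assume w: "Re w \<ge> 0"
  have "norm (exp (- of_real (2 * t) * (w + 1 / w))) \<le> 1"
    unfolding norm_exp_eq_Re using Re_add_inverse_nonneg[OF w] t by simp
  then have "norm (exp (- of_real (2 * t) * (w + 1 / w))) * norm (g w) \<le> 1 * g0"
    by (intro mult_mono g_bound w) auto
  then show ?thesis by (simp add: R_def norm_mult norm_divide divide_right_mono)
qed

text \<open>Off the real axis, \<open>Y\<close> is \<open>\<pi> P exp (- t (w + 1/w)) / csqrt w\<close>; its two halves match along the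
  positive axis because the jump of the Stieltjes transform is compensated.\<close>

definition Y where "Y w = g (- w) - \<i> * of_real pi * of_real (sgn (Im w)) * R w"

text \<open>The part of the Cauchy integral over \<open>[c - r, c + r]\<close> is moved to the lower
  semicircle, where \<open>\<rho>\<close> continues as \<open>R\<close>. For \<open>w\<close> above
  the axis nothing is crossed. For \<open>w\<close> below, the path is moved upwards instead, and
  Cauchy's formula on the full circle adds the \<open>2 * pi * \<i> * R w\<close> by which the two
  branches of \<open>Y\<close> differ. What matters about the bound is that it does not depend on
  \<open>c\<close>.\<close>

lemma Y_local:
  assumes c: "c > 0"
  obtains h where "h holomorphic_on ball (of_real c) (c/2)" 
    "\<And>w. w \<in> ball (of_real c) (c/2) \<Longrightarrow> Im w \<noteq> 0 \<Longrightarrow> h w = Y w"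
    "\<And>w. w \<in> ball (of_real c) (c/4) \<Longrightarrow> norm (h w) \<le> 11 * g0"
proof -
  define r where "r = c / 2"
  have r: "r > 0" using c by (simp add: r_def)
  let ?B = "ball (complex_of_real c) r"
  \<comment> \<open>The density with the segment around \<open>c\<close> cut out; its transform is
    holomorphic at \<open>- w\<close> for all \<open>w\<close> in the disc.\<close>
  define \<rho>o where "\<rho>o = (\<lambda>s. indicator (- {c - r..c + r}) s * \<rho> s)"
  note [measurable] = \<rho>_meas
  have \<rho>o_int: "integrable lborel \<rho>o" unfolding \<rho>o_def
    by (rule Bochner_Integration.integrable_bound[OF \<rho>_int]) (measurable, simp add: indicator_def)
  have \<rho>o_int': "integrable lborel (\<lambda>s. \<rho>o s / s)" unfolding \<rho>o_def
    by (rule Bochner_Integration.integrable_bound[OF \<rho>_int']) (measurable, simp add: indicator_def)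
  have \<rho>o_nz: "s > 0 \<and> \<bar>s - c\<bar> > r" if "\<rho>o s \<noteq> 0" for s
    using that \<rho>_pos[of s] by (auto simp: \<rho>o_def indicator_def abs_if split: if_splits)
  have sphere_right: "Re u > 0" if "norm (u - of_real c) \<le> r" for u
  proof -
    have "\<bar>Re (u - of_real c)\<bar> \<le> r" using abs_Re_le_cmod that order_trans by blast
    then have "\<bar>Re u - c\<bar> \<le> c / 2" by (simp add: r_def)
    then show ?thesis using c by linarith
  qed
  have "(\<lambda>w. stieltjes \<rho>o (- w)) field_differentiable (at w)" if w: "w \<in> ?B" for w
  proof -
    define e where "e = (r - norm (w - of_real c)) / 2"
    have e: "e > 0" using w by (simp add: e_def dist_norm norm_minus_commute)
    have "stieltjes \<rho>o field_differentiable (at (- w))"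
    proof (rule stieltjes_differentiable[OF \<rho>o_int e])
      fix s assume "\<rho>o s \<noteq> 0"
      then have "r < norm (complex_of_real s - of_real c)" using \<rho>o_nz[of s] by (simp flip: of_real_diff)
      also have "\<dots> \<le> norm (of_real s - w) + norm (w - of_real c)" using norm_triangle_ineq[of "of_real s - w" "w - of_real c"] by simp
      finally show "2 * e \<le> norm (of_real s + - w)" by (simp add: e_def)
    qed
    then have "(stieltjes \<rho>o \<circ> (\<lambda>w. - w)) field_differentiable (at w)"
      by (intro field_differentiable_compose field_differentiable_minus field_differentiable_ident)
    then show ?thesis by (simp add: o_def)
  qed
  then have holo1: "(\<lambda>w. stieltjes \<rho>o (- w)) holomorphic_on ?B" by (simp add: holomorphic_on_def field_differentiable_at_within)
  let ?low = "part_circlepath (of_real c) r pi (2 * pi)"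
  define A where "A w = contour_integral ?low (\<lambda>u. R u / (u - w))" for w
  have low_im: "path_image ?low \<subseteq> sphere (of_real c) r" using r by (intro path_image_part_circlepath_subset') auto
  have R_cont: "continuous_on S R" if "S \<subseteq> {u. Re u > 0}" for S
    using R_holo that slit_Re by (intro holomorphic_on_imp_continuous_on holomorphic_on_subset[OF R_holo]) blast
  have sph: "sphere (of_real c) r \<subseteq> {u. Re u > 0}" "cball (of_real c) r \<subseteq> {u. Re u > 0}"
    using sphere_right by (auto simp: dist_norm norm_minus_commute)
  have nsph: "u \<noteq> w" if "u \<in> path_image ?low" "w \<in> ?B" for u w using that low_im by auto
  have low_int: "(\<lambda>u. R u / (u - w)) contour_integrable_on ?low" if w: "w \<in> ?B" for w
    by (rule contour_integrable_continuous_part_circlepath)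
       (use nsph[OF _ w] low_im sph in \<open>auto intro!: continuous_intros R_cont\<close>)
  have holo2: "A holomorphic_on ?B"
  proof -
    have "A field_differentiable (at w)" if w: "w \<in> ?B" for w
    proof -
      have "(A has_field_derivative (of_nat 1 * contour_integral ?low (\<lambda>u. R u / (u - w) ^ Suc 1))) (at w)"
      proof (rule Cauchy_next_derivative(2)[where S = ?B and B = "norm (\<i> * (2 * pi - pi) * r)" and \<gamma> = ?low])
        show "continuous_on (path_image ?low) R" using low_im sph by (intro R_cont) auto
        show "norm (vector_derivative ?low (at x)) \<le> norm (\<i> * (2 * pi - pi) * r)" for x
          by (simp add: vector_derivative_part_circlepath norm_mult)
        show "((\<lambda>u. R u / (u - w) ^ 1) has_contour_integral A w) ?low" if "w \<in> ?B - path_image ?low" for w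
          using has_contour_integral_integral[OF low_int[of w]] that by (simp add: A_def)
        show "w \<in> ?B - path_image ?low" using w low_im by auto
      qed auto
      then show ?thesis by (auto simp: field_differentiable_def)
    qed
    then show ?thesis by (simp add: holomorphic_on_def field_differentiable_at_within)
  qed
  define h where "h w = 1 + stieltjes \<rho>o (- w) + A w - \<i> * of_real pi * R w" for w
  have holo: "h holomorphic_on ?B"
  proof -
    have "?B \<subseteq> {u. Re u > 0}" using sph(2) ball_subset_cball by blast
    then have "?B \<subseteq> slit" using slit_Re by blast
    then show ?thesis unfolding h_def[abs_def] by (intro holomorphic_intros holo1 holo2 holomorphic_on_subset[OF R_holo])
  qed
  have seg: "contour_integral (linepath (of_real (c - r)) (of_real (c + r))) (\<lambda>u. R u / (u - w)) = stieltjes \<rho> (- w) - stieltjes \<rho>o (- w)"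
    if w: "Im w \<noteq> 0" for w
  proof -
    have far: "norm (of_real s + - w) \<ge> \<bar>Im w\<bar>" for s using abs_Im_le_cmod[of "of_real s + - w"] by simp
    have i1: "integrable lborel (\<lambda>s. of_real (\<rho> s) / (of_real s + - w))" by (rule stieltjes_integrable[OF \<rho>_int _ far]) (use w in auto)
    have i2: "integrable lborel (\<lambda>s. of_real (\<rho>o s) / (of_real s + - w))" by (rule stieltjes_integrable[OF \<rho>o_int _ far]) (use w in auto)
    have e: "of_real (\<rho> s) / (of_real s + - w) - of_real (\<rho>o s) / (of_real s + - w) = indicator {c - r..c + r} s *\<^sub>R (R (of_real s) / (of_real s - w))" for s
    proof (cases "s \<in> {c - r..c + r}")
      case True
      then have "s > 0" using c by (auto simp: r_def)
      then show ?thesis using True by (simp add: \<rho>o_def R_real)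
    qed (simp add: \<rho>o_def)
    have "integrable lborel (\<lambda>s. indicator {c - r..c + r} s *\<^sub>R (R (of_real s) / (of_real s - w)))"
      unfolding e[symmetric] using i1 i2 by (rule Bochner_Integration.integrable_diff)
    then have si: "set_integrable lborel {c - r..c + r} (\<lambda>s. R (of_real s) / (of_real s - w))" by (simp add: set_integrable_def)
    have "contour_integral (linepath (of_real (c - r)) (of_real (c + r))) (\<lambda>u. R u / (u - w)) = integral {c - r..c + r} (\<lambda>s. R (of_real s) / (of_real s - w))"
      using r by (subst contour_integral_linepath_Reals_eq) auto
    also have "\<dots> = (LINT s:{c - r..c + r}|lborel. R (of_real s) / (of_real s - w))"
      by (rule set_borel_integral_eq_integral(2)[OF si, symmetric])
    also have "\<dots> = (LINT s|lborel. of_real (\<rho> s) / (of_real s + - w) - of_real (\<rho>o s) / (of_real s + - w))"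
      unfolding set_lebesgue_integral_def e ..
    also have "\<dots> = stieltjes \<rho> (- w) - stieltjes \<rho>o (- w)" unfolding stieltjes_def using i1 i2 by (rule Bochner_Integration.integral_diff)
    finally show ?thesis .
  qed
  have deform: "contour_integral (linepath (of_real (c - r)) (of_real (c + r))) (\<lambda>u. R u / (u - w)) = contour_integral p (\<lambda>u. R u / (u - w))"
    if V: "open V" "convex V" "V \<subseteq> {u. Re u > 0}" "w \<notin> V" "closed_segment (of_real (c - r)) (of_real (c + r)) \<subseteq> V" 
    and p: "valid_path p" "path_image p \<subseteq> V" "pathstart p = of_real (c - r)" "pathfinish p = of_real (c + r)" for w V p
  proof -
    have Vs: "V \<subseteq> slit" using V(3) slit_Re by blast
    have "(\<lambda>u. R u / (u - w)) holomorphic_on V"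
      using V(4) by (intro holomorphic_intros holomorphic_on_subset[OF R_holo Vs]) auto
    then obtain F where F: "\<And>u. u \<in> V \<Longrightarrow> (F has_field_derivative R u / (u - w)) (at u within V)"
      using holomorphic_convex_primitive'[OF V(2,1)] by blast
    have "((\<lambda>u. R u / (u - w)) has_contour_integral (F (of_real (c + r)) - F (of_real (c - r)))) p"
      using contour_integral_primitive[OF F p(1,2)] p(3,4) by simp
    moreover have "((\<lambda>u. R u / (u - w)) has_contour_integral (F (of_real (c + r)) - F (of_real (c - r)))) (linepath (of_real (c - r)) (of_real (c + r)))"
      using contour_integral_primitive[OF F, of "linepath (of_real (c - r)) (of_real (c + r))"] V(5) by simp
    ultimately show ?thesis by (simp add: contour_integral_unique)
  qed
  have ends: "of_real c + of_real r * exp (\<i> * of_real pi) = complex_of_real (c - r)" 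
    "of_real c + of_real r * exp (\<i> * of_real (2 * pi)) = complex_of_real (c + r)"
    "of_real c + of_real r * exp (\<i> * of_real 0) = complex_of_real (c + r)"
    unfolding cis_conv_exp[symmetric] by simp_all
  have "\<i> * (2 * complex_of_real pi) = 2 * complex_of_real pi * \<i>" by simp
  then have e2: "exp (\<i> * (2 * complex_of_real pi)) = 1" by (simp only: exp_two_pi_i)
  have Yh: "h w = Y w" if w: "w \<in> ?B" and im: "Im w \<noteq> 0" for w
  proof (cases "Im w > 0")
    case True
    define V where "V = {u. Im u < Im w} \<inter> {u. Re u > 0}"
    have "contour_integral (linepath (of_real (c - r)) (of_real (c + r))) (\<lambda>u. R u / (u - w)) = A w"
      unfolding A_def
    proof (rule deform[of V])
      show "open V" unfolding V_def by (intro open_Int open_halfspace_Im_lt open_halfspace_Re_gt)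
      show "convex V" unfolding V_def by (intro convex_Int convex_halfspace_Im_lt convex_halfspace_Re_gt)
      show "closed_segment (of_real (c - r)) (of_real (c + r)) \<subseteq> V" 
        by (rule closed_segment_subset) (use True r c \<open>convex V\<close> in \<open>auto simp: V_def r_def\<close>)
      show "path_image ?low \<subseteq> V"
      proof
        fix u assume u: "u \<in> path_image ?low"
        then obtain x where x: "pi \<le> x" "x \<le> 2 * pi" "u = of_real c + of_real r * cis x"
          by (auto simp: path_image_part_circlepath' closed_segment_eq_real_ivl)
        have "sin x \<le> 0" using sin_le_zero[of x] x by (cases "x = 2 * pi") auto
        then have "Im u \<le> 0" using r x by (simp add: mult_nonneg_nonpos)
        then show "u \<in> V" using True u low_im sph by (auto simp: V_def)
      qed
    qed (auto simp: V_def ends e2)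
    then show ?thesis unfolding seg[OF im] h_def Y_def g_def using True by (simp add: algebra_simps)
  next
    case False
    then have neg: "Im w < 0" using im by simp
    define V where "V = {u. Im u > Im w} \<inter> {u. Re u > 0}"
    let ?up = "part_circlepath (of_real c) r 0 pi"
    have "contour_integral (linepath (of_real (c - r)) (of_real (c + r))) (\<lambda>u. R u / (u - w)) = contour_integral (reversepath ?up) (\<lambda>u. R u / (u - w))"
    proof (rule deform[of V])
      show "open V" unfolding V_def by (intro open_Int open_halfspace_Im_gt open_halfspace_Re_gt)
      show "convex V" unfolding V_def by (intro convex_Int convex_halfspace_Im_gt convex_halfspace_Re_gt)
      show "closed_segment (of_real (c - r)) (of_real (c + r)) \<subseteq> V" 
        by (rule closed_segment_subset) (use neg r c \<open>convex V\<close> in \<open>auto simp: V_def r_def\<close>)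
      have "path_image ?up \<subseteq> V"
      proof
        fix u assume u: "u \<in> path_image ?up"
        then obtain x where x: "0 \<le> x" "x \<le> pi" "u = of_real c + of_real r * cis x"
          by (auto simp: path_image_part_circlepath' closed_segment_eq_real_ivl)
        have "Im u \<ge> 0" using r x by (simp add: sin_ge_zero)
        moreover have "u \<in> sphere (of_real c) r" using r x by (simp add: dist_norm norm_mult)
        ultimately show "u \<in> V" using neg sph by (auto simp: V_def)
      qed
      then show "path_image (reversepath ?up) \<subseteq> V" by (simp only: path_image_reversepath)
    qed (auto simp: V_def ends e2)
    also have "\<dots> = - contour_integral ?up (\<lambda>u. R u / (u - w))"
      by (rule contour_integral_reversepath) simp
    also have "contour_integral ?up (\<lambda>u. R u / (u - w)) = 2 * of_real pi * \<i> * R w - A w"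
    proof -
      let ?q = "\<lambda>x. R (of_real c + of_real r * cis x) / (of_real c + of_real r * cis x - w) * of_real r * \<i> * cis x"
      have "((\<lambda>u. R u / (u - w)) has_contour_integral (2 * of_real pi * \<i> * R w)) (circlepath (of_real c) r)"
        by (rule Cauchy_integral_circlepath)
           (use w sphere_right in \<open>auto simp: dist_norm norm_minus_commute intro!: R_cont holomorphic_on_subset[OF R_holo] slit_Re\<close>)
      then have 1: "(?q has_integral (2 * of_real pi * \<i> * R w)) {0..2 * pi}"
        unfolding circlepath_def by (subst (asm) has_contour_integral_part_circlepath_iff) (simp_all add: mult.assoc)
      have 2: "integral {0..pi} ?q + integral {pi..2 * pi} ?q = integral {0..2 * pi} ?q"
        by (rule Henstock_Kurzweil_Integration.integral_combine) (use 1 in auto)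
      have "contour_integral ?up (\<lambda>u. R u / (u - w)) = integral {0..pi} ?q" "A w = integral {pi..2 * pi} ?q"
        unfolding A_def by (subst contour_integral_part_circlepath_eq; simp add: mult.assoc)+
      with 2 integral_unique[OF 1] show ?thesis by (simp add: algebra_simps)
    qed
    finally show ?thesis unfolding seg[OF im] h_def Y_def g_def using neg by (simp add: algebra_simps)
  qed
  have bound: "norm (h w) \<le> 11 * g0" if w: "w \<in> ball (of_real c) (c/4)" for w
  proof -
    have wB: "w \<in> ?B" using w c by (auto simp: r_def)
    have rw: "Re w > 0" using wB by (intro sphere_right) (simp add: dist_norm norm_minus_commute)
    have nw: "norm (w - of_real c) < c / 4" using w by (simp add: dist_norm norm_minus_commute)
    have b1: "norm (stieltjes \<rho>o (- w)) \<le> 6 * (LINT s|lborel. \<rho>o s / s)"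
    proof (rule stieltjes_bound[OF \<rho>o_int'])
      fix s assume "\<rho>o s \<noteq> 0"
      then have s: "s > 0" "\<bar>s - c\<bar> > c / 2" using \<rho>o_nz[of s] by (auto simp: r_def)
      have "\<bar>s - c\<bar> = norm (complex_of_real s - of_real c)" by (simp flip: of_real_diff)
      also have "\<dots> \<le> norm (of_real s - w) + norm (w - of_real c)" using norm_triangle_ineq[of "of_real s - w" "w - of_real c"] by simp
      finally have "\<bar>s - c\<bar> - c / 4 \<le> norm (of_real s - w)" using nw by linarith
      moreover have "s / 6 \<le> \<bar>s - c\<bar> - c / 4" using s by (auto simp: abs_if split: if_splits)
      ultimately show "s > 0 \<and> s / 6 \<le> norm (of_real s + - w)" using s by simp
    qed (auto simp: \<rho>o_def \<rho>_ge)
    also have "(LINT s|lborel. \<rho>o s / s) \<le> (LINT s|lborel. \<rho> s / s)"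
    proof (rule integral_mono[OF \<rho>o_int' \<rho>_int'])
      fix s show "\<rho>o s / s \<le> \<rho> s / s" using \<rho>_pos[of s] \<rho>_ge[of s] by (cases "\<rho> s = 0") (auto simp: \<rho>o_def indicator_def)
    qed
    finally have b1': "norm (stieltjes \<rho>o (- w)) \<le> 6 * (g0 - 1)" by (simp add: g0_def)
    have b2: "norm (A w) \<le> ((g0 / pi) / (c / 4)) * r * \<bar>2 * pi - pi\<bar>"
      unfolding A_def
    proof (rule contour_integral_bound_part_circlepath)
      show "(\<lambda>u. R u / (u - w)) contour_integrable_on ?low" by (rule low_int[OF wB])
      fix u assume "u \<in> path_image ?low"
      then have u: "norm (u - of_real c) = r" using low_im by (auto simp: dist_norm norm_minus_commute)
      then have "Re u > 0" using sphere_right by simp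
      have "norm (u - of_real c) \<le> norm (u - w) + norm (w - of_real c)" using norm_triangle_ineq[of "u - w" "w - of_real c"] by simp
      then have "c / 4 \<le> norm (u - w)" using u nw by (simp add: r_def)
      then have "norm (R u) / norm (u - w) \<le> (g0 / pi) / (c / 4)"
        using R_bound[of u] \<open>Re u > 0\<close> c g0_ge by (intro frac_le) auto
      then show "norm (R u / (u - w)) \<le> (g0 / pi) / (c / 4)" by (simp add: norm_divide)
    qed (use r c g0_ge in auto)
    also have "\<dots> = 2 * g0" using c by (simp add: r_def field_simps)
    finally have b2': "norm (A w) \<le> 2 * g0" .
    have "norm (\<i> * of_real pi * R w) = pi * norm (R w)" by (simp add: norm_mult)
    also have "\<dots> \<le> pi * (g0 / pi)" using R_bound[of w] rw by (intro mult_left_mono) auto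
    finally have b3: "norm (\<i> * of_real pi * R w) \<le> g0" by simp
    show ?thesis unfolding h_def
      using norm_triangle_ineq4[of "1 + stieltjes \<rho>o (- w) + A w" "\<i> * of_real pi * R w"]
        norm_triangle_ineq[of "1 + stieltjes \<rho>o (- w)" "A w"] norm_triangle_ineq[of 1 "stieltjes \<rho>o (- w)"]
        b1' b2' b3 g0_ge by simp
  qed
  show ?thesis by (rule that[of h]) (use holo Yh bound in \<open>auto simp: r_def\<close>)
qed

text \<open>Inside the sector of slope 1/4 around the positive axis, \<open>w\<close> lies in the
  inner ball of the local extension centred at \<open>Re w\<close>. Outside it, \<open>- w\<close>
  keeps an angle from the cut and \<open>g (- w)\<close> is estimated directly.\<close>

lemma Y_bound: "Re w > 0 \<Longrightarrow> Im w \<noteq> 0 \<Longrightarrow> norm (Y w) \<le> 11 * g0"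
proof -
  assume w: "Re w > 0" "Im w \<noteq> 0"
  show ?thesis
  proof (cases "\<bar>Im w\<bar> < Re w / 4")
    case True
    obtain h where h: "\<And>u. u \<in> ball (of_real (Re w)) (Re w/2) \<Longrightarrow> Im u \<noteq> 0 \<Longrightarrow> h u = Y u"
      "\<And>u. u \<in> ball (of_real (Re w)) (Re w/4) \<Longrightarrow> norm (h u) \<le> 11 * g0"
      by (rule Y_local[OF w(1)]) blast
    have "norm (of_real (Re w) - w) = \<bar>Im w\<bar>" by (simp add: norm_complex_def)
    then have "w \<in> ball (of_real (Re w)) (Re w/4)" "w \<in> ball (of_real (Re w)) (Re w/2)" using True w by (auto simp: dist_norm)
    with h w show ?thesis by metis
  next
    case False
    have "norm (\<i> * of_real pi * of_real (sgn (Im w)) * R w) = pi * norm (R w)" using w by (simp add: norm_mult)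
    also have "\<dots> \<le> pi * (g0 / pi)" using R_bound[of w] w by (intro mult_left_mono) auto
    finally have "norm (\<i> * of_real pi * of_real (sgn (Im w)) * R w) \<le> g0" by simp
    then show ?thesis using g_bound'[of w] w False g0_ge norm_triangle_ineq4[of "g (- w)" "\<i> * of_real pi * of_real (sgn (Im w)) * R w"]
      by (simp add: Y_def)
  qed
qed

end

section \<open>The holomorphic factor\<close>

lemma holomorphic_on_uminus_arg:
  assumes "f holomorphic_on B" "\<And>w. w \<in> A \<Longrightarrow> - w \<in> B"
  shows "(\<lambda>w. f (- w)) holomorphic_on A"
proof -
  have "uminus holomorphic_on A" "uminus ` A \<subseteq> B" using assms(2) by (auto intro!: holomorphic_intros)
  from holomorphic_on_compose_gen[OF this(1) assms(1) this(2)] show ?thesis by (simp add: o_def)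
qed

context neumann
begin

lemma open_slit: "open slit" by (simp add: open_Compl)

definition Q where "Q w = csqrt w * exp (- of_real t * (w + 1 / w)) * g w"
definition Pf where "Pf w = - of_real (sgn (Im w)) * (Q (- w) - Q w) / (\<i> * of_real pi)"

lemma Q_holo: "Q holomorphic_on slit"
  unfolding Q_def[abs_def] by (intro holomorphic_intros g_holo) auto

text \<open>\<open>csqrt (- w)\<close> is \<open>csqrt w\<close> times \<open>- \<i>\<close> or
  \<open>\<i>\<close>, according to the half-plane. This sign cancels the one in \<open>Pf\<close>
  for the term with \<open>g (- w)\<close> and leaves it on the other term, as in
  \<open>Y\<close>.\<close>

lemma Pf_right:
  assumes "Re w > 0" "Im w \<noteq> 0"
  shows "Pf w = csqrt w * exp (of_real t * (w + 1 / w)) / of_real pi * Y w"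
proof -
  define e where "e = exp (of_real t * (w + 1 / w))"
  have e1: "exp (- of_real t * (- w + 1 / - w)) = e" by (simp add: e_def algebra_simps)
  have e2: "exp (- of_real t * (w + 1 / w)) = inverse e" by (simp add: e_def exp_minus)
  have e3: "exp (- of_real (2 * t) * (w + 1 / w)) = inverse e * inverse e"
    by (simp add: e_def exp_minus[symmetric] algebra_simps flip: exp_add)
  have e0: "e \<noteq> 0" by (simp add: e_def)
  have ii: "\<i> * (\<i> * a) = - a" for a :: complex by simp
  have "csqrt (- w) = - of_real (sgn (Im w)) * \<i> * csqrt w"
  proof (cases "Im w > 0")
    case True
    have "csqrt (- (- w)) = \<i> * csqrt (- w)" using True by (intro csqrt_minus) simp
    then show ?thesis using True by (simp add: mult.assoc)
  next
    case False
    then have "csqrt (- w) = \<i> * csqrt w" using assms by (intro csqrt_minus) simp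
    then show ?thesis using False assms by simp
  qed
  moreover have "of_real (sgn (Im w)) * of_real (sgn (Im w)) = (1::complex)" using assms by (simp add: sgn_if)
  ultimately show ?thesis
    unfolding Pf_def Q_def Y_def R_def e1 e2 e3 e_def[symmetric] using e0
    by (simp add: field_simps ii)
qed

lemma P_exists: "\<exists>P. P holomorphic_on slit \<and> (\<forall>w\<in>slit. Im w \<noteq> 0 \<longrightarrow> P w = Pf w)"
proof -
  have h0: "Pf holomorphic_on {w\<in>slit. Im w \<noteq> 0}"
  proof -
    have hh: "Pf holomorphic_on A" if A: "A \<subseteq> slit" "uminus ` A \<subseteq> slit" and s: "\<And>w. w \<in> A \<Longrightarrow> sgn (Im w) = s" for A s
    proof -
      have "(\<lambda>w. Q (- w)) holomorphic_on A"
        using A(2) by (intro holomorphic_on_uminus_arg[OF Q_holo]) blast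
      then have "(\<lambda>w. - of_real s * (Q (- w) - Q w) / (\<i> * of_real pi)) holomorphic_on A"
        by (intro holomorphic_intros holomorphic_on_subset[OF Q_holo A(1)]) auto
      then show ?thesis by (rule holomorphic_transform) (simp add: Pf_def s)
    qed
    have "Pf holomorphic_on {w. Im w > 0}" by (rule hh[of _ 1]) (auto simp: complex_nonpos_Reals_iff complex_nonneg_Reals_iff)
    moreover have "Pf holomorphic_on {w. Im w < 0}" by (rule hh[of _ "-1"]) (auto simp: complex_nonpos_Reals_iff complex_nonneg_Reals_iff)
    ultimately have "Pf holomorphic_on {w. Im w > 0} \<union> {w. Im w < 0}"
      by (intro holomorphic_on_Un open_halfspace_Im_gt open_halfspace_Im_lt)
    then show ?thesis by (rule holomorphic_on_subset) auto
  qed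
  obtain F where "F holomorphic_on slit" "\<And>w. w \<in> slit \<Longrightarrow> Im w \<noteq> 0 \<Longrightarrow> F w = Pf w"
  proof (rule extend_across_real[OF open_slit h0])
    fix c :: real assume "of_real c \<in> slit"
    then have c: "c > 0" by (auto simp: complex_nonpos_Reals_iff)
    obtain h where h: "h holomorphic_on ball (of_real c) (c/2)" 
      "\<And>w. w \<in> ball (of_real c) (c/2) \<Longrightarrow> Im w \<noteq> 0 \<Longrightarrow> h w = Y w" by (rule Y_local[OF c]) blast
    have right: "Re w > 0" if "w \<in> ball (of_real c) (c/2)" for w
    proof -
      have "\<bar>Re (of_real c - w)\<bar> \<le> c / 2" using that abs_Re_le_cmod[of "of_real c - w"] by (simp add: dist_norm)
      then have "\<bar>c - Re w\<bar> \<le> c / 2" by simp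
      then show ?thesis using c by linarith
    qed
    then have sub: "ball (of_real c) (c/2) \<subseteq> slit" using slit_Re by blast
    show "\<exists>r>0. \<exists>h. h holomorphic_on ball (of_real c) r \<and> (\<forall>w\<in>ball (of_real c) r. Im w \<noteq> 0 \<longrightarrow> h w = Pf w)"
    proof (intro exI conjI ballI impI)
      show "c / 2 > 0" using c by simp
      show "(\<lambda>w. csqrt w * exp (of_real t * (w + 1 / w)) / of_real pi * h w) holomorphic_on ball (of_real c) (c/2)"
        using sub slit_nz by (intro holomorphic_intros h(1)) (auto simp: subset_iff)
      fix w assume "w \<in> ball (complex_of_real c) (c/2)" "Im w \<noteq> 0"
      then show "csqrt w * exp (of_real t * (w + 1 / w)) / of_real pi * h w = Pf w"
        using Pf_right[OF right] h(2) by simp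
    qed
  qed blast
  then show ?thesis by blast
qed

text \<open>Continuity determines the chosen function on \<open>slit\<close>; its values on the cut
  carry no information.\<close>

definition P where "P = (SOME P. P holomorphic_on slit \<and> (\<forall>w\<in>slit. Im w \<noteq> 0 \<longrightarrow> P w = Pf w))"

lemma P_holo: "P holomorphic_on slit" and P_eq: "Im w \<noteq> 0 \<Longrightarrow> P w = Pf w"
  using someI_ex[OF P_exists] slit_Im unfolding P_def by blast+

lemma Q_bound:
  assumes "Re w > 0" shows "norm (Q w) \<le> g0 * sqrt (norm w) * exp (- t * Re (w + 1 / w))"
proof -
  have "norm (Q w) = (sqrt (norm w) * exp (- t * Re (w + 1 / w))) * norm (g w)"
    by (simp add: Q_def norm_mult norm_exp_eq_Re norm_csqrt)
  also have "\<dots> \<le> (sqrt (norm w) * exp (- t * Re (w + 1 / w))) * g0"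
    using g_bound[of w] assms by (intro mult_left_mono) auto
  finally show ?thesis by (simp add: mult_ac)
qed

lemma P_bound:
  assumes "Re w > 0" shows "norm (P w) \<le> 11 * g0 * sqrt (norm w) * exp (t * Re (w + 1 / w))"
proof -
  have "norm (P w) - 11 * g0 * sqrt (norm w) * exp (t * Re (w + 1 / w)) \<le> 0"
  proof (rule off_real_le[of "{w. Re w > 0}" w "\<lambda>w. norm (P w) - 11 * g0 * sqrt (norm w) * exp (t * Re (w + 1 / w))"])
    show "open {w. Re w > 0}" by (rule open_halfspace_Re_gt)
    have "continuous_on {w. Re w > 0} P" using slit_Re by (intro holomorphic_on_imp_continuous_on holomorphic_on_subset[OF P_holo]) auto
    then show "continuous_on {w. Re w > 0} (\<lambda>w. norm (P w) - 11 * g0 * sqrt (norm w) * exp (t * Re (w + 1 / w)))"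
      by (intro continuous_intros) auto
    fix w assume w: "w \<in> {w. Re w > 0}" "Im w \<noteq> 0"
    have "norm (P w) = (sqrt (norm w) * exp (t * Re (w + 1 / w)) / pi) * norm (Y w)"
      using P_eq[OF w(2)] Pf_right[of w] w by (simp add: norm_mult norm_divide norm_exp_eq_Re norm_csqrt)
    also have "\<dots> \<le> (sqrt (norm w) * exp (t * Re (w + 1 / w)) / 1) * (11 * g0)"
      using Y_bound[of w] w pi_ge_two by (intro mult_mono divide_left_mono) auto
    finally show "norm (P w) - 11 * g0 * sqrt (norm w) * exp (t * Re (w + 1 / w)) \<le> 0" by (simp add: mult_ac)
  qed (use assms in auto)
  then show ?thesis by simp
qed

lemma Q_cnj: "w \<in> slit \<Longrightarrow> cnj (Q w) = Q (cnj w)"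
proof -
  assume w: "w \<in> slit"
  have "cnj (csqrt w) = csqrt (cnj w)" using w by (intro cnj_csqrt) (auto simp: complex_nonpos_Reals_iff)
  then show ?thesis by (simp add: Q_def g_cnj exp_cnj)
qed

lemma P_cnj: "w \<in> slit \<Longrightarrow> cnj (P w) = P (cnj w)"
proof (rule off_real_eq[OF open_slit, of w "\<lambda>w. cnj (P w)" "\<lambda>w. P (cnj w)"])
  have c: "continuous_on slit P" using P_holo by (rule holomorphic_on_imp_continuous_on)
  then show "continuous_on slit (\<lambda>w. cnj (P w))" by (intro continuous_intros)
  show "continuous_on slit (\<lambda>w. P (cnj w))"
    by (rule continuous_on_compose2[OF c]) (auto intro!: continuous_intros simp: complex_nonpos_Reals_iff)
  fix w assume w: "w \<in> slit" "Im w \<noteq> 0"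
  then have "- w \<in> slit" by (intro slit_Im) simp
  then show "cnj (P w) = P (cnj w)" using w by (simp add: P_eq Pf_def Q_cnj)
qed

lemma Q_minus: "Im w \<noteq> 0 \<Longrightarrow> Q (- w) = Q w - of_real (sgn (Im w)) * \<i> * of_real pi * P w"
  by (cases "Im w > 0") (simp_all add: P_eq Pf_def field_simps)

lemma P_minus: "Im w \<noteq> 0 \<Longrightarrow> P (- w) = P w"
  by (cases "Im w > 0") (simp_all add: P_eq Pf_def field_simps)

end

section \<open>Removal of the cut and of the singularity at the origin\<close>

lemma slit_inverse: "w \<in> slit \<Longrightarrow> t > 0 \<Longrightarrow> of_real t / w \<in> slit"
proof -
  assume w: "w \<in> slit" and t: "t > 0"
  have "w \<noteq> 0" using w by (rule slit_nz)
  then have n: "(Re w)\<^sup>2 + (Im w)\<^sup>2 > 0" by (simp add: sum_power2_gt_zero_iff complex_eq_iff)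
  have "Im (of_real t / w) = - (t * Im w) / ((Re w)\<^sup>2 + (Im w)\<^sup>2)" "Re (of_real t / w) = t * Re w / ((Re w)\<^sup>2 + (Im w)\<^sup>2)"
    by (simp_all add: Re_divide Im_divide)
  then show ?thesis using w t n by (auto simp: complex_nonpos_Reals_iff divide_le_0_iff mult_le_0_iff)
qed

text \<open>Parity glues across the cut: \<open>s * f (- w)\<close> is holomorphic in the left
  half-plane and agrees with \<open>f\<close> off the axis. Growth of order 1/2 at \<open>0\<close>
  is less than that of a pole, so the singularity is removable; conjugation symmetry makes the value
  there real. The sign \<open>s\<close> treats even and odd functions together.\<close>

lemma entire_extension:
  fixes f :: "complex \<Rightarrow> complex" and s :: complex
  assumes f: "f holomorphic_on slit" and s: "s * s = 1" "norm s = 1" and par: "\<And>w. Im w < 0 \<Longrightarrow> f (- w) = s * f w"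
    and \<delta>: "\<delta> > 0" and M: "\<And>w. Re w > 0 \<Longrightarrow> norm w < \<delta> \<Longrightarrow> norm (f w) \<le> M / sqrt (norm w)"
    and cj: "\<And>w. w \<in> slit \<Longrightarrow> cnj (f w) = f (cnj w)"
  obtains F where "F holomorphic_on UNIV" "\<And>w. w \<in> slit \<Longrightarrow> F w = f w" "\<And>w. F (- w) = s * F w" "F 0 \<in> \<real>"
proof -
  have par': "f (- w) = s * f w" if "Im w \<noteq> 0" for w
  proof (cases "Im w < 0")
    case False
    then have "f w = s * f (- w)" using par[of "- w"] that by simp
    then have "s * f w = (s * s) * f (- w)" by (simp add: mult.assoc)
    then show ?thesis using s(1) by simp
  qed (rule par)
  define F0 where "F0 w = (if w \<in> slit then f w else s * f (- w))" for w
  have F0_neg: "F0 w = s * f (- w)" if "Re w < 0" for w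
  proof (cases "Im w = 0")
    case True
    then show ?thesis using that by (simp add: F0_def complex_nonpos_Reals_iff)
  next
    case False
    then show ?thesis using par'[of "- w"] by (auto simp: F0_def complex_nonpos_Reals_iff)
  qed
  have F0_minus: "F0 (- w) = s * F0 w" if w: "w \<noteq> 0" for w
  proof (cases "Im w = 0")
    case False
    then have "w \<in> slit" "- w \<in> slit" by (auto simp: complex_nonpos_Reals_iff)
    then show ?thesis using par'[OF False] by (simp add: F0_def)
  next
    case True
    then have "Re w \<noteq> 0" using w by (auto simp: complex_eq_iff)
    then show ?thesis
    proof (cases "Re w > 0")
      case True
      then show ?thesis using F0_neg[of "- w"] slit_Re[of w] by (simp add: F0_def)
    next
      case False
      then have n: "Re w < 0" using \<open>Re w \<noteq> 0\<close> by simp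
      have "s * F0 w = (s * s) * f (- w)" unfolding F0_neg[OF n] by (simp add: mult.assoc)
      then show ?thesis using n slit_Re[of "- w"] by (simp add: F0_def s(1))
    qed
  qed
  have holo: "F0 holomorphic_on - {0}"
  proof -
    have "F0 holomorphic_on slit" using f by (rule holomorphic_transform) (simp add: F0_def)
    moreover have "F0 holomorphic_on {w. Re w < 0}"
    proof -
      have "(\<lambda>w. f (- w)) holomorphic_on {w. Re w < 0}"
        by (rule holomorphic_on_uminus_arg[OF f]) (auto simp: complex_nonpos_Reals_iff)
      then have "(\<lambda>w. s * f (- w)) holomorphic_on {w. Re w < 0}" by (intro holomorphic_intros)
      then show ?thesis by (rule holomorphic_transform) (simp add: F0_neg)
    qed
    ultimately have "F0 holomorphic_on slit \<union> {w. Re w < 0}"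
      by (intro holomorphic_on_Un open_halfspace_Re_lt) (auto simp: open_Compl)
    then show ?thesis by (rule holomorphic_on_subset) (auto simp: complex_nonpos_Reals_iff complex_eq_iff)
  qed
  have bnd1: "norm (F0 w) * sqrt (norm w) \<le> M" if w: "Re w \<noteq> 0" "norm w < \<delta>" for w
  proof -
    have w0: "w \<noteq> 0" using w by auto
    have *: "norm (F0 u) * sqrt (norm u) \<le> M" if "Re u > 0" "norm u < \<delta>" for u
    proof -
      have "u \<noteq> 0" using that by auto
      then have "norm (f u) * sqrt (norm u) \<le> M" using M[OF that] by (simp add: pos_le_divide_eq)
      then show ?thesis using slit_Re[OF that(1)] by (simp add: F0_def)
    qed
    show ?thesis
    proof (cases "Re w > 0")
      case False
      then show ?thesis using *[of "- w"] w F0_minus[OF w0] s(2) by (simp add: norm_mult)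
    qed (rule *, use w in auto)
  qed
  have bnd: "norm (F0 w) * sqrt (norm w) \<le> M" if w: "w \<noteq> 0" "norm w < \<delta>" for w
  proof -
    let ?S = "ball 0 \<delta> - {0} :: complex set"
    \<comment> \<open>So far the bound is known off the imaginary axis. Multiplication by
      \<open>\<i>\<close> carries that axis to the real one, where \<open>off_real_le\<close> closes
      the gap.\<close>
    have "norm (F0 (- \<i> * (\<i> * w))) * sqrt (norm (\<i> * w)) - M \<le> 0"
    proof (rule off_real_le[of ?S "\<i> * w" "\<lambda>v. norm (F0 (- \<i> * v)) * sqrt (norm v) - M"])
      show "open ?S" by auto
      show "\<i> * w \<in> ?S" using w by (simp add: norm_mult)
      have "continuous_on (- {0}) F0" using holo by (rule holomorphic_on_imp_continuous_on)
      then have "continuous_on ?S (\<lambda>v. F0 (- \<i> * v))" by (rule continuous_on_compose2) (auto intro!: continuous_intros)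
      then show "continuous_on ?S (\<lambda>v. norm (F0 (- \<i> * v)) * sqrt (norm v) - M)" by (intro continuous_intros)
      fix v assume "v \<in> ?S" "Im v \<noteq> 0"
      then show "norm (F0 (- \<i> * v)) * sqrt (norm v) - M \<le> 0" using bnd1[of "- \<i> * v"] by (simp add: norm_mult)
    qed
    then show ?thesis by (simp add: norm_mult)
  qed
  have "((\<lambda>w. (w - 0) * F0 w) \<longlongrightarrow> 0) (at 0)"
  proof (rule Lim_null_comparison)
    have "\<forall>\<^sub>F w in at 0. w \<noteq> (0::complex) \<and> norm w < \<delta>" using \<delta> by (auto simp: eventually_at intro!: exI[of _ \<delta>])
    then show "\<forall>\<^sub>F w in at 0. norm ((w - 0) * F0 w) \<le> M * sqrt (norm w)"
    proof eventually_elim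
      case (elim w)
      have "norm ((w - 0) * F0 w) = sqrt (norm w) * (norm (F0 w) * sqrt (norm w))"
        by (simp add: norm_mult mult_ac flip: real_sqrt_mult)
      also have "\<dots> \<le> sqrt (norm w) * M" using elim bnd by (intro mult_left_mono) auto
      finally show ?case by (simp add: mult.commute)
    qed
    have "((\<lambda>w. M * sqrt (norm (w::complex))) \<longlongrightarrow> M * sqrt (norm (0::complex))) (at 0)" by (intro tendsto_intros)
    then show "((\<lambda>w. M * sqrt (norm (w::complex))) \<longlongrightarrow> 0) (at 0)" by simp
  qed
  moreover have "F0 holomorphic_on UNIV - {0}" using holo by (simp add: Compl_eq_Diff_UNIV)
  ultimately obtain F where F: "F holomorphic_on UNIV" "\<And>w. w \<noteq> 0 \<Longrightarrow> F w = F0 w"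
    using holomorphic_on_extend_lim[of F0 UNIV 0] by auto
  have Fc: "continuous_on UNIV F" using F(1) by (rule holomorphic_on_imp_continuous_on)
  have Ff: "F w = f w" if "w \<in> slit" for w using F(2)[OF slit_nz[OF that]] that by (simp add: F0_def)
  show ?thesis
  proof (rule that[OF F(1) Ff])
    show "F (- w) = s * F w" for w
    proof (rule off_real_eq[of UNIV w "\<lambda>w. F (- w)" "\<lambda>w. s * F w"])
      show "continuous_on UNIV (\<lambda>w. F (- w))" by (rule continuous_on_compose2[OF Fc]) (auto intro!: continuous_intros)
      show "continuous_on UNIV (\<lambda>w. s * F w)" by (intro continuous_intros Fc)
      fix w :: complex assume "Im w \<noteq> 0"
      then have "w \<noteq> 0" by auto
      then show "F (- w) = s * F w" using F(2)[of w] F(2)[of "- w"] F0_minus[of w] by simp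
    qed auto
    have "cnj (F 0) = F (cnj 0)"
    proof (rule off_real_eq[of UNIV 0 "\<lambda>w. cnj (F w)" "\<lambda>w. F (cnj w)"])
      show "continuous_on UNIV (\<lambda>w. F (cnj w))" by (rule continuous_on_compose2[OF Fc]) (auto intro!: continuous_intros)
      show "continuous_on UNIV (\<lambda>w. cnj (F w))" by (intro continuous_intros Fc)
      fix w :: complex assume "Im w \<noteq> 0"
      then have "w \<in> slit" by (rule slit_Im)
      then show "cnj (F w) = F (cnj w)" using cj[of w] Ff[of w] Ff[OF slit_cnj] by simp
    qed auto
    then show "F 0 \<in> \<real>" by (simp add: Reals_cnj_iff)
  qed
qed

context neumann
begin

text \<open>
  \<open>(A1s, w A2s / (2\<lambda>))\<close> is the column \<open>a\<close>, and \<open>C1s w\<close>, \<open>\<lambda> C2s w / w\<close> are \<open>c\<^sub>1\<^sup>*\<close>, \<open>c\<^sub>2\<^sup>*\<close>.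
\<close>

definition A1s where "A1s w = I1 (of_real t / w) * Q w - K1 (of_real t / w) * P w"
definition A2s where "A2s w = (K0 (of_real t / w) * P w - I0 (of_real t / w) * Q w) / w"
definition C1s where "C1s w = (I0 (of_real t / w) * Q (1 / w) + K0 (of_real t / w) * P (1 / w)) / 2"
definition C2s where "C2s w = w * (I1 (of_real t / w) * Q (1 / w) + K1 (of_real t / w) * P (1 / w))"

lemma slit_inv1: "w \<in> slit \<Longrightarrow> 1 / w \<in> slit"
  using slit_inverse[of w 1] by simp

lemma holo_div: "f holomorphic_on slit \<Longrightarrow> a > 0 \<Longrightarrow> (\<lambda>w. f (of_real a / w)) holomorphic_on slit"
proof -
  assume f: "f holomorphic_on slit" and a: "a > 0"
  have "(\<lambda>w. of_real a / w) holomorphic_on slit" by (intro holomorphic_intros) auto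
  moreover have "(\<lambda>w. of_real a / w) ` slit \<subseteq> slit" using slit_inverse a by blast
  ultimately have "(f \<circ> (\<lambda>w. of_real a / w)) holomorphic_on slit" using f by (intro holomorphic_on_compose_gen)
  then show ?thesis by (simp add: o_def)
qed

lemmas holo_parts = holo_div[OF I0_holo t] holo_div[OF I1_holo t] holo_div[OF K0_holo[OF order_refl] t] holo_div[OF K1_holo[OF order_refl] t]
  holo_div[OF Q_holo zero_less_one, simplified] holo_div[OF P_holo zero_less_one, simplified] Q_holo P_holo

lemma A1s_holo: "A1s holomorphic_on slit" and A2s_holo: "A2s holomorphic_on slit"
  and C1s_holo: "C1s holomorphic_on slit" and C2s_holo: "C2s holomorphic_on slit"
  unfolding A1s_def[abs_def] A2s_def[abs_def] C1s_def[abs_def] C2s_def[abs_def]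
  by (intro holomorphic_intros holo_parts; auto)+

text \<open>Under \<open>w \<mapsto> - w\<close> each of \<open>K0\<close>, \<open>K1\<close>,
  \<open>Q\<close> gains a multiple of its companion \<open>I0\<close>, \<open>I1\<close>,
  \<open>P\<close>, and in these combinations the gains cancel. In \<open>C1s\<close> and
  \<open>C2s\<close> this takes a plus sign, because \<open>1 / w\<close> lies in the other
  half-plane. The factors \<open>1 / w\<close> and \<open>w\<close> account for the odd
  parity.\<close>

lemma factor_minus:
  assumes w: "Im w < 0"
  shows "A1s (- w) = 1 * A1s w" "A2s (- w) = - 1 * A2s w" "C1s (- w) = 1 * C1s w" "C2s (- w) = - 1 * C2s w"
proof -
  define x where "x = of_real t / w"
  have im: "Im (1 / w) > 0" "Im x > 0" using w t by (auto simp: x_def Im_divide divide_less_0_iff sum_power2_gt_zero_iff mult_pos_neg)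
  have x: "of_real t / - w = - x" "1 / - w = - (1 / w)" by (simp_all add: x_def)
  have Qm: "Q (- w) = Q w + \<i> * of_real pi * P w" "P (- w) = P w" using w Q_minus[of w] P_minus[of w] by auto
  have Qi: "Q (- (1 / w)) = Q (1 / w) - \<i> * of_real pi * P (1 / w)" "P (- (1 / w)) = P (1 / w)" 
    using im(1) Q_minus[of "1 / w"] P_minus[of "1 / w"] by auto
  note e = Qm Qi I0_minus I1_minus K0_minus[OF im(2)] K1_minus[OF im(2)] x x_def[symmetric]
  show "A1s (- w) = 1 * A1s w" unfolding A1s_def e by (simp add: algebra_simps)
  show "A2s (- w) = - 1 * A2s w" unfolding A2s_def e by (simp add: algebra_simps divide_inverse)
  show "C1s (- w) = 1 * C1s w" unfolding C1s_def e by (simp add: algebra_simps)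
  show "C2s (- w) = - 1 * C2s w" unfolding C2s_def e by (simp add: algebra_simps)
qed

lemma factor_cnj:
  assumes w: "w \<in> slit"
  shows "cnj (A1s w) = A1s (cnj w)" "cnj (A2s w) = A2s (cnj w)" "cnj (C1s w) = C1s (cnj w)" "cnj (C2s w) = C2s (cnj w)"
proof -
  have x: "of_real t / w \<notin> \<real>\<^sub>\<le>\<^sub>0" using slit_inverse[OF w t] by simp
  have c: "cnj (of_real t / w) = of_real t / cnj w" "cnj (1 / w) = 1 / cnj w" by simp_all
  note e = I0_cnj I1_cnj K0_cnj[OF x] K1_cnj[OF x] Q_cnj[OF w] P_cnj[OF w] Q_cnj[OF slit_inv1[OF w]] P_cnj[OF slit_inv1[OF w]] c
  show "cnj (A1s w) = A1s (cnj w)" by (simp add: A1s_def e)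
  show "cnj (A2s w) = A2s (cnj w)" by (simp add: A2s_def e)
  show "cnj (C1s w) = C1s (cnj w)" by (simp add: C1s_def e)
  show "cnj (C2s w) = C2s (cnj w)" by (simp add: C2s_def e)
qed

text \<open>Since \<open>Re x = t * Re (1 / w)\<close> for \<open>x = t / w\<close>, the
  exponentials of the Bessel functions cancel those of \<open>Q\<close> and \<open>P\<close> up to a
  factor at most \<open>exp t\<close>. The powers that remain, from the square root, from
  \<open>norm x\<close> and from the prefactors \<open>1 / w\<close> and \<open>w\<close>, combine
  to order 1/2 in all four cases. The restriction \<open>norm w < t\<close> ensures
  \<open>norm x \<ge> 1\<close>, as \<open>K_bound\<close> requires.\<close>

lemma factor_bounds:
  obtains M where "\<And>w. Re w > 0 \<Longrightarrow> norm w < min t 1 \<Longrightarrow> norm (A1s w) \<le> M / sqrt (norm w)"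
    "\<And>w. Re w > 0 \<Longrightarrow> norm w < min t 1 \<Longrightarrow> norm (A2s w) \<le> M / sqrt (norm w)"
    "\<And>w. Re w > 0 \<Longrightarrow> norm w < min t 1 \<Longrightarrow> norm (C1s w) \<le> M / sqrt (norm w)"
    "\<And>w. Re w > 0 \<Longrightarrow> norm w < min t 1 \<Longrightarrow> norm (C2s w) \<le> M / sqrt (norm w)"
proof -
  obtain CI where CI: "CI > 0" "\<And>x. Re x > 0 \<Longrightarrow> norm (I0 x) \<le> CI * exp (Re x)"
    "\<And>x. Re x > 0 \<Longrightarrow> norm (I1 x) \<le> CI * norm x * exp (Re x)" by (rule I_bound) (rule that)
  obtain CK where CK: "CK > 0" "\<And>x. Re x > 0 \<Longrightarrow> norm x \<ge> 1 \<Longrightarrow> norm (K0 x) \<le> CK * exp (- Re x)"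
    "\<And>x. Re x > 0 \<Longrightarrow> norm x \<ge> 1 \<Longrightarrow> norm (K1 x) \<le> CK * norm x * exp (- Re x)" by (rule K_bound) (rule that)
  define N where "N = (CI + 11 * CK * exp t) * g0"
  have N: "N \<ge> 0" using CI(1) CK(1) g0_ge by (simp add: N_def)
  define M where "M = N * (1 + t)"
  have M: "N \<le> M" "t * N \<le> M" using N t by (auto simp: M_def algebra_simps)
  {
    fix w assume w: "Re w > 0" "norm w < min t 1"
    define x where "x = of_real t / w"
    define n where "n = norm w"
    have w0: "w \<noteq> 0" using w by auto
    have n: "n > 0" "n < 1" "n < t" using w w0 by (auto simp: n_def)
    have nx: "norm x = t / n" using t by (simp add: x_def n_def norm_divide)
    have x1: "norm x \<ge> 1" unfolding nx using n by simp
    have Rx: "Re x = t * Re (1 / w)" by (simp add: x_def Re_divide)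
    have R1: "Re (1 / w) > 0" using w by (simp add: Re_divide sum_power2_gt_zero_iff)
    have Rx0: "Re x > 0" unfolding Rx using R1 t by simp
    have Rw: "t * Re w \<ge> 0" "t * Re w \<le> t" using w t complex_Re_le_cmod[of w] by auto
    have comb: "norm (u * q) + norm (v * p) \<le> N * k * c" 
      if u: "norm u \<le> CI * k * exp (Re x)" and v: "norm v \<le> CK * k * exp (- Re x)" and k: "k \<ge> 0" and c: "c \<ge> 0"
      and q: "norm q \<le> g0 * c * exp (- t * Re (w + 1 / w))" and p: "norm p \<le> 11 * g0 * c * exp (t * Re (w + 1 / w))" for u v p q :: complex and k c :: real
    proof -
      have "norm (u * q) \<le> (CI * k * exp (Re x)) * (g0 * c * exp (- t * Re (w + 1 / w)))"
        unfolding norm_mult using u q k CI(1) by (intro mult_mono) auto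
      also have "\<dots> = CI * k * g0 * c * exp (- (t * Re w))" unfolding Rx by (simp add: algebra_simps flip: exp_add)
      also have "\<dots> \<le> CI * k * g0 * c * 1" using Rw k c CI(1) g0_ge by (intro mult_left_mono) auto
      finally have 1: "norm (u * q) \<le> CI * k * g0 * c" by simp
      have "norm (v * p) \<le> (CK * k * exp (- Re x)) * (11 * g0 * c * exp (t * Re (w + 1 / w)))"
        unfolding norm_mult using v p k CK(1) by (intro mult_mono) auto
      also have "\<dots> = 11 * CK * k * g0 * c * exp (t * Re w)" unfolding Rx by (simp add: algebra_simps flip: exp_add)
      also have "\<dots> \<le> 11 * CK * k * g0 * c * exp t" using Rw k c CK(1) g0_ge by (intro mult_left_mono) auto
      finally show ?thesis using 1 by (simp add: N_def algebra_simps)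
    qed
    note I = CI(2)[OF Rx0] CI(3)[OF Rx0] and K = CK(2)[OF Rx0 x1] CK(3)[OF Rx0 x1]
    have sw: "1 / w + 1 / (1 / w) = w + 1 / w" by simp
    have q1: "norm (Q w) \<le> g0 * sqrt n * exp (- t * Re (w + 1 / w))" "norm (P w) \<le> 11 * g0 * sqrt n * exp (t * Re (w + 1 / w))"
      using Q_bound[OF w(1)] P_bound[OF w(1)] by (simp_all add: n_def)
    have q2: "norm (Q (1 / w)) \<le> g0 * (1 / sqrt n) * exp (- t * Re (w + 1 / w))" "norm (P (1 / w)) \<le> 11 * g0 * (1 / sqrt n) * exp (t * Re (w + 1 / w))"
      using Q_bound[OF R1] P_bound[OF R1] unfolding sw by (simp_all add: n_def norm_divide real_sqrt_divide)
    have s: "sqrt n > 0" "sqrt n * sqrt n = n" using n by auto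
    have ks: "norm (A1s w) \<le> N * (t / n) * sqrt n"
      using norm_triangle_ineq4[of "I1 x * Q w" "K1 x * P w"] comb[OF _ _ _ _ q1, of "I1 x" "t / n" "K1 x"] I K n s t
      by (simp add: A1s_def x_def[symmetric] nx)
    also have "\<dots> = (t * N) / sqrt n" using s by (simp add: field_simps)
    also have "\<dots> \<le> M / sqrt n" using s M by (intro divide_right_mono) auto
    finally have a: "norm (A1s w) \<le> M / sqrt (norm w)" by (simp add: n_def)
    have "n * norm (A2s w) = norm (K0 x * P w - I0 x * Q w)" using w0 by (simp add: A2s_def x_def[symmetric] n_def norm_divide)
    also have "\<dots> \<le> N * 1 * sqrt n"
      using norm_triangle_ineq4[of "K0 x * P w" "I0 x * Q w"] comb[OF _ _ _ _ q1, of "I0 x" 1 "K0 x"] I K n s t by simp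
    also have "\<dots> \<le> M * sqrt n" using s M by (simp add: mult_right_mono)
    finally have "norm (A2s w) \<le> M * sqrt n / n" using n by (simp add: field_simps)
    also have "M * sqrt n / n = M / sqrt n" using s by (metis less_irrefl mult_divide_mult_cancel_right)
    finally have b: "norm (A2s w) \<le> M / sqrt (norm w)" by (simp add: n_def)
    have "2 * norm (C1s w) = norm (I0 x * Q (1 / w) + K0 x * P (1 / w))" by (simp add: C1s_def x_def[symmetric] norm_divide)
    also have "\<dots> \<le> N * 1 * (1 / sqrt n)"
      using norm_triangle_ineq[of "I0 x * Q (1 / w)" "K0 x * P (1 / w)"] comb[OF _ _ _ _ q2, of "I0 x" 1 "K0 x"] I K n s t by simp
    also have "\<dots> \<le> M / sqrt n" using s M by (simp add: divide_right_mono)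
    finally have c: "norm (C1s w) \<le> M / sqrt (norm w)" using norm_ge_zero[of "C1s w"] unfolding n_def[symmetric] by linarith
    have "norm (C2s w) = n * norm (I1 x * Q (1 / w) + K1 x * P (1 / w))" by (simp add: C2s_def x_def[symmetric] norm_mult n_def)
    also have "\<dots> \<le> n * (N * (t / n) * (1 / sqrt n))"
      using norm_triangle_ineq[of "I1 x * Q (1 / w)" "K1 x * P (1 / w)"] comb[OF _ _ _ _ q2, of "I1 x" "t / n" "K1 x"] I K n s t
      by (intro mult_left_mono) (auto simp: nx)
    also have "\<dots> = (t * N) / sqrt n" using n by (simp add: field_simps)
    also have "\<dots> \<le> M / sqrt n" using s M by (intro divide_right_mono) auto
    finally have d: "norm (C2s w) \<le> M / sqrt (norm w)" by (simp add: n_def)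
    note a b c d
  }
  then show ?thesis using that by blast
qed

text \<open>The pairing of the columns \<open>a\<close> and \<open>c\<close>, continued off the
  circle. The Bessel functions enter only through their Wronskian, which leaves an expression
  invariant under \<open>w \<mapsto> 1 / w\<close>.\<close>

lemma factor_det:
  "A1s w * C1s w + A2s w * C2s w / 2 = (Q w * P (1 / w) + P w * Q (1 / w)) / 2" if "w \<noteq> 0"
proof -
  define x where "x = of_real t / w"
  have "A1s w * C1s w + A2s w * C2s w / 2 = (I1 x * K0 x - K1 x * I0 x) * ((Q w * P (1 / w) + P w * Q (1 / w)) / 2)"
    unfolding A1s_def A2s_def C1s_def C2s_def x_def[symmetric] using that by (simp add: field_simps)
  then show ?thesis by (simp add: bessel_wronskian)
qed

text \<open>Polarisation: on the circle \<open>Q (1 / w) = cnj (Q w)\<close>, and likewise for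
  \<open>P\<close>, so the pure squares cancel and the cross terms leave \<open>d\<close> times a
  Bessel product. These are the entries of the hermitian identity for \<open>M\<close>, before
  normalisation.\<close>

lemma factor_circle:
  assumes w: "w \<in> slit" "norm w = 1"
  defines "x \<equiv> of_real t / w" and "d \<equiv> (Q w * P (1 / w) + P w * Q (1 / w)) / 2"
  shows "cnj (C1s w) * C1s w - cnj (A2s w) * A2s w / 4 = d / 2 * (cnj (I0 x) * K0 x + I0 x * cnj (K0 x))"
    "cnj (C1s w) * C2s w + cnj (A2s w) * A1s w / 2 = w * d * (cnj (I0 x) * K1 x + cnj (K0 x) * I1 x)"
    "cnj (C2s w) * C2s w - cnj (A1s w) * A1s w = 2 * d * (cnj (I1 x) * K1 x + I1 x * cnj (K1 x))"
proof -
  have w0: "w \<noteq> 0" using w(2) by auto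
  have ww: "cnj w * w = 1" using w(2) by (metis complex_norm_square mult.commute of_real_1 one_power2)
  have c1: "1 / w = cnj w" using ww w0 by (simp add: field_simps)
  have c: "Q (1 / w) = cnj (Q w)" "P (1 / w) = cnj (P w)" unfolding c1 by (simp_all add: Q_cnj[OF w(1)] P_cnj[OF w(1)])
  have b: "A2s w = cnj w * (K0 x * P w - I0 x * Q w)" unfolding A2s_def x_def c1[symmetric] by simp
  note d = A1s_def[of w] b C1s_def[of w] C2s_def[of w] d_def c x_def[symmetric]
  have w2: "w * cnj w = 1" using ww by (simp add: mult.commute)
  have r1: "cnj (cnj w * a) * (cnj w * b) = cnj a * b" for a b using ww by (simp add: mult_ac)
  have r2: "cnj (w * a) * (w * b) = cnj a * b" for a b 
  proof -
    have "cnj (w * a) * (w * b) = (cnj w * w) * (cnj a * b)" by simp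
    then show ?thesis by (simp add: ww)
  qed
  show "cnj (C1s w) * C1s w - cnj (A2s w) * A2s w / 4 = d / 2 * (cnj (I0 x) * K0 x + I0 x * cnj (K0 x))"
    unfolding d r1 by (simp add: field_simps)
  show "cnj (C1s w) * C2s w + cnj (A2s w) * A1s w / 2 = w * d * (cnj (I0 x) * K1 x + cnj (K0 x) * I1 x)"
    unfolding d by (simp add: field_simps)
  show "cnj (C2s w) * C2s w - cnj (A1s w) * A1s w = 2 * d * (cnj (I1 x) * K1 x + I1 x * cnj (K1 x))"
    unfolding d r2 by (simp add: field_simps)
qed

text \<open>On the imaginary axis \<open>w\<close> and \<open>1 / w\<close> are non-real, so both
  values of \<open>P\<close> are explicit in \<open>Q\<close>. The exponentials at \<open>w\<close>
  and \<open>- 1 / w\<close> cancel and the square roots multiply to \<open>\<i>\<close> or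
  \<open>- \<i>\<close>, which leaves only \<open>g\<close>.\<close>

lemma factor_det_imaginary:
  assumes y: "y > 0"
  defines "w \<equiv> \<i> * of_real y"
  shows "(Q w * P (1 / w) + P w * Q (1 / w)) / 2 = (g w * g (1 / cnj w) + g (- w) * g (1 / w)) / (2 * of_real pi)"
proof -
  have im: "Im w > 0" "Im (1 / w) < 0" using y by (auto simp: w_def Im_divide)
  have m: "- (1 / w) = 1 / cnj w" using y by (simp add: w_def)
  have P1: "P w = - (Q (- w) - Q w) / (\<i> * of_real pi)" using im by (subst P_eq) (auto simp: Pf_def)
  have P2: "P (1 / w) = (Q (- (1 / w)) - Q (1 / w)) / (\<i> * of_real pi)" using im by (subst P_eq) (auto simp: Pf_def)
  have s: "csqrt w * csqrt (- (1 / w)) = \<i>"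
  proof -
    have e: "- (1 / w) = \<i> * of_real (1 / y)" using y by (simp add: w_def field_simps)
    have L: "Ln (\<i> * of_real a) = of_real (ln a) + \<i> * of_real pi / 2" if "a > 0" for a
      using that Ln_of_real[OF that] by (subst Ln_times_ii) auto
    have nz: "w \<noteq> 0" "- (1 / w) \<noteq> 0" using y by (auto simp: w_def)
    have "csqrt w * csqrt (- (1 / w)) = exp (Ln w / 2) * exp (Ln (- (1 / w)) / 2)" by (simp only: csqrt_exp_Ln[OF nz(1)] csqrt_exp_Ln[OF nz(2)])
    also have "\<dots> = exp ((Ln w + Ln (- (1 / w))) / 2)" by (simp add: exp_add[symmetric] add_divide_distrib)
    also have "Ln w + Ln (- (1 / w)) = \<i> * of_real pi" unfolding e unfolding w_def using y by (subst (1 2) L) (auto simp: ln_div)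
    also have "exp (\<i> * of_real pi / 2) = \<i>" using cis_conv_exp[of "pi / 2"] by simp
    finally show ?thesis .
  qed
  have s': "csqrt (- w) * csqrt (1 / w) = - \<i>"
  proof -
    have e: "- w = cnj w" "1 / w = cnj (- (1 / w))" using y by (simp_all add: w_def field_simps)
    have "cnj (csqrt w) = csqrt (- w)" unfolding e(1) using im by (intro cnj_csqrt) (simp add: complex_nonpos_Reals_iff)
    moreover have "cnj (csqrt (- (1 / w))) = csqrt (cnj (- (1 / w)))" using im by (intro cnj_csqrt) (simp add: complex_nonpos_Reals_iff)
    then have "cnj (csqrt (- (1 / w))) = csqrt (1 / w)" by (simp only: e(2)[symmetric])
    ultimately have "csqrt (- w) * csqrt (1 / w) = cnj (csqrt w * csqrt (- (1 / w)))" by simp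
    then show ?thesis unfolding s by simp
  qed
  have q: "Q w * Q (- (1 / w)) = \<i> * (g w * g (- (1 / w)))" "Q (- w) * Q (1 / w) = - \<i> * (g (- w) * g (1 / w))"
  proof -
    have ex: "exp (- of_real t * (a + 1 / a)) * exp (- of_real t * (b + 1 / b)) = 1" if "b = - (1 / a)" for a b :: complex
      using that by (simp add: algebra_simps flip: exp_add)
    have "Q w * Q (- (1 / w)) = (csqrt w * csqrt (- (1 / w))) * (exp (- of_real t * (w + 1 / w)) * exp (- of_real t * (- (1 / w) + 1 / - (1 / w)))) * (g w * g (- (1 / w)))"
      unfolding Q_def by (simp only: mult_ac)
    then show "Q w * Q (- (1 / w)) = \<i> * (g w * g (- (1 / w)))" unfolding s by (subst (asm) ex) simp_all
    have "Q (- w) * Q (1 / w) = (csqrt (- w) * csqrt (1 / w)) * (exp (- of_real t * (- w + 1 / - w)) * exp (- of_real t * ((1 / w) + 1 / (1 / w)))) * (g (- w) * g (1 / w))"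
      unfolding Q_def by (simp only: mult_ac)
    then show "Q (- w) * Q (1 / w) = - \<i> * (g (- w) * g (1 / w))" unfolding s' by (subst (asm) ex) simp_all
  qed
  have "(Q w * P (1 / w) + P w * Q (1 / w)) / 2 = (Q w * Q (- (1 / w)) - Q (- w) * Q (1 / w)) / (2 * \<i> * of_real pi)"
    unfolding P1 P2 by (simp add: field_simps)
  also have "\<dots> = (g w * g (- (1 / w)) + g (- w) * g (1 / w)) / (2 * of_real pi)"
    unfolding q by (simp add: field_simps)
  finally show ?thesis unfolding m .
qed

text \<open>Dominated convergence with \<open>\<rho>\<close> as majorant; the shift to
  \<open>Suc n\<close> avoids \<open>n = 0\<close>, where the denominator has no uniform lower
  bound.\<close>

lemma g_lim_infty: "(\<lambda>n. g (z * of_real (real n))) \<longlonglongrightarrow> 1" if z: "z = \<i> \<or> z = - \<i>" for z :: complex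
proof -
  note [measurable] = \<rho>_meas
  have "(\<lambda>n. stieltjes \<rho> (z * of_real (real (Suc n)))) \<longlonglongrightarrow> (LINT (s::real)|lborel. 0)"
    unfolding stieltjes_def
  proof (rule integral_dominated_convergence[where w = \<rho> and f = "\<lambda>_. 0"])
    have ge: "norm (of_real s + z * of_real (real (Suc n))) \<ge> real (Suc n)" for s n
      using abs_Im_le_cmod[of "of_real s + z * of_real (real (Suc n))"] z by auto
    have le: "norm (of_real (\<rho> s) / (of_real s + z * of_real (real (Suc n)))) \<le> \<rho> s * inverse (real (Suc n))" for s n
    proof -
      have "inverse (norm (of_real s + z * of_real (real (Suc n)))) \<le> inverse (real (Suc n))"
        by (rule le_imp_inverse_le[OF ge]) simp
      moreover have "norm (of_real (\<rho> s) / u) = \<rho> s * inverse (norm u)" for u :: complex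
        using \<rho>_ge[of s] by (simp add: divide_inverse norm_mult norm_inverse)
      ultimately show ?thesis using \<rho>_ge[of s] by (simp only: mult_left_mono)
    qed
    show "AE s in lborel. (\<lambda>n. of_real (\<rho> s) / (of_real s + z * of_real (real (Suc n)))) \<longlonglongrightarrow> 0"
    proof (rule AE_I2, rule Lim_null_comparison)
      fix s
      show "\<forall>\<^sub>F n in sequentially. norm (of_real (\<rho> s) / (of_real s + z * of_real (real (Suc n)))) \<le> \<rho> s * inverse (real (Suc n))"
        by (intro always_eventually allI le)
      show "(\<lambda>n. \<rho> s * inverse (real (Suc n))) \<longlonglongrightarrow> 0"
        by (intro tendsto_mult_right_zero LIMSEQ_inverse_real_of_nat)
    qed
    show "AE s in lborel. norm (of_real (\<rho> s) / (of_real s + z * of_real (real (Suc n)))) \<le> \<rho> s" for n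
    proof (intro AE_I2 order_trans[OF le])
      fix s
      have "\<rho> s * inverse (real (Suc n)) \<le> \<rho> s * 1" using \<rho>_ge[of s] by (intro mult_left_mono) (auto simp: inverse_le_1_iff)
      then show "\<rho> s * inverse (real (Suc n)) \<le> \<rho> s" by simp
    qed
    show "(\<lambda>s. of_real (\<rho> s) / (of_real s + z * of_real (real (Suc n)))) \<in> borel_measurable lborel" for n by measurable
    show "(\<lambda>s::real. 0::complex) \<in> borel_measurable lborel" by simp
    show "integrable lborel \<rho>" by (rule \<rho>_int)
  qed
  then have "(\<lambda>n. g (z * of_real (real (Suc n)))) \<longlonglongrightarrow> 1 + 0" unfolding g_def by (intro tendsto_intros) simp
  then show ?thesis using LIMSEQ_imp_Suc[of "\<lambda>n. g (z * of_real (real n))"] by simp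
qed

text \<open>Here \<open>\<rho> s / s\<close> dominates, since points of the imaginary axis have
  distance at least \<open>s\<close> from \<open>- s\<close>. At \<open>n = 0\<close> the quotient
  is \<open>0\<close> by convention and obeys the same bound.\<close>

lemma g_lim_0: "(\<lambda>n. g (z / of_real (real n))) \<longlonglongrightarrow> of_real g0" if z: "z = \<i> \<or> z = - \<i>" for z :: complex
proof -
  note [measurable] = \<rho>_meas
  have "(\<lambda>n. stieltjes \<rho> (z / of_real (real n))) \<longlonglongrightarrow> (LINT s|lborel. of_real (\<rho> s) / of_real s)"
    unfolding stieltjes_def
  proof (rule integral_dominated_convergence[where w = "\<lambda>s. \<rho> s / s"])
    have re: "Re (z / of_real (real n)) \<ge> 0" for n using z by auto
    show "AE s in lborel. (\<lambda>n. of_real (\<rho> s) / (of_real s + z / of_real (real n))) \<longlonglongrightarrow> of_real (\<rho> s) / of_real s"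
    proof (intro AE_I2)
      fix s
      show "(\<lambda>n. of_real (\<rho> s) / (of_real s + z / of_real (real n))) \<longlonglongrightarrow> of_real (\<rho> s) / of_real s"
      proof (cases "\<rho> s = 0")
        case False
        then have s: "s > 0" by (rule \<rho>_pos)
        have "(\<lambda>n. z * inverse (of_nat n)) \<longlonglongrightarrow> z * 0" by (intro tendsto_intros lim_inverse_n)
        then have "(\<lambda>n. of_real (\<rho> s) / (of_real s + z / of_real (real n))) \<longlonglongrightarrow> of_real (\<rho> s) / (of_real s + 0)"
          using s by (intro tendsto_intros) (auto simp: divide_inverse)
        then show ?thesis by simp
      qed simp
    qed
    show "AE s in lborel. norm (of_real (\<rho> s) / (of_real s + z / of_real (real n))) \<le> \<rho> s / s" for n
    proof (intro AE_I2)
      fix s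
      show "norm (of_real (\<rho> s) / (of_real s + z / of_real (real n))) \<le> \<rho> s / s"
      proof (cases "\<rho> s = 0")
        case False
        then have s: "s > 0" by (rule \<rho>_pos)
        show ?thesis unfolding norm_divide norm_of_real using dist_slit_right[OF re s, of n] \<rho>_ge[of s] s by (intro frac_le) auto
      qed simp
    qed
    show "(\<lambda>s. of_real (\<rho> s) / (of_real s + z / of_real (real n))) \<in> borel_measurable lborel" for n by measurable
    show "(\<lambda>s. of_real (\<rho> s) / of_real s :: complex) \<in> borel_measurable lborel" by measurable
    show "integrable lborel (\<lambda>s. \<rho> s / s)" by (rule \<rho>_int')
  qed
  also have "(LINT s|lborel. of_real (\<rho> s) / of_real s) = complex_of_real (LINT s|lborel. \<rho> s / s)"
    unfolding integral_complex_of_real[symmetric] by simp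
  finally have "(\<lambda>n. g (z / of_real (real n))) \<longlonglongrightarrow> 1 + of_real (LINT s|lborel. \<rho> s / s)" unfolding g_def by (intro tendsto_intros)
  then show ?thesis by (simp add: g0_def)
qed

lemma factor_exists:
  obtains A1 A2 C1 C2 :: "complex \<Rightarrow> complex" and d :: real where "d > 0"
    "A1 holomorphic_on UNIV" "A2 holomorphic_on UNIV" "C1 holomorphic_on UNIV" "C2 holomorphic_on UNIV"
    "\<And>w. A1 (- w) = A1 w" "\<And>w. A2 (- w) = - A2 w" "\<And>w. C1 (- w) = C1 w" "\<And>w. C2 (- w) = - C2 w"
    "A1 0 \<in> \<real>" "C1 0 \<in> \<real>" "\<And>w. A1 w * C1 w + A2 w * C2 w / 2 = of_real d"
    "\<And>w x. w \<in> slit \<Longrightarrow> norm w = 1 \<Longrightarrow> x = of_real t / w \<Longrightarrow> cnj (C1 w) * C1 w - cnj (A2 w) * A2 w / 4 = of_real d / 2 * (cnj (I0 x) * K0 x + I0 x * cnj (K0 x))"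
    "\<And>w x. w \<in> slit \<Longrightarrow> norm w = 1 \<Longrightarrow> x = of_real t / w \<Longrightarrow> cnj (C1 w) * C2 w + cnj (A2 w) * A1 w / 2 = w * of_real d * (cnj (I0 x) * K1 x + cnj (K0 x) * I1 x)"
    "\<And>w x. w \<in> slit \<Longrightarrow> norm w = 1 \<Longrightarrow> x = of_real t / w \<Longrightarrow> cnj (C2 w) * C2 w - cnj (A1 w) * A1 w = 2 * of_real d * (cnj (I1 x) * K1 x + I1 x * cnj (K1 x))"
proof -
  obtain M where M: "\<And>w. Re w > 0 \<Longrightarrow> norm w < min t 1 \<Longrightarrow> norm (A1s w) \<le> M / sqrt (norm w)"
    "\<And>w. Re w > 0 \<Longrightarrow> norm w < min t 1 \<Longrightarrow> norm (A2s w) \<le> M / sqrt (norm w)"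
    "\<And>w. Re w > 0 \<Longrightarrow> norm w < min t 1 \<Longrightarrow> norm (C1s w) \<le> M / sqrt (norm w)"
    "\<And>w. Re w > 0 \<Longrightarrow> norm w < min t 1 \<Longrightarrow> norm (C2s w) \<le> M / sqrt (norm w)"
    by (rule factor_bounds) blast
  have \<delta>: "min t 1 > 0" using t by simp
  have s: "1 * 1 = (1::complex)" "norm (1::complex) = 1" "- 1 * - 1 = (1::complex)" "norm (- 1::complex) = 1" by simp_all
  obtain A1 where A1: "A1 holomorphic_on UNIV" "\<And>w. w \<in> slit \<Longrightarrow> A1 w = A1s w" "\<And>w. A1 (- w) = 1 * A1 w" "A1 0 \<in> \<real>"
    by (rule entire_extension[OF A1s_holo s(1,2) factor_minus(1) \<delta> M(1) factor_cnj(1)]) (rule that | assumption)+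
  obtain A2 where A2: "A2 holomorphic_on UNIV" "\<And>w. w \<in> slit \<Longrightarrow> A2 w = A2s w" "\<And>w. A2 (- w) = - 1 * A2 w" "A2 0 \<in> \<real>"
    by (rule entire_extension[OF A2s_holo s(3,4) factor_minus(2) \<delta> M(2) factor_cnj(2)]) (rule that | assumption)+
  obtain C1 where C1: "C1 holomorphic_on UNIV" "\<And>w. w \<in> slit \<Longrightarrow> C1 w = C1s w" "\<And>w. C1 (- w) = 1 * C1 w" "C1 0 \<in> \<real>"
    by (rule entire_extension[OF C1s_holo s(1,2) factor_minus(3) \<delta> M(3) factor_cnj(3)]) (rule that | assumption)+
  obtain C2 where C2: "C2 holomorphic_on UNIV" "\<And>w. w \<in> slit \<Longrightarrow> C2 w = C2s w" "\<And>w. C2 (- w) = - 1 * C2 w" "C2 0 \<in> \<real>"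
    by (rule entire_extension[OF C2s_holo s(3,4) factor_minus(4) \<delta> M(4) factor_cnj(4)]) (rule that | assumption)+
  define D where "D w = A1 w * C1 w + A2 w * C2 w / 2" for w
  have D_holo: "D holomorphic_on UNIV" unfolding D_def[abs_def] by (intro holomorphic_intros A1(1) A2(1) C1(1) C2(1)) auto
  have D_slit: "D w = (Q w * P (1 / w) + P w * Q (1 / w)) / 2" if "w \<in> slit" for w
    using factor_det[OF slit_nz[OF that]] by (simp add: D_def A1(2)[OF that] A2(2)[OF that] C1(2)[OF that] C2(2)[OF that])
  have D_minus: "D (- w) = D w" for w by (simp add: D_def A1(3) A2(3) C1(3) C2(3))
  have D_inv: "D (1 / w) = D w" if "w \<noteq> 0" for w
  proof -
    have *: "D (1 / u) = D u" if "u \<in> slit" for u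
      unfolding D_slit[OF that] D_slit[OF slit_inv1[OF that]] by simp
    show ?thesis
    proof (cases "w \<in> slit")
      case False
      then have "- w \<in> slit" using that by (auto simp: complex_nonpos_Reals_iff complex_eq_iff)
      then show ?thesis using *[of "- w"] D_minus[of w] D_minus[of "1 / w"] by simp
    qed (rule *)
  qed
  \<comment> \<open>By the symmetry under inversion, all values of \<open>D\<close> are already
    taken on the closed unit disc.\<close>
  have "bounded (D ` cball 0 1)"
    using D_holo by (intro compact_imp_bounded compact_continuous_image holomorphic_on_imp_continuous_on) (auto intro: holomorphic_on_subset)
  moreover have "range D \<subseteq> D ` cball 0 1"
  proof
    fix v assume "v \<in> range D"
    then obtain w where w: "v = D w" by blast
    show "v \<in> D ` cball 0 1"
    proof (cases "norm w \<le> 1")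
      case False
      then have "norm w > 1" "w \<noteq> 0" by auto
      then have "norm (1 / w) \<le> 1" "w \<noteq> 0" by (auto simp: norm_divide field_simps)
      then show ?thesis using D_inv[of w] w by (intro image_eqI[of _ _ "1 / w"]) auto
    qed (use w in auto)
  qed
  ultimately have "bounded (range D)" using bounded_subset by blast
  then have const: "D w = D 0" for w using Liouville_theorem[OF D_holo] by (metis constant_on_def UNIV_I)
  define d where "d = g0 / pi"
  have d: "d > 0" using g0_ge by (simp add: d_def)
  \<comment> \<open>The constant is found along \<open>w = \<i> * n\<close>: each of the two
    products of \<open>g\<close> tends to \<open>1 * g0\<close>, which gives
    \<open>2 * g0 / (2 * pi)\<close>.\<close>
  have D0: "D 0 = of_real d"
  proof -
    have "D 0 = (g (\<i> * of_real (real n)) * g (\<i> / of_real (real n)) + g (- \<i> * of_real (real n)) * g (- \<i> / of_real (real n))) / (2 * of_real pi)"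
      if n: "n \<ge> 1" for n
    proof -
      let ?w = "\<i> * of_real (real n)"
      have "?w \<in> slit" using n by (intro slit_Im) simp
      from D_slit[OF this] have "D 0 = (Q ?w * P (1 / ?w) + P ?w * Q (1 / ?w)) / 2" using const[of ?w] by simp
      also have "\<dots> = (g ?w * g (1 / cnj ?w) + g (- ?w) * g (1 / ?w)) / (2 * of_real pi)" using n by (intro factor_det_imaginary) simp
      also have "1 / cnj ?w = \<i> / of_real (real n)" using n by (simp add: field_simps)
      also have "- ?w = - \<i> * of_real (real n)" by simp
      also have "1 / ?w = - \<i> / of_real (real n)" using n by (simp add: field_simps)
      finally show ?thesis .
    qed
    then have "\<forall>\<^sub>F n in sequentially. (g (\<i> * of_real (real n)) * g (\<i> / of_real (real n)) + g (- \<i> * of_real (real n)) * g (- \<i> / of_real (real n))) / (2 * of_real pi) = D 0"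
      by (intro eventually_sequentiallyI[of 1]) simp
    moreover have "(\<lambda>n. (g (\<i> * of_real (real n)) * g (\<i> / of_real (real n)) + g (- \<i> * of_real (real n)) * g (- \<i> / of_real (real n))) / (2 * of_real pi)) \<longlonglongrightarrow> 
      (1 * of_real g0 + 1 * of_real g0) / (2 * of_real pi)"
      by (intro tendsto_divide tendsto_add tendsto_mult g_lim_infty g_lim_0 tendsto_const) auto
    ultimately have "(\<lambda>n. D 0) \<longlonglongrightarrow> (1 * of_real g0 + 1 * of_real g0) / (2 * of_real pi)" by (simp add: tendsto_cong)
    then have "D 0 = (1 * of_real g0 + 1 * of_real g0) / (2 * of_real pi)" by (simp add: LIMSEQ_const_iff)
    then show ?thesis by (simp add: d_def)
  qed
  have Dd: "D w = of_real d" for w using const D0 by simp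
  have dd: "(Q w * P (1 / w) + P w * Q (1 / w)) / 2 = of_real d" if "w \<in> slit" for w using D_slit[OF that] Dd by simp
  show ?thesis
  proof (rule that[OF d A1(1) A2(1) C1(1) C2(1)])
    show "A1 w * C1 w + A2 w * C2 w / 2 = of_real d" for w using Dd[of w] by (simp add: D_def)
  next
    fix w x assume w: "w \<in> slit" "norm w = 1" and x: "x = of_real t / w"
    note * = factor_circle[OF w, folded x, unfolded dd[OF w(1)]]
    show "cnj (C1 w) * C1 w - cnj (A2 w) * A2 w / 4 = of_real d / 2 * (cnj (I0 x) * K0 x + I0 x * cnj (K0 x))"
      "cnj (C1 w) * C2 w + cnj (A2 w) * A1 w / 2 = w * of_real d * (cnj (I0 x) * K1 x + cnj (K0 x) * I1 x)"
      "cnj (C2 w) * C2 w - cnj (A1 w) * A1 w = 2 * of_real d * (cnj (I1 x) * K1 x + I1 x * cnj (K1 x))"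
      using * A1(2)[OF w(1)] A2(2)[OF w(1)] C1(2)[OF w(1)] C2(2)[OF w(1)] by simp_all
  next
    fix w
    show "A1 (- w) = A1 w" using A1(3)[of w] by simp
    show "A2 (- w) = - A2 w" using A2(3)[of w] by simp
    show "C1 (- w) = C1 w" using C1(3)[of w] by simp
    show "C2 (- w) = - C2 w" using C2(3)[of w] by simp
  next
    show "A1 0 \<in> \<real>" by (rule A1(4))
    show "C1 0 \<in> \<real>" by (rule C1(4))
  qed
qed

end

section \<open>Matrix loops\<close>

abbreviation entry :: "cmat2 \<Rightarrow> 2 \<Rightarrow> 2 \<Rightarrow> complex" where
  "entry X i j \<equiv> vec_nth (vec_nth X i) j"

lemma mat22_nth [simp]:
  "entry (mat22 a b c d) 1 1 = a" "entry (mat22 a b c d) 1 2 = b" "entry (mat22 a b c d) 2 1 = c" "entry (mat22 a b c d) 2 2 = d"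
  by (simp_all add: mat22_def)

lemma cmat2_eq_iff: "X = (Y :: cmat2) \<longleftrightarrow> entry X 1 1 = entry Y 1 1 \<and> entry X 1 2 = entry Y 1 2 \<and> entry X 2 1 = entry Y 2 1 \<and> entry X 2 2 = entry Y 2 2"
  unfolding vec_eq_iff forall_2 by blast

lemma mat22_eq_iff: "mat22 a b c d = mat22 a' b' c' d' \<longleftrightarrow> a = a' \<and> b = b' \<and> c = c' \<and> d = d'"
  by (simp add: cmat2_eq_iff)

lemma mat22_mult: "mat22 a b c d ** mat22 e f g h = mat22 (a * e + b * g) (a * f + b * h) (c * e + d * g) (c * f + d * h)"
  by (simp add: cmat2_eq_iff matrix_matrix_mult_def sum_2)

lemma det_mat22: "det (mat22 a b c d) = a * d - b * c"
  by (simp add: det_2)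

lemma one_mat22: "mat 1 = mat22 1 0 0 1"
  by (simp add: cmat2_eq_iff mat_def)

definition adj2 :: "cmat2 \<Rightarrow> cmat2" where "adj2 X = transpose (map_matrix cnj X)"

lemma adj2_mat22: "adj2 (mat22 a b c d) = mat22 (cnj a) (cnj c) (cnj b) (cnj d)"
  by (simp add: cmat2_eq_iff adj2_def transpose_def map_matrix_def)

lemma adj2_mult: "adj2 (X ** Y) = adj2 Y ** adj2 X"
  by (simp add: cmat2_eq_iff adj2_def transpose_def map_matrix_def matrix_matrix_mult_def sum_2)

lemma twist_mat22: "twist (mat22 a b c d) = mat22 a (- b) (- c) d"
  by (simp add: twist_def sigma3_def mat22_mult)

lemma sigma3_sq: "sigma3 ** sigma3 = mat 1"
  by (simp add: sigma3_def mat22_mult one_mat22)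

lemma twist_mult: "twist (X ** Y) = twist X ** twist Y"
proof -
  have "twist X ** twist Y = sigma3 ** X ** (sigma3 ** sigma3) ** Y ** sigma3" by (simp add: twist_def matrix_mul_assoc)
  then show ?thesis by (simp add: sigma3_sq twist_def matrix_mul_assoc)
qed

lemma has_vector_derivative_vec:
  fixes f :: "real \<Rightarrow> 'a::real_normed_vector ^ 'n"
  assumes "\<And>i. ((\<lambda>t. vec_nth (f t) i) has_vector_derivative vec_nth f' i) (at x)"
  shows "(f has_vector_derivative f') (at x)"
  using assms unfolding has_vector_derivative_def has_derivative_def
  by (auto intro!: vec_tendstoI bounded_linear_scaleR_left)

text \<open>The derivative of \<open>f (cis t)\<close> in \<open>t\<close> is the value at
  \<open>cis t\<close> of \<open>\<i> * l * deriv f l\<close>. This operation preserves holomorphy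
  on the punctured plane, so its iterates are the derivatives of all orders.\<close>

lemma smooth_on_circle_holomorphic:
  fixes G :: "complex \<Rightarrow> cmat2"
  assumes "\<And>i j. (\<lambda>l. entry (G l) i j) holomorphic_on - {0}"
  shows "smooth_on_circle G"
proof -
  define dt where "dt = (\<lambda>f l. \<i> * l * deriv f l :: complex)"
  define D where "D = (\<lambda>n t. (\<chi> i j. (dt ^^ n) (\<lambda>l. entry (G l) i j) (cis t)) :: cmat2)"
  have holo: "(dt ^^ n) (\<lambda>l. entry (G l) i j) holomorphic_on - {0}" for n i j
    by (induction n) (auto simp: dt_def assms intro!: holomorphic_intros holomorphic_deriv)
  have "(D n has_vector_derivative D (Suc n) t) (at t)" for n t
  proof (intro has_vector_derivative_vec)
    fix i j
    let ?f = "(dt ^^ n) (\<lambda>l. entry (G l) i j)"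
    have "(?f has_field_derivative deriv ?f (cis t)) (at (cis t))"
      by (rule holomorphic_derivI[OF holo]) auto
    moreover have "(cis has_vector_derivative \<i> * cis t) (at t)" 
    proof -
      have "((\<lambda>t. \<i> * of_real t) has_vector_derivative \<i> * of_real 1) (at t)"
        by (intro has_vector_derivative_mult_right has_vector_derivative_of_real DERIV_ident)
      from field_vector_diff_chain_at[OF this DERIV_exp]
      show ?thesis by (simp add: o_def cis_conv_exp[abs_def])
    qed
    ultimately have "((?f \<circ> cis) has_vector_derivative (\<i> * cis t) * deriv ?f (cis t)) (at t)"
      by (intro field_vector_diff_chain_at)
    then show "((\<lambda>s. entry (D n s) i j) has_vector_derivative entry (D (Suc n) t) i j) (at t)"
      by (simp add: D_def o_def dt_def)
  qed
  moreover have "D 0 t = G (cis t)" for t by (simp add: D_def vec_eq_iff)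
  ultimately show ?thesis unfolding smooth_on_circle_def by blast
qed

lemma mat22_holo:
  assumes "a holomorphic_on S" "b holomorphic_on S" "c holomorphic_on S" "d holomorphic_on S"
  shows "(\<lambda>l. entry (mat22 (a l) (b l) (c l) (d l)) i j) holomorphic_on S"
  using assms exhaust_2[of i] exhaust_2[of j] by auto

text \<open>If \<open>\<phi>\<^sup>* \<sigma>\<^sub>3 \<phi> = - B\<^sup>* \<sigma>\<^sub>3 B\<close>, then \<open>\<phi> B\<^sup>-\<^sup>1\<close> turns \<open>\<sigma>\<^sub>3\<close> into \<open>- \<sigma>\<^sub>3\<close>, and the extra factor \<open>\<omega>\<^sup>-\<^sup>1\<close>
  restores the sign.\<close>

lemma su11_of_hermitian_eq:
  assumes l: "norm l = 1" and inv: "B ** Bi = mat 1"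
    and eq: "adj2 X ** sigma3 ** X = adj2 B ** mat22 (- 1) 0 0 1 ** B"
  defines "F \<equiv> X ** Bi ** mat22 0 (- l) (inverse l) 0"
  shows "F ** sigma3 ** adj2 F = sigma3"
proof -
  let ?O = "mat22 0 (- l) (inverse l) 0"
  have ll: "cnj l * l = 1" using l by (metis complex_norm_square mult.commute of_real_1 one_power2)
  have l0: "l \<noteq> 0" using l by auto
  have O: "adj2 ?O ** mat22 (- 1) 0 0 1 ** ?O = sigma3"
    using ll l0 by (simp add: adj2_mat22 mat22_mult sigma3_def mat22_eq_iff field_simps)
  have a: "adj2 Bi ** adj2 B = mat 1" unfolding adj2_mult[symmetric] inv by (simp add: one_mat22 adj2_mat22)
  have "adj2 F ** sigma3 ** F = adj2 ?O ** (adj2 Bi ** (adj2 X ** sigma3 ** X) ** Bi) ** ?O"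
    unfolding F_def adj2_mult by (simp add: matrix_mul_assoc)
  also have "\<dots> = adj2 ?O ** ((adj2 Bi ** adj2 B) ** mat22 (- 1) 0 0 1 ** (B ** Bi)) ** ?O"
    unfolding eq by (simp add: matrix_mul_assoc)
  also have "\<dots> = sigma3" unfolding a inv using O by simp
  finally have "adj2 F ** sigma3 ** F = sigma3" .
  then have "(sigma3 ** adj2 F ** sigma3) ** F = mat 1" by (metis matrix_mul_assoc sigma3_sq)
  \<comment> \<open>The group condition has the adjoint on the right; a left inverse of a square
    matrix is a right inverse.\<close>
  then have "F ** (sigma3 ** adj2 F ** sigma3) = mat 1" using matrix_left_right_inverse by blast
  then have "F ** sigma3 ** adj2 F ** (sigma3 ** sigma3) = sigma3" by (metis matrix_mul_assoc matrix_mul_lid)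
  then show ?thesis by (simp add: sigma3_sq)
qed

section \<open>The matrix phi in terms of Bessel functions\<close>

lemma series_term:
  assumes "l \<noteq> 0"
  shows "l powi (- 2 * int j) * z ^ (4 * j) / (16 ^ j * (fact j)\<^sup>2) = bcoeff j * ((z\<^sup>2 / (2 * l) / 2)\<^sup>2) ^ j"
proof -
  have "l powi (- 2 * int j) = inverse ((l\<^sup>2) ^ j)"
    using power_int_minus[of l "2 * int j"] power_int_of_nat[of l "2 * j"] by (simp add: power_mult)
  moreover have "(z\<^sup>2 / (2 * l) / 2)\<^sup>2 = z ^ 4 / (16 * l\<^sup>2)" by (simp add: power_divide power_mult_distrib flip: power_mult)
  moreover have "z ^ (4 * j) = (z ^ 4) ^ j" by (rule power_mult)
  ultimately show ?thesis unfolding bcoeff_def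
    by (simp only: power_divide power_mult_distrib divide_inverse inverse_mult_distrib mult_1_left mult_ac power_inverse)
qed

lemma y0_eq: "l \<noteq> 0 \<Longrightarrow> y0 z l = I0 (z\<^sup>2 / (2 * l))"
  unfolding y0_def I0_def pser_def by (subst series_term) auto

lemma y1_eq: "l \<noteq> 0 \<Longrightarrow> y1 z l = - 2 * inverse l * H0 (z\<^sup>2 / (2 * l))"
proof -
  assume l: "l \<noteq> 0"
  have c: "harm j * (bcoeff j * q) = hcoeff j * q" for j q by (simp add: bcoeff_def hcoeff_def)
  define q where "q = (z\<^sup>2 / (2 * l) / 2)\<^sup>2"
  have "(\<lambda>j. hcoeff j * q ^ j) sums pser hcoeff q" unfolding pser_def by (intro summable_sums hcoeff_summable)
  then have "(\<lambda>i. hcoeff (Suc i) * q ^ Suc i) sums pser hcoeff q" by (subst sums_Suc_iff) (simp add: hcoeff_def harm_def)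
  then have "pser hcoeff q = (\<Sum>i. hcoeff (Suc i) * q ^ Suc i)" by (simp add: sums_iff)
  then show ?thesis unfolding y1_def H0_def Let_def series_term[OF l] c q_def[symmetric] by simp
qed

text \<open>\<open>z d/dz\<close> acts on functions of \<open>x\<close> as \<open>2 x d/dx\<close>,
  which turns the derivative of \<open>y0\<close> into \<open>I1\<close> and that of
  \<open>y1\<close> into \<open>H1\<close>. The function \<open>v\<close> is the logarithmic
  solution with \<open>Ln (z / 2)\<close> as its logarithm, and \<open>v1\<close> is
  \<open>z dv/dz\<close>.\<close>

lemma phi_eq:
  assumes l: "l \<noteq> 0" and z: "z \<noteq> 0"
  defines "x \<equiv> z\<^sup>2 / (2 * l)"
  defines "v \<equiv> Ln (z / 2) * I0 x - H0 x / 2" and "v1 \<equiv> 2 * Ln (z / 2) * I1 x + I0 x - H1 x" and "s \<equiv> sqrt_neg_euler"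
  shows "phi z l = mat22 (s * I0 x - v / s) (2 * l * s * I1 x - l * v1 / s) (v / (l * s)) (v1 / s)"
proof -
  have x: "x \<noteq> 0" using l z by (simp add: x_def)
  have dx: "((\<lambda>w. w\<^sup>2 / (2 * l)) has_field_derivative z / l) (at z)"
    using l by (auto intro!: derivative_eq_intros)
  have zx: "z / l / x = 2 / z" using l z by (simp add: x_def power2_eq_square field_simps)
  have c: "a / x * (z / l) = 2 * a / z" for a
  proof -
    have "a / x * (z / l) = a * (z / l / x)" by simp
    then show ?thesis unfolding zx by simp
  qed
  have "((\<lambda>w. I0 (w\<^sup>2 / (2 * l))) has_field_derivative I1 x / x * (z / l)) (at z)"
    using DERIV_chain2[where f = I0 and g = "\<lambda>w. w\<^sup>2 / (2 * l)", OF _ dx] I0_deriv[OF x] unfolding x_def by blast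
  then have d0: "deriv (\<lambda>w. y0 w l) z = 2 * I1 x / z"
    unfolding y0_eq[OF l] c by (rule DERIV_imp_deriv)
  have "((\<lambda>w. H0 (w\<^sup>2 / (2 * l))) has_field_derivative H1 x / x * (z / l)) (at z)"
    using DERIV_chain2[where f = H0 and g = "\<lambda>w. w\<^sup>2 / (2 * l)", OF _ dx] H0_deriv[OF x] unfolding x_def by blast
  from DERIV_cmult[OF this, of "- 2 * inverse l"]
  have d1: "deriv (\<lambda>w. y1 w l) z = - 2 * inverse l * (2 * H1 x / z)"
    unfolding y1_eq[OF l] c by (rule DERIV_imp_deriv)
  have s0: "s \<noteq> 0" using euler_mascheroni_pos by (simp add: s_def sqrt_neg_euler_def)
  show ?thesis
    unfolding phi_def unfolding d0 d1 unfolding y0_eq[OF l] y1_eq[OF l] x_def[symmetric] s_def[symmetric] mat22_mult mat22_eq_iff v_def v1_def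
    using l z s0 by (simp add: field_simps)
qed

lemma sqrt_neg_euler_facts: "sqrt_neg_euler \<noteq> 0" "sqrt_neg_euler * sqrt_neg_euler = - euler_mascheroni" "cnj sqrt_neg_euler = - sqrt_neg_euler"
proof -
  show "sqrt_neg_euler \<noteq> 0" using euler_mascheroni_pos by (simp add: sqrt_neg_euler_def)
  have "sqrt euler_mascheroni * sqrt euler_mascheroni = euler_mascheroni" using euler_mascheroni_pos by simp
  then have "complex_of_real (sqrt euler_mascheroni) * of_real (sqrt euler_mascheroni) = of_real euler_mascheroni" by (metis of_real_mult)
  then show "sqrt_neg_euler * sqrt_neg_euler = - euler_mascheroni" by (simp add: sqrt_neg_euler_def algebra_simps)
  show "cnj sqrt_neg_euler = - sqrt_neg_euler" by (simp add: sqrt_neg_euler_def)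
qed

lemma phi_det: "l \<noteq> 0 \<Longrightarrow> z \<noteq> 0 \<Longrightarrow> det (phi z l) = 1"
proof -
  assume l: "l \<noteq> 0" and z: "z \<noteq> 0"
  define x where "x = z\<^sup>2 / (2 * l)"
  define L where "L = Ln (z / 2)"
  have "det (phi z l) = (I0 x)\<^sup>2 + I1 x * H0 x - H1 x * I0 x"
    unfolding phi_eq[OF l z] det_mat22 x_def[symmetric] L_def[symmetric]
    using l sqrt_neg_euler_facts(1) by (simp add: field_simps power2_eq_square)
  then show ?thesis by (simp add: bessel_det)
qed

lemma phi_twist: "l \<noteq> 0 \<Longrightarrow> z \<noteq> 0 \<Longrightarrow> phi z (- l) = twist (phi z l)"
proof -
  assume l: "l \<noteq> 0" and z: "z \<noteq> 0"
  have m: "z\<^sup>2 / (2 * - l) = - (z\<^sup>2 / (2 * l))" by simp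
  have "- l \<noteq> 0" using l by simp
  show ?thesis
    unfolding phi_eq[OF l z] phi_eq[OF \<open>- l \<noteq> 0\<close> z] twist_mat22 m I0_minus I1_minus H0_minus H1_minus by (simp add: mat22_eq_iff)
qed

lemma phi_holo: "z \<noteq> 0 \<Longrightarrow> (\<lambda>l. entry (phi z l) i j) holomorphic_on - {0}"
proof -
  assume z: "z \<noteq> 0"
  have c: "(\<lambda>l. f (z\<^sup>2 / (2 * l))) holomorphic_on - {0}" if "f holomorphic_on UNIV" for f
  proof -
    have "(\<lambda>l. z\<^sup>2 / (2 * l)) holomorphic_on - {0}" by (intro holomorphic_intros) auto
    from holomorphic_on_compose_gen[OF this that] show ?thesis by (simp add: o_def)
  qed
  note h = c[OF I0_holo] c[OF I1_holo] c[OF H0_holo] c[OF H1_holo]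
  have "(\<lambda>l. entry (mat22 (sqrt_neg_euler * I0 (z\<^sup>2 / (2 * l)) - (Ln (z / 2) * I0 (z\<^sup>2 / (2 * l)) - H0 (z\<^sup>2 / (2 * l)) / 2) / sqrt_neg_euler)
     (2 * l * sqrt_neg_euler * I1 (z\<^sup>2 / (2 * l)) - l * (2 * Ln (z / 2) * I1 (z\<^sup>2 / (2 * l)) + I0 (z\<^sup>2 / (2 * l)) - H1 (z\<^sup>2 / (2 * l))) / sqrt_neg_euler)
     ((Ln (z / 2) * I0 (z\<^sup>2 / (2 * l)) - H0 (z\<^sup>2 / (2 * l)) / 2) / (l * sqrt_neg_euler))
     ((2 * Ln (z / 2) * I1 (z\<^sup>2 / (2 * l)) + I0 (z\<^sup>2 / (2 * l)) - H1 (z\<^sup>2 / (2 * l))) / sqrt_neg_euler)) i j) holomorphic_on - {0}"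
    by (intro mat22_holo holomorphic_intros h) (use sqrt_neg_euler_facts in auto)
  then show ?thesis by (rule holomorphic_transform) (simp add: phi_eq z)
qed

text \<open>Since \<open>norm (x / 2) = (norm (z / 2))\<^sup>2\<close>, \<open>Ln (z / 2)\<close>
  and \<open>Ln (x / 2) / 2\<close> differ by an imaginary \<open>\<tau>\<close>, whatever the
  branches, and \<open>v\<close> is \<open>- K0 x / 2\<close> plus \<open>\<tau> - e / 2\<close>
  times \<open>I0 x\<close>. In the hermitian products \<open>\<tau>\<close> cancels against its
  conjugate, and the two halves of \<open>e\<close> cancel the term produced by
  \<open>s * s = - e\<close>.\<close>

lemma phi_hermitian:
  assumes l: "norm l = 1" and z: "z \<noteq> 0"
  defines "x \<equiv> z\<^sup>2 / (2 * l)"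
  defines "m \<equiv> cnj (I0 x) * K1 x + cnj (K0 x) * I1 x"
  shows "adj2 (phi z l) ** sigma3 ** phi z l = mat22 (- (cnj (I0 x) * K0 x + I0 x * cnj (K0 x)) / 2) (- l * m)
     (- cnj l * cnj m) (- 2 * (cnj (I1 x) * K1 x + I1 x * cnj (K1 x)))"
proof -
  have l0: "l \<noteq> 0" using l by auto
  have ll: "cnj l * l = 1" using l by (metis complex_norm_square mult.commute of_real_1 one_power2)
  have cl: "cnj l = 1 / l" using ll l0 by (simp add: field_simps)
  define s where "s = sqrt_neg_euler"
  have s: "s \<noteq> 0" "s * s = - euler_mascheroni" "cnj s = - s" using sqrt_neg_euler_facts by (auto simp: s_def)
  define e :: complex where "e = euler_mascheroni"
  have ce: "cnj e = e" by (simp add: e_def euler_mascheroni_def)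
  define \<tau> where "\<tau> = Ln (z / 2) - Ln (x / 2) / 2"
  have x0: "x \<noteq> 0" using l0 z by (simp add: x_def)
  have "Re (Ln (x / 2)) = 2 * Re (Ln (z / 2))"
  proof -
    have "norm (x / 2) = (norm (z / 2))\<^sup>2" using l by (simp add: x_def norm_divide norm_mult norm_power power2_eq_square)
    moreover have "norm (z / 2) > 0" "x / 2 \<noteq> 0" "z / 2 \<noteq> 0" using z x0 by auto
    ultimately show ?thesis by (simp add: Re_Ln ln_realpow)
  qed
  then have "Re \<tau> = 0" by (simp add: \<tau>_def)
  then have \<tau>: "cnj \<tau> = - \<tau>" by (simp add: complex_eq_iff)
  define I J K M where "I = I0 x" and "J = I1 x" and "K = K0 x" and "M = K1 x"
  define v where "v = - K / 2 + (\<tau> - e / 2) * I"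
  define v1 where "v1 = - M + (2 * \<tau> - e) * J"
  have v: "Ln (z / 2) * I0 x - H0 x / 2 = v" 
    unfolding v_def I_def K_def \<tau>_def K0_def e_def by (simp add: field_simps)
  have v1: "2 * Ln (z / 2) * I1 x + I0 x - H1 x = v1" 
    unfolding v1_def J_def M_def \<tau>_def K1_def e_def by (simp add: field_simps)
  have ph: "phi z l = mat22 (s * I - v / s) (2 * l * s * J - l * v1 / s) (v / (l * s)) (v1 / s)"
    unfolding phi_eq[OF l0 z] x_def[symmetric] v v1 s_def[symmetric] I_def J_def ..
  have ss: "s * s = - e" "s * (s * a) = - e * a" for a using s(2) by (simp_all add: e_def mult.assoc[symmetric])
  have cs: "cnj (s * a - b / s) = - s * cnj a + cnj b / s" "cnj (a / s) = - cnj a / s" for a b using s by simp_all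
  have p: "(- s * a + b / s) * (s * c - d / s) - (- b / s) * (d / s) = e * a * c + a * d + b * c" for a b c d
  proof -
    have "(- s * a + b / s) * (s * c - d / s) - (- b / s) * (d / s) = - (s * s) * a * c + a * d + b * c"
      using s(1) by (simp add: field_simps)
    then show ?thesis unfolding ss(1) by simp
  qed
  have cnjs: "cnj v = - cnj K / 2 + (- \<tau> - e / 2) * cnj I" "cnj v1 = - cnj M + (- 2 * \<tau> - e) * cnj J"
    unfolding v_def v1_def by (simp_all add: \<tau> ce)
  have e11: "cnj (s * I - v / s) * (s * I - v / s) - cnj (v / (l * s)) * (v / (l * s)) = - (cnj I * K + I * cnj K) / 2"
  proof -
    have "cnj (v / (l * s)) * (v / (l * s)) = (- cnj v / s) * (v / s)" using l0 s by (simp add: cl)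
    then have "cnj (s * I - v / s) * (s * I - v / s) - cnj (v / (l * s)) * (v / (l * s)) = e * cnj I * I + cnj I * v + cnj v * I"
      unfolding cs(1) using p by simp
    also have "\<dots> = - (cnj I * K + I * cnj K) / 2" unfolding cnjs unfolding v_def by (simp add: field_simps)
    finally show ?thesis .
  qed
  have e12: "cnj (s * I - v / s) * (2 * l * s * J - l * v1 / s) - cnj (v / (l * s)) * (v1 / s) = - l * (cnj I * M + cnj K * J)"
  proof -
    have a: "2 * l * s * J - l * v1 / s = l * (s * (2 * J) - v1 / s)" by (simp add: algebra_simps)
    have b: "cnj (v / (l * s)) = l * (- cnj v / s)" using l0 s by (simp add: cl)
    have "cnj (s * I - v / s) * (2 * l * s * J - l * v1 / s) - cnj (v / (l * s)) * (v1 / s) 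
       = l * ((- s * cnj I + cnj v / s) * (s * (2 * J) - v1 / s) - (- cnj v / s) * (v1 / s))"
      unfolding a b cs(1) by (simp add: algebra_simps)
    also have "\<dots> = l * (e * cnj I * (2 * J) + cnj I * v1 + cnj v * (2 * J))" unfolding p ..
    also have "\<dots> = - l * (cnj I * M + cnj K * J)" unfolding cnjs unfolding v1_def by (simp add: algebra_simps)
    finally show ?thesis .
  qed
  have e22: "cnj (2 * l * s * J - l * v1 / s) * (2 * l * s * J - l * v1 / s) - cnj (v1 / s) * (v1 / s) = - 2 * (cnj J * M + J * cnj M)"
  proof -
    have a: "2 * l * s * J - l * v1 / s = l * (s * (2 * J) - v1 / s)" by (simp add: algebra_simps)
    have "cnj (2 * l * s * J - l * v1 / s) * (2 * l * s * J - l * v1 / s) = (cnj l * l) * (cnj (s * (2 * J) - v1 / s) * (s * (2 * J) - v1 / s))"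
      unfolding a complex_cnj_mult[of l] by (simp only: mult_ac)
    then have "cnj (2 * l * s * J - l * v1 / s) * (2 * l * s * J - l * v1 / s) - cnj (v1 / s) * (v1 / s) 
       = (- s * cnj (2 * J) + cnj v1 / s) * (s * (2 * J) - v1 / s) - (- cnj v1 / s) * (v1 / s)"
      unfolding ll cs by simp
    also have "\<dots> = e * cnj (2 * J) * (2 * J) + cnj (2 * J) * v1 + cnj v1 * (2 * J)" unfolding p ..
    also have "\<dots> = - 2 * (cnj J * M + J * cnj M)" unfolding cnjs unfolding v1_def by (simp add: algebra_simps)
    finally show ?thesis .
  qed
  have e21: "cnj (2 * l * s * J - l * v1 / s) * (s * I - v / s) - cnj (v1 / s) * (v / (l * s)) = - cnj l * cnj (cnj I * M + cnj K * J)"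
    using arg_cong[OF e12, of cnj] by (simp add: mult.commute)
  show ?thesis
    unfolding ph adj2_mat22 sigma3_def mat22_mult mat22_eq_iff m_def I_def[symmetric] J_def[symmetric] K_def[symmetric] M_def[symmetric]
    using e11 e12 e21 e22 by simp
qed

lemma adj2_twist: "adj2 (twist X) = twist (adj2 X)"
proof -
  have "adj2 sigma3 = sigma3" by (simp add: sigma3_def adj2_mat22)
  then show ?thesis by (simp add: twist_def adj2_mult matrix_mul_assoc)
qed

lemma matrix_mult_holo:
  fixes X Y :: "complex \<Rightarrow> cmat2"
  assumes "\<And>i j. (\<lambda>l. entry (X l) i j) holomorphic_on S" "\<And>i j. (\<lambda>l. entry (Y l) i j) holomorphic_on S"
  shows "(\<lambda>l. entry (X l ** Y l) i j) holomorphic_on S"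
  unfolding matrix_matrix_mult_def using assms by (simp add: sum_2 holomorphic_intros)

lemma continuous_on_entries:
  fixes X :: "complex \<Rightarrow> cmat2"
  assumes "\<And>i j. continuous_on S (\<lambda>l. entry (X l) i j)"
  shows "continuous_on S X"
proof -
  have "continuous_on S (\<lambda>l. \<chi> i. \<chi> j. entry (X l) i j)" by (intro continuous_on_vec_lambda assms)
  then show ?thesis by simp
qed

theorem theorem5p6:
  shows "\<forall>z::complex. z \<notin> \<real>\<^sub>\<le>\<^sub>0 \<longrightarrow>
    (\<exists>F\<in>Loop_SU11. \<exists>B\<in>Loop_plus_pos_SL2C.
       \<forall>l\<in>sphere 0 1. phi z l = F l ** omega l ** B l)"
proof (intro allI impI)
  fix z :: complex assume "z \<notin> \<real>\<^sub>\<le>\<^sub>0"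
  then have z: "z \<noteq> 0" by auto
  define t where "t = (norm z)\<^sup>2 / 2"
  have t: "t > 0" using z by (simp add: t_def)
  obtain \<rho> where \<rho>: "\<rho> \<in> borel_measurable borel" "\<And>s. \<rho> s \<ge> 0" "\<And>s. s \<le> 0 \<Longrightarrow> \<rho> s = 0"
    "integrable lborel \<rho>" "integrable lborel (\<lambda>s. \<rho> s / s)"
    "\<And>s. s > 0 \<Longrightarrow> \<rho> s = exp (- 2 * t * (s + 1 / s)) / pi * (1 + (LINT v|lborel. \<rho> v / (v + s)))"
    by (rule neumann_solution[OF t]) (rule that | assumption)+
  interpret neumann t \<rho> by unfold_locales (fact t \<rho>)+
  obtain A1 A2 C1 C2 :: "complex \<Rightarrow> complex" and d :: real where d: "d > 0"
    and holo: "A1 holomorphic_on UNIV" "A2 holomorphic_on UNIV" "C1 holomorphic_on UNIV" "C2 holomorphic_on UNIV"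
    and par: "\<And>w. A1 (- w) = A1 w" "\<And>w. A2 (- w) = - A2 w" "\<And>w. C1 (- w) = C1 w" "\<And>w. C2 (- w) = - C2 w"
    and real0: "A1 0 \<in> \<real>" "C1 0 \<in> \<real>" and det: "\<And>w. A1 w * C1 w + A2 w * C2 w / 2 = of_real d"
    and circ: "\<And>w x. w \<in> slit \<Longrightarrow> norm w = 1 \<Longrightarrow> x = of_real t / w \<Longrightarrow> cnj (C1 w) * C1 w - cnj (A2 w) * A2 w / 4 = of_real d / 2 * (cnj (I0 x) * K0 x + I0 x * cnj (K0 x))"
    "\<And>w x. w \<in> slit \<Longrightarrow> norm w = 1 \<Longrightarrow> x = of_real t / w \<Longrightarrow> cnj (C1 w) * C2 w + cnj (A2 w) * A1 w / 2 = w * of_real d * (cnj (I0 x) * K1 x + cnj (K0 x) * I1 x)"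
    "\<And>w x. w \<in> slit \<Longrightarrow> norm w = 1 \<Longrightarrow> x = of_real t / w \<Longrightarrow> cnj (C2 w) * C2 w - cnj (A1 w) * A1 w = 2 * of_real d * (cnj (I1 x) * K1 x + I1 x * cnj (K1 x))"
    by (rule factor_exists) (rule that | assumption)+
  \<comment> \<open>A rotation of the circle depending on \<open>z\<close>: \<open>l * u\<close>
    equals \<open>t / x\<close>, so it is the variable \<open>w\<close> in which the factor was
    constructed.\<close>
  define u where "u = of_real ((norm z)\<^sup>2) / z\<^sup>2"
  have nu: "norm u = 1" using z by (simp add: u_def norm_divide norm_power)
  have uu: "cnj u * u = 1" "u * cnj u = 1" using nu by (metis complex_norm_square mult.commute of_real_1 one_power2)+
  define a0 where "a0 = Re (A1 0)"
  define c0 where "c0 = Re (C1 0)"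
  have A0: "A1 0 = of_real a0" and C0: "C1 0 = of_real c0" using real0 by (auto simp: a0_def c0_def elim!: Reals_cases)
  have odd0: "A2 0 = 0" "C2 0 = 0" using par(2)[of 0] par(4)[of 0] by auto
  have "complex_of_real (a0 * c0) = of_real d" using det[of 0] by (simp add: A0 C0 odd0)
  then have ac: "a0 * c0 = d" by (simp only: of_real_eq_iff)
  \<comment> \<open>Division by \<open>sqrt d\<close> normalises the determinant. As
    \<open>a0 * c0 = d > 0\<close>, the two values share their sign, and \<open>sgn a0\<close> makes
    the diagonal of \<open>B 0\<close> positive.\<close>
  define \<epsilon> where "\<epsilon> = sgn a0 / sqrt d"
  have \<epsilon>: "\<epsilon> * \<epsilon> = 1 / d" "\<epsilon> * c0 > 0"
  proof -
    have "a0 \<noteq> 0" using ac d by auto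
    then have "sgn a0 * sgn a0 = 1" by (simp add: sgn_if)
    then show "\<epsilon> * \<epsilon> = 1 / d" using d by (simp add: \<epsilon>_def)
    have "sgn a0 * c0 > 0" using ac d \<open>a0 \<noteq> 0\<close> by (auto simp: sgn_if zero_less_mult_iff)
    then show "\<epsilon> * c0 > 0" using d by (simp add: \<epsilon>_def)
  qed
  define k where "k = complex_of_real \<epsilon>"
  have k: "k * k = 1 / of_real d" "cnj k = k" using \<epsilon>(1) by (simp_all add: k_def flip: of_real_mult)
  have d0: "complex_of_real d \<noteq> 0" using d by simp
  have cancel: "- (1 / of_real d) * (of_real d / 2 * X) = - X / 2" "- (1 / of_real d) * (2 * of_real d * X) = - 2 * X" for X :: complex
    using d0 by (simp_all add: field_simps)
  \<comment> \<open>\<open>Bi\<close> has the column \<open>a\<close> and the column built from the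
    conjugates of \<open>c\<close>, both scaled by \<open>k\<close>; the ratios \<open>w / l\<close>
    and \<open>l / w\<close> become \<open>u\<close> and \<open>cnj u\<close>.\<close>
  define B where "B = (\<lambda>l. mat22 (k * C1 (l * u)) (k * cnj u * C2 (l * u)) (- k * u * A2 (l * u) / 2) (k * A1 (l * u)))"
  define Bi where "Bi = (\<lambda>l. mat22 (k * A1 (l * u)) (- k * cnj u * C2 (l * u)) (k * u * A2 (l * u) / 2) (k * C1 (l * u)))"
  define F where "F = (\<lambda>l. phi z l ** Bi l ** mat22 0 (- l) (inverse l) 0)"
  have hu: "(\<lambda>l. f (l * u)) holomorphic_on S" if "f holomorphic_on UNIV" for f S
  proof -
    have "(\<lambda>l. l * u) holomorphic_on S" by (intro holomorphic_intros)
    from holomorphic_on_compose_gen[OF this that] show ?thesis by (simp add: o_def)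
  qed
  have B_holo: "(\<lambda>l. entry (B l) i j) holomorphic_on S" and Bi_holo: "(\<lambda>l. entry (Bi l) i j) holomorphic_on S" for i j S
    unfolding B_def Bi_def by (intro mat22_holo holomorphic_intros hu holo; simp)+
  have dd: "k * A1 w * (k * C1 w) + (k * cnj u * C2 w) * (k * u * A2 w / 2) = 1" for w
  proof -
    have "k * A1 w * (k * C1 w) + (k * cnj u * C2 w) * (k * u * A2 w / 2) = (k * k) * (A1 w * C1 w + (cnj u * u) * (A2 w * C2 w / 2))"
      by (simp add: algebra_simps)
    then show ?thesis unfolding uu k using det[of w] d0 by simp
  qed
  have BBi: "B l ** Bi l = mat 1" "Bi l ** B l = mat 1" and detB: "det (B l) = 1" "det (Bi l) = 1" for l
    using dd[of "l * u"] by (simp_all add: B_def Bi_def mat22_mult one_mat22 mat22_eq_iff det_mat22 algebra_simps)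
  have B_twist: "B (- l) = twist (B l)" and Bi_twist: "Bi (- l) = twist (Bi l)" for l
    by (simp_all add: B_def Bi_def twist_mat22 par mat22_eq_iff)
  have F_twist: "F (- l) = twist (F l)" if "l \<noteq> 0" for l
    unfolding F_def twist_mult Bi_twist phi_twist[OF that z] by (simp add: twist_mat22)
  have herm: "adj2 (phi z l) ** sigma3 ** phi z l = adj2 (B l) ** mat22 (- 1) 0 0 1 ** B l"
    if l: "norm l = 1" and w: "l * u \<in> slit" for l
  proof -
    define x where "x = z\<^sup>2 / (2 * l)"
    have l0: "l \<noteq> 0" using l by auto
    have nw: "norm (l * u) = 1" using l nu by (simp add: norm_mult)
    have x: "x = of_real t / (l * u)" using z l0 by (simp add: x_def u_def t_def field_simps)
    note c = circ[OF w nw x]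
    define m where "m = cnj (I0 x) * K1 x + cnj (K0 x) * I1 x"
    define c1 c2 a1 a2 where "c1 = C1 (l * u)" and "c2 = C2 (l * u)" and "a1 = A1 (l * u)" and "a2 = A2 (l * u)"
    note c' = c[folded c1_def c2_def a1_def a2_def m_def]
    have e11: "- cnj (k * c1) * (k * c1) + cnj (- k * u * a2 / 2) * (- k * u * a2 / 2) = - (cnj (I0 x) * K0 x + I0 x * cnj (K0 x)) / 2"
    proof -
      have "- cnj (k * c1) * (k * c1) + cnj (- k * u * a2 / 2) * (- k * u * a2 / 2) = - (k * k) * (cnj c1 * c1 - (cnj u * u) * (cnj a2 * a2 / 4))"
        using k(2) by (simp add: algebra_simps)
      also have "\<dots> = - (k * k) * (of_real d / 2 * (cnj (I0 x) * K0 x + I0 x * cnj (K0 x)))"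
        unfolding uu using c'(1) by simp
      finally show ?thesis unfolding k(1) cancel .
    qed
    have e12: "- cnj (k * c1) * (k * cnj u * c2) + cnj (- k * u * a2 / 2) * (k * a1) = - l * m"
    proof -
      have "- cnj (k * c1) * (k * cnj u * c2) + cnj (- k * u * a2 / 2) * (k * a1) = - (k * k) * cnj u * (cnj c1 * c2 + cnj a2 * a1 / 2)"
        using k(2) by (simp add: algebra_simps)
      also have "\<dots> = - (k * k) * (cnj u * u) * l * of_real d * m" unfolding c'(2) by (simp add: mult_ac)
      finally show ?thesis unfolding uu k using d0 by simp
    qed
    have e22: "- cnj (k * cnj u * c2) * (k * cnj u * c2) + cnj (k * a1) * (k * a1) = - 2 * (cnj (I1 x) * K1 x + I1 x * cnj (K1 x))"
    proof -
      have "- cnj (k * cnj u * c2) * (k * cnj u * c2) + cnj (k * a1) * (k * a1) = - (k * k) * ((u * cnj u) * (cnj c2 * c2) - cnj a1 * a1)"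
        using k(2) by (simp add: algebra_simps)
      also have "\<dots> = - (k * k) * (2 * of_real d * (cnj (I1 x) * K1 x + I1 x * cnj (K1 x)))"
        unfolding uu using c'(3) by simp
      finally show ?thesis unfolding k(1) cancel .
    qed
    have e21: "- cnj (k * cnj u * c2) * (k * c1) + cnj (k * a1) * (- k * u * a2 / 2) = - cnj l * cnj m"
      using arg_cong[OF e12, of cnj] by (simp add: mult.commute)
    show ?thesis
      unfolding phi_hermitian[OF l z] x_def[symmetric] m_def[symmetric] B_def adj2_mat22 mat22_mult mat22_eq_iff
        c1_def[symmetric] c2_def[symmetric] a1_def[symmetric] a2_def[symmetric]
      using e11 e12 e21 e22 by simp
  qed
  have F_herm: "F l ** sigma3 ** adj2 (F l) = sigma3" if l: "norm l = 1" for l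
  proof (cases "l * u \<in> slit")
    case True
    show ?thesis unfolding F_def by (rule su11_of_hermitian_eq[OF l BBi(1) herm[OF l True]])
  next
    case False
    \<comment> \<open>The identities on the circle are stated on \<open>slit\<close>, which leaves
      the single \<open>l\<close> with \<open>l * u = - 1\<close>. There \<open>- l\<close> is
      admissible, and the twist symmetry of \<open>F\<close> transfers the result.\<close>
    have nl: "norm (- l) = 1" "- l \<noteq> 0" using l by auto
    have "l * u \<noteq> 0" using l nu by auto
    then have "- l * u \<in> slit" using False by (auto simp: complex_nonpos_Reals_iff complex_eq_iff)
    then have *: "F (- l) ** sigma3 ** adj2 (F (- l)) = sigma3"
      unfolding F_def by (intro su11_of_hermitian_eq[OF nl(1) BBi(1)] herm[OF nl(1)])
    have "F l = twist (F (- l))" using F_twist[OF nl(2)] by simp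
    moreover have ts: "twist sigma3 = sigma3" by (simp add: sigma3_def twist_mat22)
    ultimately have "F l ** sigma3 ** adj2 (F l) = twist (F (- l) ** sigma3 ** adj2 (F (- l)))"
      by (simp add: twist_mult adj2_twist)
    then show ?thesis using * ts by simp
  qed
  have F_loop: "F \<in> Loop_SL2C"
  proof -
    have "smooth_on_circle F"
    proof (rule smooth_on_circle_holomorphic)
      show "(\<lambda>l. entry (F l) i j) holomorphic_on - {0}" for i j
        unfolding F_def by (intro matrix_mult_holo phi_holo z Bi_holo mat22_holo holomorphic_intros) auto
    qed
    moreover have "F l \<in> SL2C" if "l \<noteq> 0" for l
      using that by (simp add: SL2C_def F_def det_mul phi_det z detB det_mat22)
    moreover have "l \<noteq> 0" if "l \<in> sphere 0 1" for l :: complex using that by auto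
    ultimately show ?thesis using F_twist by (simp add: Loop_SL2C_def)
  qed
  have "F \<in> Loop_SU11"
  proof -
    have "F l ** sigma3 ** transpose (map_matrix cnj (F (cnj (inverse l)))) = sigma3" if l: "norm l = 1" for l
    proof -
      have "cnj l * l = 1" "l \<noteq> 0" using l by (metis complex_norm_square mult.commute of_real_1 one_power2) (use l in auto)
      then have "cnj (inverse l) = l" by (simp add: field_simps)
      then show ?thesis using F_herm[OF l] by (simp add: adj2_def)
    qed
    then show ?thesis using F_loop by (simp add: Loop_SU11_def)
  qed
  moreover have "B \<in> Loop_plus_pos_SL2C"
  proof -
    have "B \<in> Loop_SL2C"
      using smooth_on_circle_holomorphic[OF B_holo] detB B_twist by (auto simp: Loop_SL2C_def SL2C_def)
    moreover have ext: "disc_extension B B"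
      unfolding disc_extension_def SL2C_def using B_holo detB
      by (auto intro!: continuous_on_entries holomorphic_on_imp_continuous_on[OF B_holo])
    moreover have "B 0 = mat22 (of_real (\<epsilon> * c0)) 0 0 (of_real (inverse (\<epsilon> * c0)))"
    proof -
      have "(\<epsilon> * a0) * (\<epsilon> * c0) = (\<epsilon> * \<epsilon>) * (a0 * c0)" by simp
      also have "\<dots> = 1" unfolding \<epsilon>(1) ac using d by simp
      finally have "inverse (\<epsilon> * c0) = \<epsilon> * a0" using inverse_unique[of "\<epsilon> * c0" "\<epsilon> * a0"] by (simp add: mult.commute)
      then show ?thesis by (simp only: B_def mult_zero_left odd0 A0 C0 k_def) (simp add: mat22_eq_iff)
    qed
    ultimately show ?thesis using \<epsilon>(2) unfolding Loop_plus_pos_SL2C_def Loop_plus_SL2C_def by blast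
  qed
  moreover have "phi z l = F l ** omega l ** B l" if "l \<in> sphere 0 1" for l
  proof -
    have "mat22 0 (- l) (inverse l) 0 ** omega l = mat 1"
    proof -
      have "l \<noteq> 0" using that by auto
      then show ?thesis by (simp add: omega_def mat22_mult one_mat22 mat22_eq_iff)
    qed
    then have "F l ** omega l ** B l = phi z l ** (Bi l ** B l)"
      unfolding F_def by (metis matrix_mul_assoc matrix_mul_rid)
    then show ?thesis by (simp add: BBi)
  qed
  ultimately show "\<exists>F\<in>Loop_SU11. \<exists>B\<in>Loop_plus_pos_SL2C. \<forall>l\<in>sphere 0 1. phi z l = F l ** omega l ** B l"
    by blast
qed

end
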